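(* The \textsc{Unsplittable Flow} problem (as defined in the context) is in XP when parameterized by the combined parameter $c+\mathrm{tw}+\Delta$, where $c$ is the maximum edge capacity, $\mathrm{tw}$ is the treewidth of the input graph and $\Delta$ is the maximum degree of the input graph. That is, it can be solved in time $|\mathbb{I}|^{f(c,\mathrm{tw},\Delta)}$ for some computable function $f$, where $|\mathbb{I}|$ is the instance size.
   Context: \textsc{Unsplittable Flow} (decision version): an instance $\mathbb{I}$ consists of a simple undirected graph $G=(V,E)$; a capacity function $\gamma:E\to\mathbb{N}$, encoded in unary; a set $\mathcal{T}$ of tasks, each task being a tuple $(s,t,d,w)\in V\times V\times\mathbb{N}\times\mathbb{N}$ with endpoints $s,t$, demand $d$ and profit $w$; a profit target $\tau\in\mathbb{N}$; and an integer length bound $\ell$. For a subset $T'\subseteq\mathcal{T}$, a flow routing assigns to each task $(s,t,d,w)\in T'$ an $s$-$t$ path in $G$ of length at most $\ell$ such that for every edge $e\in E$ the sum of the demands of the tasks in $T'$ whose assigned path uses $e$ is at most $\gamma(e)$. The question is whether there is a subset $T'$ admitting a flow routing whose total profit $\sum_{(s,t,d,w)\in T'} w$ is at least $\tau$. The instance size $|\mathbb{I}|$ is the total size of all components (so it upper-bounds the maximum capacity). The maximum capacity is $c=\max_{e\in E}\gamma(e)$. *)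

theory Defs
  imports Main
begin

section \<open>Simple graphs and treewidth\<close>

record 'v sgraph =
  verts :: "'v set"
  edges :: "'v set set"

definition simple_graph :: "'v sgraph \<Rightarrow> bool" where
  "simple_graph G \<longleftrightarrow> finite (verts G) \<and>
     (\<forall>e\<in>edges G. \<exists>u\<in>verts G. \<exists>v\<in>verts G. u \<noteq> v \<and> e = {u, v})"

definition is_path :: "'v sgraph \<Rightarrow> 'v \<Rightarrow> 'v \<Rightarrow> 'v list \<Rightarrow> bool" where
  "is_path G s t p \<longleftrightarrow> p \<noteq> [] \<and> hd p = s \<and> last p = t \<and> distinct p \<and> set p \<subseteq> verts G \<and>
     successively (\<lambda>u v. {u, v} \<in> edges G) p"

definition path_edges :: "'v list \<Rightarrow> 'v set set" where
  "path_edges p = {{p ! i, p ! Suc i} | i. Suc i < length p}"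

definition path_length :: "'v list \<Rightarrow> nat" where
  "path_length p = length p - 1"

definition is_connected :: "'v sgraph \<Rightarrow> bool" where
  "is_connected G \<longleftrightarrow> (\<forall>u\<in>verts G. \<forall>v\<in>verts G. \<exists>p. is_path G u v p)"

definition is_cycle :: "'v sgraph \<Rightarrow> 'v list \<Rightarrow> bool" where
  "is_cycle G p \<longleftrightarrow> 3 \<le> length p \<and> is_path G (hd p) (last p) p \<and> {last p, hd p} \<in> edges G"

definition is_tree :: "'v sgraph \<Rightarrow> bool" where
  "is_tree G \<longleftrightarrow> simple_graph G \<and> verts G \<noteq> {} \<and> is_connected G \<and> (\<nexists>p. is_cycle G p)"

definition induced :: "'v sgraph \<Rightarrow> 'v set \<Rightarrow> 'v sgraph" where
  "induced G W = \<lparr>verts = verts G \<inter> W, edges = {e \<in> edges G. e \<subseteq> W}\<rparr>"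

definition degree :: "'v sgraph \<Rightarrow> 'v \<Rightarrow> nat" where
  "degree G v = card {e \<in> edges G. v \<in> e}"

(* The element 0 only matters for the graph without vertices. *)
definition max_degree :: "'v sgraph \<Rightarrow> nat" where
  "max_degree G = Max (insert 0 (degree G ` verts G))"

definition tree_decomposition :: "'v sgraph \<Rightarrow> nat sgraph \<Rightarrow> (nat \<Rightarrow> 'v set) \<Rightarrow> bool" where
  "tree_decomposition G T bag \<longleftrightarrow> is_tree T \<and>
     (\<Union>i\<in>verts T. bag i) = verts G \<and>
     (\<forall>e\<in>edges G. \<exists>i\<in>verts T. e \<subseteq> bag i) \<and>
     (\<forall>v\<in>verts G. is_connected (induced T {i. v \<in> bag i}))"

(* Truncated subtraction: the graph without vertices gets treewidth 0 instead of -1. *)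
definition width :: "nat sgraph \<Rightarrow> (nat \<Rightarrow> 'v set) \<Rightarrow> nat" where
  "width T bag = Max ((\<lambda>i. card (bag i)) ` verts T) - 1"

definition treewidth :: "'v sgraph \<Rightarrow> nat" where
  "treewidth G = (LEAST k. \<exists>T bag. tree_decomposition G T bag \<and> width T bag = k)"


section \<open>Unsplittable Flow\<close>

(* source, sink, demand, profit *)
type_synonym task = "nat \<times> nat \<times> nat \<times> nat"

fun source :: "task \<Rightarrow> nat" where "source (s, t, d, w) = s"
fun sink :: "task \<Rightarrow> nat" where "sink (s, t, d, w) = t"
fun demand :: "task \<Rightarrow> nat" where "demand (s, t, d, w) = d"
fun profit :: "task \<Rightarrow> nat" where "profit (s, t, d, w) = w"

(* Vertices are named by natural numbers so that instances can be written down. *)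
record uf_instance =
  graph :: "nat sgraph"
  capacity :: "nat set \<Rightarrow> nat"
  tasks :: "task set"
  target :: nat
  len_bound :: int

definition valid_instance :: "uf_instance \<Rightarrow> bool" where
  "valid_instance I \<longleftrightarrow> simple_graph (graph I) \<and> finite (tasks I) \<and>
     (\<forall>a\<in>tasks I. source a \<in> verts (graph I) \<and> sink a \<in> verts (graph I))"

definition flow_routing :: "uf_instance \<Rightarrow> task set \<Rightarrow> (task \<Rightarrow> nat list) \<Rightarrow> bool" where
  "flow_routing I A R \<longleftrightarrow>
     (\<forall>a\<in>A. is_path (graph I) (source a) (sink a) (R a) \<and> int (path_length (R a)) \<le> len_bound I) \<and>
     (\<forall>e\<in>edges (graph I). (\<Sum>a | a \<in> A \<and> e \<in> path_edges (R a). demand a) \<le> capacity I e)"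

definition uf_yes :: "uf_instance \<Rightarrow> bool" where
  "uf_yes I \<longleftrightarrow> (\<exists>A\<subseteq>tasks I. (\<exists>R. flow_routing I A R) \<and> target I \<le> (\<Sum>a\<in>A. profit a))"

(* The element 0 only matters for graphs without edges. *)
definition max_capacity :: "uf_instance \<Rightarrow> nat" where
  "max_capacity I = Max (insert 0 (capacity I ` edges (graph I)))"


section \<open>Machine model\<close>

text \<open>
  Algorithms are programs of the WHILE language of N. D. Jones (\<^emph>\<open>Computability and Complexity
  from a Programming Perspective\<close>, MIT Press 1997), in three-address form and with a conditional.
  Data are binary trees (S-expressions); every instruction and every test costs one unit of time.
  Values can be shared, so a run of \<open>t\<close> instructions creates at most \<open>t\<close> new cells and can be
  simulated by a Turing machine in time polynomial in \<open>t\<close> and the input size; conversely,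
  Turing machines are simulated with polynomial overhead. The number of \<open>CONS\<close> cells of a tree
  is its \<open>size\<close>.
\<close>

datatype sexp = NIL | CONS sexp sexp

fun left :: "sexp \<Rightarrow> sexp" where
  "left NIL = NIL"
| "left (CONS x y) = x"

fun right :: "sexp \<Rightarrow> sexp" where
  "right NIL = NIL"
| "right (CONS x y) = y"

type_synonym var = nat

datatype prog =
    SetNil var
  | Copy var var
  | SetCons var var var
  | SetLeft var var
  | SetRight var var
  | Seq prog prog
  | IfCons var prog prog
  | WhileCons var prog

type_synonym state = "var \<Rightarrow> sexp"

inductive exec :: "prog \<Rightarrow> state \<Rightarrow> nat \<Rightarrow> state \<Rightarrow> bool" where
  SetNil: "exec (SetNil x) s 1 (s(x := NIL))"
| Copy: "exec (Copy x y) s 1 (s(x := s y))"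
| SetCons: "exec (SetCons x y z) s 1 (s(x := CONS (s y) (s z)))"
| SetLeft: "exec (SetLeft x y) s 1 (s(x := left (s y)))"
| SetRight: "exec (SetRight x y) s 1 (s(x := right (s y)))"
| Seq: "exec p s m s' \<Longrightarrow> exec q s' n s'' \<Longrightarrow> exec (Seq p q) s (m + n) s''"
| IfTrue: "s x \<noteq> NIL \<Longrightarrow> exec p s n s' \<Longrightarrow> exec (IfCons x p q) s (Suc n) s'"
| IfFalse: "s x = NIL \<Longrightarrow> exec q s n s' \<Longrightarrow> exec (IfCons x p q) s (Suc n) s'"
| WhileFalse: "s x = NIL \<Longrightarrow> exec (WhileCons x p) s 1 s"
| WhileTrue: "s x \<noteq> NIL \<Longrightarrow> exec p s m s' \<Longrightarrow> exec (WhileCons x p) s' n s'' \<Longrightarrow>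
    exec (WhileCons x p) s (Suc (m + n)) s''"

definition runs :: "prog \<Rightarrow> sexp \<Rightarrow> nat \<Rightarrow> sexp \<Rightarrow> bool" where
  "runs p inp n out \<longleftrightarrow> (\<exists>s. exec p ((\<lambda>_. NIL)(0 := inp)) n s \<and> s 0 = out)"

definition decides_in_time :: "prog \<Rightarrow> sexp \<Rightarrow> nat \<Rightarrow> bool \<Rightarrow> bool" where
  "decides_in_time p inp n answer \<longleftrightarrow> (\<exists>m\<le>n. \<exists>out. runs p inp m out \<and> (out \<noteq> NIL \<longleftrightarrow> answer))"


section \<open>Encodings\<close>

fun enc_list :: "sexp list \<Rightarrow> sexp" where
  "enc_list [] = NIL"
| "enc_list (x # xs) = CONS x (enc_list xs)"

definition enc_bool :: "bool \<Rightarrow> sexp" where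
  "enc_bool b = (if b then CONS NIL NIL else NIL)"

definition enc_unary :: "nat \<Rightarrow> sexp" where
  "enc_unary n = enc_list (replicate n NIL)"

(* binary digits, least significant first, no leading zeros *)
fun bits :: "nat \<Rightarrow> bool list" where
  "bits n = (if n = 0 then [] else odd n # bits (n div 2))"

declare bits.simps [simp del]

definition enc_nat :: "nat \<Rightarrow> sexp" where
  "enc_nat n = enc_list (map enc_bool (bits n))"

definition enc_int :: "int \<Rightarrow> sexp" where
  "enc_int i = CONS (enc_bool (i < 0)) (enc_nat (nat \<bar>i\<bar>))"

definition enc_edge :: "(nat set \<Rightarrow> nat) \<Rightarrow> nat \<times> nat \<Rightarrow> sexp" where
  "enc_edge \<gamma> = (\<lambda>(u, v). enc_list [enc_nat u, enc_nat v, enc_unary (\<gamma> {u, v})])"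

definition enc_task :: "task \<Rightarrow> sexp" where
  "enc_task = (\<lambda>(s, t, d, w). enc_list [enc_nat s, enc_nat t, enc_nat d, enc_nat w])"

(* A relation, since the vertices, edges (with either orientation) and tasks of an instance may be
   listed in any order; the size of the encoding does not depend on these choices. *)
definition encodes :: "uf_instance \<Rightarrow> sexp \<Rightarrow> bool" where
  "encodes I x \<longleftrightarrow> (\<exists>vs es as.
     set vs = verts (graph I) \<and> distinct vs \<and>
     set (map (\<lambda>(u, v). {u, v}) es) = edges (graph I) \<and> distinct (map (\<lambda>(u, v). {u, v}) es) \<and>
     set as = tasks I \<and> distinct as \<and>
     x = enc_list [enc_list (map enc_nat vs), enc_list (map (enc_edge (capacity I)) es),
           enc_list (map enc_task as), enc_nat (target I), enc_int (len_bound I)])"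

definition computable3 :: "(nat \<Rightarrow> nat \<Rightarrow> nat \<Rightarrow> nat) \<Rightarrow> bool" where
  "computable3 f \<longleftrightarrow> (\<exists>p. \<forall>a b c. \<exists>n.
     runs p (enc_list [enc_unary a, enc_unary b, enc_unary c]) n (enc_unary (f a b c)))"

end

theory Submission
  imports Defs
begin

text \<open>
  Tasks with demand 0 or with equal endpoints use no capacity and are decided by breadth-first search.
  A routing of the other tasks is described by items \<open>(v, a, i, q)\<close>: task \<open>a\<close> visits \<open>v\<close> with a remaining
  length budget \<open>i\<close> and continues to \<open>q\<close>. Since \<open>i\<close> decreases along edges, all constraints involve only
  single vertices and edges, and at most \<open>c\<Delta>\<close> items are needed at a vertex. It remains to maximise a sum
  of vertex weights under local constraints on a graph of bounded treewidth.

  No tree decomposition is computed. For a set \<open>B\<close> of vertices and a component \<open>C\<close> of \<open>G - B\<close>, every set \<open>B'\<close>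
  with \<open>N(C) \<subseteq> B' \<subseteq> N(C) \<union> C\<close> gives a correct recursion from \<open>C\<close> to the components of \<open>C - B'\<close>, so the
  dynamic program maximises over all \<open>B'\<close> of load at most \<open>K\<close> and all items on \<open>B'\<close>. Its value is exact as
  soon as the recursion reaches the empty set along some choice of bags; this is visible to the
  algorithm, because the empty set of items is always feasible. Hence \<open>K\<close> can be increased until this happens,
  which is at the latest at \<open>(tw + 1)(1 + c\<Delta>)\<close>, since then the bags of a tree decomposition are among the choices.
\<close>

section \<open>Polynomial-time functions on S-expressions\<close>

text \<open>Local constraints alone could be met by items that run in a circle and never reach the
  sink. The budget \<open>i\<close> excludes this: it drops with every edge and must be positive
  away from the sink. Stray items that belong to no route are harmless, since they earn nothing
  unless they sit at a source and otherwise only add load to edges. A task of positive demand with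
  distinct endpoints takes a unit of capacity on some edge at each vertex it visits. Hence the
  weight of a vertex is one for the vertex itself plus the capacities of its incident edges, and a
  single number \<open>K\<close> bounds both the word for a bag and the word for the items on it.
  Tasks of demand 0 would break this count. Whether the recursion ends in time depends only on the
  bags, never on items or profits. A nonempty list of results therefore certifies that a suitable
  recursion exists, and completeness then holds for all solutions at once. As every step is a
  program to be verified, the algorithm consists of exhaustive search, filters and folds over lists;
  an XP bound leaves room for that.\<close>

fun vars :: "prog \<Rightarrow> var set" where
  "vars (SetNil x) = {x}"
| "vars (Copy x y) = {x, y}"
| "vars (SetCons x y z) = {x, y, z}"
| "vars (SetLeft x y) = {x, y}"
| "vars (SetRight x y) = {x, y}"
| "vars (Seq p q) = vars p \<union> vars q"
| "vars (IfCons x p q) = insert x (vars p \<union> vars q)"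
| "vars (WhileCons x p) = insert x (vars p)"

lemma finite_vars [simp]: "finite (vars p)"
  by (induction p) auto

lemma exec_frame: "exec p s n s' \<Longrightarrow> x \<notin> vars p \<Longrightarrow> s' x = s x"
  by (induction rule: exec.induct) auto

lemma fresh_var: "finite X \<Longrightarrow> \<exists>v::var. v \<notin> X"
  by (rule ex_new_if_finite) auto

section \<open>Time-bounded weakest preconditions\<close>

definition wp :: "prog \<Rightarrow> nat \<Rightarrow> (state \<Rightarrow> bool) \<Rightarrow> state \<Rightarrow> bool" where
  "wp p b Q s \<longleftrightarrow> (\<exists>n s'. exec p s n s' \<and> n \<le> b \<and> Q s')"

lemma wp_SetNil: "Q (s(x := NIL)) \<Longrightarrow> wp (SetNil x) 1 Q s"
  unfolding wp_def using exec.SetNil by blast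

lemma wp_Copy: "Q (s(x := s y)) \<Longrightarrow> wp (Copy x y) 1 Q s"
  unfolding wp_def using exec.Copy by blast

lemma wp_SetCons: "Q (s(x := CONS (s y) (s z))) \<Longrightarrow> wp (SetCons x y z) 1 Q s"
  unfolding wp_def using exec.SetCons by blast

lemma wp_SetLeft: "Q (s(x := left (s y))) \<Longrightarrow> wp (SetLeft x y) 1 Q s"
  unfolding wp_def using exec.SetLeft by blast

lemma wp_SetRight: "Q (s(x := right (s y))) \<Longrightarrow> wp (SetRight x y) 1 Q s"
  unfolding wp_def using exec.SetRight by blast

text \<open>The budgets of the two halves add up, so applying the rules backwards builds the running
  time as a term while it proves the postcondition.\<close>

lemma wp_Seq:
  assumes "wp p b (wp q c Q) s"
  shows "wp (Seq p q) (b + c) Q s"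
proof -
  obtain n s' m s'' where "exec p s n s'" "n \<le> b" "exec q s' m s''" "m \<le> c" "Q s''"
    using assms unfolding wp_def by blast
  then show ?thesis
    unfolding wp_def using exec.Seq add_mono by blast
qed

lemma wp_If:
  assumes "s x \<noteq> NIL \<Longrightarrow> wp p b Q s" and "s x = NIL \<Longrightarrow> wp q b Q s"
  shows "wp (IfCons x p q) (Suc b) Q s"
proof (cases "s x = NIL")
  case True
  then show ?thesis
    using assms(2) exec.IfFalse unfolding wp_def by (meson Suc_le_mono)
next
  case False
  then show ?thesis
    using assms(1) exec.IfTrue unfolding wp_def by (meson Suc_le_mono)
qed

lemma wp_While_False: "s x = NIL \<Longrightarrow> Q s \<Longrightarrow> wp (WhileCons x p) 1 Q s"
  unfolding wp_def using exec.WhileFalse by blast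

lemma wp_While_True:
  assumes "s x \<noteq> NIL" and "wp p b (wp (WhileCons x p) c Q) s"
  shows "wp (WhileCons x p) (Suc (b + c)) Q s"
proof -
  obtain n s' m s'' where "exec p s n s'" "n \<le> b" "exec (WhileCons x p) s' m s''" "m \<le> c" "Q s''"
    using assms unfolding wp_def by blast
  then show ?thesis
    unfolding wp_def using exec.WhileTrue[of s x p n s' m s''] assms(1)
    by (meson Suc_le_mono add_mono)
qed

lemma wp_mono: "wp p b Q s \<Longrightarrow> b \<le> c \<Longrightarrow> (\<And>s'. Q s' \<Longrightarrow> R s') \<Longrightarrow> wp p c R s"
  unfolding wp_def by (meson le_trans)

lemma wp_frame: "wp p b Q s \<Longrightarrow> wp p b (\<lambda>s'. Q s' \<and> (\<forall>x. x \<notin> vars p \<longrightarrow> s' x = s x)) s"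
  unfolding wp_def using exec_frame by blast

text \<open>Variable 0 is both input and output, and the initial contents of all other variables are
  arbitrary. Programs can therefore be chained without clearing their work variables.\<close>

definition computes :: "prog \<Rightarrow> (sexp \<Rightarrow> sexp) \<Rightarrow> (sexp \<Rightarrow> nat) \<Rightarrow> bool" where
  "computes p F b \<longleftrightarrow> (\<forall>s. wp p (b (s 0)) (\<lambda>s'. s' 0 = F (s 0)) s)"

text \<open>Combines the specification with the frame property, so that a caller may keep values in
  variables foreign to \<open>p\<close> while \<open>p\<close> runs.\<close>

lemma computes_wp:
  assumes "computes p F b" and "s 0 = e"
    and "\<And>s'. s' 0 = F e \<Longrightarrow> (\<And>x. x \<notin> vars p \<Longrightarrow> s' x = s x) \<Longrightarrow> Q s'"
  shows "wp p (b e) Q s"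
proof -
  have "wp p (b e) (\<lambda>s'. s' 0 = F e) s"
    using assms(1,2) unfolding computes_def by blast
  from wp_frame[OF this] show ?thesis
    by (rule wp_mono) (use assms(3) in auto)
qed

section \<open>Polynomial bounds in the size of a tree\<close>

definition pbd :: "(sexp \<Rightarrow> nat) \<Rightarrow> bool" where
  "pbd b \<longleftrightarrow> (\<exists>c. \<forall>e. b e \<le> (size e + 2) ^ c)"

lemma pbdI: "(\<And>e. b e \<le> (size e + 2) ^ c) \<Longrightarrow> pbd b"
  unfolding pbd_def by blast

lemma pbd_mono: "pbd b \<Longrightarrow> (\<And>e. a e \<le> b e) \<Longrightarrow> pbd a"
  unfolding pbd_def by (meson le_trans)

lemma pbd_const: "pbd (\<lambda>_. k)"
proof (rule pbdI)
  fix e :: sexp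
  have "k \<le> 2 ^ k"
    by (simp add: order.strict_implies_order)
  also have "\<dots> \<le> (size e + 2) ^ k"
    by (rule power_mono) auto
  finally show "k \<le> (size e + 2) ^ k" .
qed

lemma pbd_size: "pbd size"
  by (rule pbdI[where c = 1]) simp

lemma pbd_mult:
  assumes "pbd a" "pbd b"
  shows "pbd (\<lambda>e. a e * b e)"
proof -
  obtain c d where "\<And>e. a e \<le> (size e + 2) ^ c" "\<And>e. b e \<le> (size e + 2) ^ d"
    using assms unfolding pbd_def by blast
  then have "\<And>e. a e * b e \<le> (size e + 2) ^ (c + d)"
    by (simp add: mult_mono power_add)
  then show ?thesis by (rule pbdI)
qed

text \<open>The base \<open>size e + 2\<close> is at least 2, so one more factor absorbs a doubling;
  a sum is then bounded by the product of the summands increased by 1.\<close>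

lemma pbd_add:
  assumes "pbd a" "pbd b"
  shows "pbd (\<lambda>e. a e + b e)"
proof -
  have "pbd (\<lambda>e. (a e + 1) * (b e + 1))" if "pbd (\<lambda>e. a e + 1)" "pbd (\<lambda>e. b e + 1)"
    using that by (rule pbd_mult)
  moreover have "pbd (\<lambda>e. f e + 1)" if f: "pbd f" for f
  proof -
    obtain c where c: "\<And>e. f e \<le> (size e + 2) ^ c"
      using f unfolding pbd_def by blast
    have "f e + 1 \<le> (size e + 2) ^ Suc c" for e
    proof -
      have "f e + 1 \<le> (size e + 2) ^ c + (size e + 2) ^ c"
        using c[of e] by (metis add_mono one_le_numeral one_le_power trans_le_add2)
      also have "\<dots> \<le> (size e + 2) ^ Suc c" by simp
      finally show ?thesis .
    qed
    then show ?thesis by (rule pbdI)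
  qed
  ultimately have "pbd (\<lambda>e. (a e + 1) * (b e + 1))"
    using assms by blast
  then show ?thesis by (rule pbd_mono) simp
qed

lemma pbd_comp:
  assumes "pbd b" "pbd (\<lambda>e. size (F e))"
  shows "pbd (\<lambda>e. b (F e))"
proof -
  obtain c where c: "\<And>e. b e \<le> (size e + 2) ^ c"
    using assms(1) unfolding pbd_def by blast
  have "pbd (\<lambda>e. size (F e) + 2)"
    by (intro pbd_add assms pbd_const)
  then obtain d where "\<And>e. size (F e) + 2 \<le> (size e + 2) ^ d"
    unfolding pbd_def by blast
  then have "\<And>e. b (F e) \<le> (size e + 2) ^ (d * c)"
    using c by (metis (no_types, lifting) le_trans power_mono power_mult zero_le)
  then show ?thesis by (rule pbdI)
qed

text \<open>A bound for each input becomes a monotone function of the size alone. Loops need this,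
  because only the size of their intermediate values is controlled.\<close>

lemma pbd_bound:
  assumes "pbd b"
  obtains B where "pbd (\<lambda>e. B (size e))" "mono B" "\<And>e. b e \<le> B (size e)"
proof -
  obtain c where c: "\<And>e. b e \<le> (size e + 2) ^ c"
    using assms unfolding pbd_def by blast
  show ?thesis
  proof (rule that)
    show "pbd (\<lambda>e. (size e + 2) ^ c)" by (rule pbdI[where c = c]) simp
    show "mono (\<lambda>m::nat. (m + 2) ^ c)" by (intro monoI power_mono) auto
    show "b e \<le> (size e + 2) ^ c" for e by (rule c)
  qed
qed

text \<open>Subtrees can be shared while \<open>size\<close> counts every repetition, so
  \<open>t\<close> instructions may build a tree of size exponential in \<open>t\<close>. A
  polynomial running time hence does not bound the output, and composition requires the second
  conjunct.\<close>

definition pt :: "(sexp \<Rightarrow> sexp) \<Rightarrow> bool" where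
  "pt F \<longleftrightarrow> (\<exists>p b. computes p F b \<and> pbd b) \<and> pbd (\<lambda>e. size (F e))"

lemma ptI: "computes p F b \<Longrightarrow> pbd b \<Longrightarrow> pbd (\<lambda>e. size (F e)) \<Longrightarrow> pt F"
  unfolding pt_def by blast

lemma ptE:
  assumes "pt F"
  obtains p b where "computes p F b" "pbd b" "pbd (\<lambda>e. size (F e))"
  using assms unfolding pt_def by blast

lemma pt_pbd: "pt F \<Longrightarrow> pbd (\<lambda>e. size (F e))"
  unfolding pt_def by blast

lemma pt_cong: "pt f \<Longrightarrow> (\<And>e. f e = g e) \<Longrightarrow> pt g"
  by (drule ext) simp

lemma pt_id: "pt (\<lambda>e. e)"
proof (rule ptI)
  show "computes (Copy 0 0) (\<lambda>e. e) (\<lambda>_. 1)"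
    unfolding computes_def by (intro allI wp_Copy) simp
qed (auto intro: pbd_const pbd_size)

lemma pt_NIL: "pt (\<lambda>_. NIL)"
proof (rule ptI)
  show "computes (SetNil 0) (\<lambda>_. NIL) (\<lambda>_. 1)"
    unfolding computes_def by (intro allI wp_SetNil) simp
qed (auto intro: pbd_const)

lemma pt_comp:
  assumes "pt f" "pt g"
  shows "pt (\<lambda>e. g (f e))"
proof -
  obtain p b where p: "computes p f b" "pbd b" "pbd (\<lambda>e. size (f e))" using assms(1) by (rule ptE)
  obtain q c where q: "computes q g c" "pbd c" "pbd (\<lambda>e. size (g e))" using assms(2) by (rule ptE)
  show ?thesis
  proof (rule ptI)
    show "computes (Seq p q) (\<lambda>e. g (f e)) (\<lambda>e. b e + c (f e))"
      unfolding computes_def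
      by (intro allI wp_Seq computes_wp[OF p(1) refl] computes_wp[OF q(1)]) auto
    show "pbd (\<lambda>e. b e + c (f e))" by (intro pbd_add p pbd_comp[OF q(2)])
    show "pbd (\<lambda>e. size (g (f e)))" by (rule pbd_comp[OF q(3) p(3)])
  qed
qed

lemma size_left [simp]: "size (left x) \<le> size x"
  by (cases x) auto

lemma size_right [simp]: "size (right x) \<le> size x"
  by (cases x) auto

lemma pt_left: "pt f \<Longrightarrow> pt (\<lambda>e. left (f e))"
proof (erule pt_comp, rule ptI)
  show "computes (SetLeft 0 0) left (\<lambda>_. 1)"
    unfolding computes_def by (intro allI wp_SetLeft) simp
  show "pbd (\<lambda>e. size (left e))" by (rule pbd_mono[OF pbd_size]) simp
qed (rule pbd_const)

lemma pt_right: "pt f \<Longrightarrow> pt (\<lambda>e. right (f e))"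
proof (erule pt_comp, rule ptI)
  show "computes (SetRight 0 0) right (\<lambda>_. 1)"
    unfolding computes_def by (intro allI wp_SetRight) simp
  show "pbd (\<lambda>e. size (right e))" by (rule pbd_mono[OF pbd_size]) simp
qed (rule pbd_const)

lemma pt_CONS:
  assumes "pt f" "pt g"
  shows "pt (\<lambda>e. CONS (f e) (g e))"
proof -
  obtain p b where p: "computes p f b" "pbd b" "pbd (\<lambda>e. size (f e))" using assms(1) by (rule ptE)
  obtain q c where q: "computes q g c" "pbd c" "pbd (\<lambda>e. size (g e))" using assms(2) by (rule ptE)
  obtain N where N: "N \<notin> insert 0 (vars p \<union> vars q)" using fresh_var by (metis finite_vars finite_Un finite_insert)
  obtain M where M: "M \<notin> insert N (insert 0 (vars p \<union> vars q))" using fresh_var by (metis finite_vars finite_Un finite_insert)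
  \<comment> \<open>\<open>N\<close> saves the input for \<open>q\<close>, and \<open>M\<close>
    holds the value of \<open>f\<close> while \<open>q\<close> works in variable 0.\<close>
  let ?p = "Seq (Copy N 0) (Seq p (Seq (Copy M 0) (Seq (Copy 0 N) (Seq q (SetCons 0 M 0)))))"
  show ?thesis
  proof (rule ptI)
    show "computes ?p (\<lambda>e. CONS (f e) (g e)) (\<lambda>e. 1 + (b e + (1 + (1 + (c e + 1)))))"
      unfolding computes_def using N M
      by (intro allI wp_Seq wp_Copy computes_wp[OF p(1)] computes_wp[OF q(1)] wp_SetCons) auto
    show "pbd (\<lambda>e. 1 + (b e + (1 + (1 + (c e + 1)))))"
      by (intro pbd_add p q pbd_const)
    have "pbd (\<lambda>e. size (f e) + size (g e) + 1)" by (intro pbd_add p q pbd_const)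
    then show "pbd (\<lambda>e. size (CONS (f e) (g e)))" by simp
  qed
qed

lemma pt_const: "pt (\<lambda>_. c)"
  by (induction c) (auto intro: pt_NIL pt_CONS)

lemma pt_ifnil:
  assumes "pt h" "pt f" "pt g"
  shows "pt (\<lambda>e. if h e \<noteq> NIL then f e else g e)"
proof -
  obtain r a where r: "computes r h a" "pbd a" "pbd (\<lambda>e. size (h e))" using assms(1) by (rule ptE)
  obtain p b where p: "computes p f b" "pbd b" "pbd (\<lambda>e. size (f e))" using assms(2) by (rule ptE)
  obtain q c where q: "computes q g c" "pbd c" "pbd (\<lambda>e. size (g e))" using assms(3) by (rule ptE)
  obtain N where N: "N \<notin> insert 0 (vars r)" using fresh_var by (metis finite_vars finite_insert)
  obtain M where M: "M \<notin> insert N (insert 0 (vars r))" using fresh_var by (metis finite_vars finite_insert)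
  let ?p = "Seq (Copy N 0) (Seq r (Seq (Copy M 0) (Seq (Copy 0 N) (IfCons M p q))))"
  show ?thesis
  proof (rule ptI)
    show "computes ?p (\<lambda>e. if h e \<noteq> NIL then f e else g e)
      (\<lambda>e. 1 + (a e + (1 + (1 + Suc (b e + c e)))))"
      unfolding computes_def using N M
      by (intro allI wp_Seq wp_Copy computes_wp[OF r(1)] wp_If
          wp_mono[OF computes_wp[OF p(1)], where c = "b e + c e" for e]
          wp_mono[OF computes_wp[OF q(1)], where c = "b e + c e" for e]) auto
    have "pbd (\<lambda>e. 1 + (a e + (1 + (1 + (1 + (b e + c e))))))" by (intro pbd_add p q r pbd_const)
    then show "pbd (\<lambda>e. 1 + (a e + (1 + (1 + Suc (b e + c e)))))" by simp
    show "pbd (\<lambda>e. size (if h e \<noteq> NIL then f e else g e))"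
      by (rule pbd_mono[OF pbd_add[OF p(3) q(3)]]) simp
  qed
qed

text \<open>The state of an iteration is a pair in variable 0 whose left part is the flag;
  \<open>N\<close> receives a copy of the flag because only a variable can be tested.\<close>

definition loop :: "var \<Rightarrow> prog \<Rightarrow> prog" where
  "loop N p = Seq (SetLeft N 0) (WhileCons N (Seq p (SetLeft N 0)))"

lemma wp_loop_aux:
  assumes p: "computes p g b" and N: "N \<notin> vars p" "N \<noteq> 0"
  shows "(\<forall>j<k. left ((g ^^ j) e) \<noteq> NIL) \<Longrightarrow> left ((g ^^ k) e) = NIL \<Longrightarrow> s 0 = e \<Longrightarrow> s N = left e \<Longrightarrow>
    wp (WhileCons N (Seq p (SetLeft N 0))) (1 + (\<Sum>j<k. b ((g ^^ j) e) + 2))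
      (\<lambda>s'. s' 0 = (g ^^ k) e) s"
proof (induction k arbitrary: e s)
  case 0
  then show ?case using wp_While_False[of s N] by simp
next
  case (Suc k)
  have *: "(g ^^ Suc j) e = (g ^^ j) (g e)" for j
    by (simp add: funpow_swap1)
  have sum: "(\<Sum>j<Suc k. b ((g ^^ j) e) + 2) = b e + 2 + (\<Sum>j<k. b ((g ^^ j) (g e)) + 2)"
    by (subst sum.lessThan_Suc_shift) (simp only: *, simp)
  have left: "left e \<noteq> NIL" using Suc.prems(1) by force
  have "wp (WhileCons N (Seq p (SetLeft N 0)))
      (Suc ((b e + 1) + (1 + (\<Sum>j<k. b ((g ^^ j) (g e)) + 2)))) (\<lambda>s'. s' 0 = (g ^^ k) (g e)) s"
  proof (intro wp_While_True wp_Seq computes_wp[OF p] wp_SetLeft Suc.IH)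
    show "\<forall>j<k. left ((g ^^ j) (g e)) \<noteq> NIL"
      using Suc.prems(1) * by (metis Suc_mono)
    show "left ((g ^^ k) (g e)) = NIL"
      using Suc.prems(2) * by metis
  qed (use Suc.prems left N in auto)
  then show ?case
    by (rule wp_mono) (use sum * in \<open>auto simp del: funpow.simps\<close>)
qed

lemma wp_loop:
  assumes "computes p g b" "N \<notin> vars p" "N \<noteq> 0"
    and "\<forall>j<k. left ((g ^^ j) (s 0)) \<noteq> NIL" "left ((g ^^ k) (s 0)) = NIL"
  shows "wp (loop N p) (2 + (\<Sum>j<k. b ((g ^^ j) (s 0)) + 2)) (\<lambda>s'. s' 0 = (g ^^ k) (s 0)) s"
proof -
  have "wp (loop N p) (1 + (1 + (\<Sum>j<k. b ((g ^^ j) (s 0)) + 2))) (\<lambda>s'. s' 0 = (g ^^ k) (s 0)) s"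
    unfolding loop_def using assms by (intro wp_Seq wp_SetLeft wp_loop_aux) auto
  then show ?thesis by simp
qed

text \<open>A polynomial-time step may square the size of its argument, so polynomially many steps
  can still explode. The bound \<open>B\<close> therefore covers the size of every iterate and not
  only their number.\<close>

lemma pt_iter:
  assumes g: "pt g" and i: "pt i" and B: "pbd B"
    and k: "\<And>e. \<exists>k\<le>B e. (\<forall>j<k. left ((g ^^ j) (i e)) \<noteq> NIL) \<and> left ((g ^^ k) (i e)) = NIL \<and>
      (\<forall>j\<le>k. size ((g ^^ j) (i e)) \<le> B e) \<and> F e = (g ^^ k) (i e)"
  shows "pt F"
proof -
  obtain p b where p: "computes p g b" "pbd b" using g by (rule ptE)
  obtain q c where q: "computes q i c" "pbd c" using i by (rule ptE)
  obtain N where N: "N \<notin> insert 0 (vars p)" using fresh_var by (metis finite_vars finite_insert)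
  obtain b' where b': "pbd (\<lambda>e. b' (size e))" "mono b'" "\<And>e. b e \<le> b' (size e)"
    using pbd_bound[OF p(2)] by blast
  \<comment> \<open>\<open>pbd_comp\<close> composes along functions that return trees, so the
    number \<open>B e\<close> is presented as a list of \<open>B e\<close> copies of
    \<open>NIL\<close>.\<close>
  have bB: "pbd (\<lambda>e. b' (B e))"
    using pbd_comp[OF b'(1), of "\<lambda>e. enc_list (replicate (B e) NIL)"] B
  proof -
    have sz: "size (enc_list (replicate m NIL)) = m" for m by (induction m) auto
    show ?thesis using pbd_comp[OF b'(1), of "\<lambda>e. enc_list (replicate (B e) NIL)"] B by (simp add: sz)
  qed
  show ?thesis
  proof (rule ptI)
    show "computes (Seq q (loop N p)) F (\<lambda>e. c e + (2 + B e * (b' (B e) + 2)))"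
      unfolding computes_def
    proof (intro allI wp_Seq computes_wp[OF q(1) refl])
      fix s s' :: state
      assume s': "s' 0 = i (s 0)"
      obtain k where kk: "k \<le> B (s 0)" "\<forall>j<k. left ((g ^^ j) (s' 0)) \<noteq> NIL" "left ((g ^^ k) (s' 0)) = NIL"
        "\<forall>j\<le>k. size ((g ^^ j) (s' 0)) \<le> B (s 0)" "F (s 0) = (g ^^ k) (s' 0)"
        using k[of "s 0"] s' by metis
      have "(\<Sum>j<k. b ((g ^^ j) (s' 0)) + 2) \<le> (\<Sum>j<k. b' (B (s 0)) + 2)"
      proof (rule sum_mono)
        fix j assume "j \<in> {..<k}"
        then have "b' (size ((g ^^ j) (s' 0))) \<le> b' (B (s 0))"
          using kk(4) b'(2) by (simp add: monoD)
        then show "b ((g ^^ j) (s' 0)) + 2 \<le> b' (B (s 0)) + 2"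
          using b'(3) le_trans by (simp, blast)
      qed
      also have "\<dots> \<le> B (s 0) * (b' (B (s 0)) + 2)"
        using mult_le_mono1[OF kk(1), of "b' (B (s 0)) + 2"] by simp
      finally show "wp (loop N p) (2 + B (s 0) * (b' (B (s 0)) + 2)) (\<lambda>sa. sa 0 = F (s 0)) s'"
        using N by (intro wp_mono[OF wp_loop[where g = g and k = k and s = s', OF p(1) _ _ kk(2,3)]]) (auto simp: kk(5))
    qed
    show "pbd (\<lambda>e. c e + (2 + B e * (b' (B e) + 2)))"
      by (intro pbd_add pbd_mult pbd_const q B bB)
    show "pbd (\<lambda>e. size (F e))"
      by (rule pbd_mono[OF B]) (metis k order_refl)
  qed
qed

text \<open>A function of several arguments is represented by a function of one nested pair.
  Higher-order rules such as \<open>ptl_map\<close> use the same layout: the bound variable is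
  \<open>left e\<close> and the environment is \<open>right e\<close>.\<close>

lemma pt_apply2: "pt (\<lambda>e. h (left e) (right e)) \<Longrightarrow> pt f \<Longrightarrow> pt g \<Longrightarrow> pt (\<lambda>e. h (f e) (g e))"
  using pt_comp[OF pt_CONS[of f g]] by fastforce

lemma pt_apply3: "pt (\<lambda>e. h (left e) (left (right e)) (right (right e))) \<Longrightarrow>
    pt f \<Longrightarrow> pt g \<Longrightarrow> pt k \<Longrightarrow> pt (\<lambda>e. h (f e) (g e) (k e))"
  using pt_comp[OF pt_CONS[of f "\<lambda>e. CONS (g e) (k e)", OF _ pt_CONS[of g k]]] by fastforce

section \<open>Lists and Boolean tests\<close>

fun dec_list :: "sexp \<Rightarrow> sexp list" where
  "dec_list NIL = []"
| "dec_list (CONS x y) = x # dec_list y"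

lemma dec_enc [simp]: "dec_list (enc_list xs) = xs"
  by (induction xs) auto

text \<open>Every tree is the code of exactly one list, so reading arbitrary data as a list never
  meets ill-formed input.\<close>

lemma enc_dec [simp]: "enc_list (dec_list x) = x"
  by (induction x) auto

lemma enc_list_inject [simp]: "enc_list xs = enc_list ys \<longleftrightarrow> xs = ys"
  by (metis dec_enc)

lemma enc_list_eq_NIL [simp]: "enc_list xs = NIL \<longleftrightarrow> xs = []"
  by (cases xs) auto

lemma size_enc_list: "size (enc_list xs) = (\<Sum>x\<leftarrow>xs. Suc (size x))"
  by (induction xs) auto

lemma size_member: "x \<in> set xs \<Longrightarrow> Suc (size x) \<le> size (enc_list xs)"
  by (induction xs) auto

lemma length_le_size: "length xs \<le> size (enc_list xs)"
  by (induction xs) auto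

lemma size_enc_list_le:
  assumes "length xs \<le> k" "\<And>x. x \<in> set xs \<Longrightarrow> size x \<le> m"
  shows "size (enc_list xs) \<le> k * (m + 1)"
proof -
  have "size (enc_list xs) \<le> length xs * (m + 1)"
    using assms(2) by (induction xs) (auto simp: add_mono algebra_simps)
  also have "\<dots> \<le> k * (m + 1)" using assms(1) by (rule mult_le_mono1)
  finally show ?thesis .
qed

lemma left_enc_list: "left (enc_list xs) = (if xs = [] then NIL else hd xs)"
  by (cases xs) auto

lemma right_enc_list: "right (enc_list xs) = enc_list (tl xs)"
  by (cases xs) auto

text \<open>The loop state holds the rest of the list, the accumulator and the unchanged environment
  \<open>e\<close>. The rest of the list is at the same time the flag, since \<open>NIL\<close>
  codes the empty list only. Folding over prefixes gives the intermediate accumulators whose size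
  \<open>pt_iter\<close> asks for.\<close>

lemma pt_foldl:
  assumes L: "pt (\<lambda>e. enc_list (L e))" and i: "pt i"
    and h: "pt (\<lambda>e. h (left e) (left (right e)) (right (right e)))"
    and B: "pbd B"
    and bound: "\<And>e j. j \<le> length (L e) \<Longrightarrow> size (foldl (\<lambda>a x. h x a e) (i e) (take j (L e))) \<le> B e"
  shows "pt (\<lambda>e. foldl (\<lambda>a x. h x a e) (i e) (L e))"
proof -
  define g where "g st = (if left st \<noteq> NIL then
    CONS (right (left st)) (CONS (h (left (left st)) (left (right st)) (right (right st))) (right (right st)))
    else st)" for st
  have g: "pt g"
    unfolding g_def by (intro pt_ifnil pt_CONS pt_left pt_right pt_id
        pt_apply3[where h = h, OF h])
  let ?i = "\<lambda>e. CONS (enc_list (L e)) (CONS (i e) e)"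
  have st: "(g ^^ j) (?i e) = CONS (enc_list (drop j (L e)))
      (CONS (foldl (\<lambda>a x. h x a e) (i e) (take j (L e))) e)" if "j \<le> length (L e)" for j e
    using that
  proof (induction j)
    case (Suc j)
    then show ?case
      by (auto simp: g_def left_enc_list right_enc_list take_Suc_conv_app_nth hd_drop_conv_nth
          drop_Suc tl_drop)
  qed simp
  have "pt (\<lambda>e. CONS NIL (CONS (foldl (\<lambda>a x. h x a e) (i e) (L e)) e))"
  proof (rule pt_iter[OF g, of ?i])
    show "pt ?i" by (intro pt_CONS L i pt_id)
    show "pbd (\<lambda>e. size (enc_list (L e)) + B e + size e + 2)"
      by (intro pbd_add pbd_size pbd_const B pt_pbd[OF L])
    fix e
    show "\<exists>k\<le>size (enc_list (L e)) + B e + size e + 2.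
            (\<forall>j<k. left ((g ^^ j) (?i e)) \<noteq> NIL) \<and> left ((g ^^ k) (?i e)) = NIL \<and>
            (\<forall>j\<le>k. size ((g ^^ j) (?i e)) \<le> size (enc_list (L e)) + B e + size e + 2) \<and>
            CONS NIL (CONS (foldl (\<lambda>a x. h x a e) (i e) (L e)) e) = (g ^^ k) (?i e)"
    proof (intro exI[of _ "length (L e)"] conjI allI impI)
      show "length (L e) \<le> size (enc_list (L e)) + B e + size e + 2"
        using length_le_size[of "L e"] by simp
      fix j
      assume "j < length (L e)"
      then show "left ((g ^^ j) (?i e)) \<noteq> NIL" by (simp add: st)
    next
      fix j
      assume j: "j \<le> length (L e)"
      have "size (enc_list (drop j (L e))) \<le> size (enc_list (L e))"
        unfolding size_enc_list
        by (metis append_take_drop_id le_add2 map_append sum_list_append)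
      then show "size ((g ^^ j) (?i e)) \<le> size (enc_list (L e)) + B e + size e + 2"
        using bound[OF j] by (simp add: st[OF j])
    qed (auto simp: st)
  qed
  then have "pt (\<lambda>e. left (right (CONS NIL (CONS (foldl (\<lambda>a x. h x a e) (i e) (L e)) e))))"
    by (intro pt_left pt_right)
  then show ?thesis by simp
qed

definition ptl :: "(sexp \<Rightarrow> sexp list) \<Rightarrow> bool" where
  "ptl L \<longleftrightarrow> pt (\<lambda>e. enc_list (L e))"

definition ptb :: "(sexp \<Rightarrow> bool) \<Rightarrow> bool" where
  "ptb P \<longleftrightarrow> pt (\<lambda>e. enc_bool (P e))"

lemma ptl_dec_list: "pt f \<Longrightarrow> ptl (\<lambda>e. dec_list (f e))"
  unfolding ptl_def by simp

lemma pt_enc_list: "ptl L \<Longrightarrow> pt (\<lambda>e. enc_list (L e))"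
  unfolding ptl_def .

lemma ptl_Nil: "ptl (\<lambda>_. [])"
  unfolding ptl_def by (simp add: pt_NIL)

lemma ptl_Cons: "pt f \<Longrightarrow> ptl L \<Longrightarrow> ptl (\<lambda>e. f e # L e)"
  unfolding ptl_def by (simp add: pt_CONS)

lemma enc_bool_eq_NIL [simp]: "enc_bool b = NIL \<longleftrightarrow> \<not> b"
  by (auto simp: enc_bool_def)

lemma pt_If: "ptb P \<Longrightarrow> pt f \<Longrightarrow> pt g \<Longrightarrow> pt (\<lambda>e. if P e then f e else g e)"
  using pt_ifnil[of "\<lambda>e. enc_bool (P e)" f g] unfolding ptb_def by simp

lemma ptl_If: "ptb P \<Longrightarrow> ptl f \<Longrightarrow> ptl g \<Longrightarrow> ptl (\<lambda>e. if P e then f e else g e)"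
  using pt_If[of P "\<lambda>e. enc_list (f e)" "\<lambda>e. enc_list (g e)"] unfolding ptl_def
  by (simp add: if_distrib)

lemma ptb_If: "ptb P \<Longrightarrow> ptb f \<Longrightarrow> ptb g \<Longrightarrow> ptb (\<lambda>e. if P e then f e else g e)"
  using pt_If[of P "\<lambda>e. enc_bool (f e)" "\<lambda>e. enc_bool (g e)"] unfolding ptb_def
  by (simp add: if_distrib)

lemma ptb_const: "ptb (\<lambda>_. b)"
  unfolding ptb_def by (rule pt_const)

lemma ptb_conj:
  assumes "ptb P" "ptb Q"
  shows "ptb (\<lambda>e. P e \<and> Q e)"
proof -
  have "(\<lambda>e. P e \<and> Q e) = (\<lambda>e. if P e then Q e else False)" by auto
  then show ?thesis using ptb_If[OF assms ptb_const[of False]] by simp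
qed

lemma ptb_disj:
  assumes "ptb P" "ptb Q"
  shows "ptb (\<lambda>e. P e \<or> Q e)"
proof -
  have "(\<lambda>e. P e \<or> Q e) = (\<lambda>e. if P e then True else Q e)" by auto
  then show ?thesis using ptb_If[OF assms(1) ptb_const[of True] assms(2)] by simp
qed

lemma ptb_imp:
  assumes "ptb P" "ptb Q"
  shows "ptb (\<lambda>e. P e \<longrightarrow> Q e)"
proof -
  have "(\<lambda>e. P e \<longrightarrow> Q e) = (\<lambda>e. if P e then Q e else True)" by auto
  then show ?thesis using ptb_If[OF assms ptb_const[of True]] by simp
qed

lemma ptb_not:
  assumes "ptb P"
  shows "ptb (\<lambda>e. \<not> P e)"
  using ptb_imp[OF assms ptb_const[of False]] by simp

lemma ptb_eq_NIL:
  assumes "pt f"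
  shows "ptb (\<lambda>e. f e = NIL)"
proof -
  have "(\<lambda>e. enc_bool (f e = NIL)) = (\<lambda>e. if f e \<noteq> NIL then NIL else CONS NIL NIL)"
    by (auto simp: enc_bool_def)
  then show ?thesis using pt_ifnil[OF assms pt_NIL pt_const[of "CONS NIL NIL"]] unfolding ptb_def by simp
qed

lemma ptb_eq_Nil: "ptl L \<Longrightarrow> ptb (\<lambda>e. L e = [])"
  unfolding ptl_def by (drule ptb_eq_NIL) simp

lemma foldl_rev: "foldl (\<lambda>a x. CONS x a) (enc_list ys) xs = enc_list (rev xs @ ys)"
  by (induction xs arbitrary: ys) (auto simp flip: enc_list.simps)

lemma size_enc_list_append: "size (enc_list (xs @ ys)) = size (enc_list xs) + size (enc_list ys)"
  by (induction xs) auto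

lemma size_enc_list_rev: "size (enc_list (rev xs)) = size (enc_list xs)"
  by (induction xs) (auto simp: size_enc_list_append)

lemma size_enc_list_take: "size (enc_list (take j xs)) \<le> size (enc_list xs)"
  by (metis append_take_drop_id le_add1 size_enc_list_append)

lemma ptl_rev_append:
  assumes "ptl L" "ptl M"
  shows "ptl (\<lambda>e. rev (L e) @ M e)"
proof -
  have "pt (\<lambda>e. foldl (\<lambda>a x. CONS x a) (enc_list (M e)) (L e))"
  proof (rule pt_foldl[where h = "\<lambda>x a e. CONS x a" and B = "\<lambda>e. size (enc_list (L e)) + size (enc_list (M e))"])
    show "pt (\<lambda>e. CONS (left e) (left (right e)))" by (intro pt_CONS pt_left pt_right pt_id)
    show "pbd (\<lambda>e. size (enc_list (L e)) + size (enc_list (M e)))"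
      by (intro pbd_add pt_pbd) (use assms in \<open>auto simp: ptl_def\<close>)
    fix e j
    show "size (foldl (\<lambda>a x. CONS x a) (enc_list (M e)) (take j (L e)))
        \<le> size (enc_list (L e)) + size (enc_list (M e))"
      by (simp add: foldl_rev size_enc_list_append size_enc_list_rev size_enc_list_take)
  qed (use assms in \<open>auto simp: ptl_def\<close>)
  then show ?thesis by (simp add: foldl_rev ptl_def)
qed

lemma ptl_rev: "ptl L \<Longrightarrow> ptl (\<lambda>e. rev (L e))"
  using ptl_rev_append[of L "\<lambda>_. []"] ptl_Nil by simp

lemma ptl_append: "ptl L \<Longrightarrow> ptl M \<Longrightarrow> ptl (\<lambda>e. L e @ M e)"
  using ptl_rev_append[OF ptl_rev] by fastforce

lemma foldl_enc_append: "foldl (\<lambda>a x. enc_list (dec_list a @ f x)) (enc_list ys) xs = enc_list (ys @ concat (map f xs))"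
  by (induction xs arbitrary: ys) auto

lemma ptl_concat_map:
  assumes L: "ptl L" and f: "ptl (\<lambda>e. f (left e) (right e))"
  shows "ptl (\<lambda>e. concat (map (\<lambda>x. f x e) (L e)))"
proof -
  have "pbd (\<lambda>e. size (enc_list (f (left e) (right e))))"
    using pt_pbd[OF f[unfolded ptl_def]] .
  then obtain b :: "nat \<Rightarrow> nat" where b: "pbd (\<lambda>e. b (size e))" "mono b"
      "\<And>e. size (enc_list (f (left e) (right e))) \<le> b (size e)"
    by (rule pbd_bound) (rule that)
  \<comment> \<open>A member \<open>x\<close> of \<open>L e\<close> is smaller than the whole list,
    so every argument \<open>CONS x e\<close> of \<open>f\<close> has size at most
    \<open>?s e\<close>.\<close>
  let ?s = "\<lambda>e. size (CONS (enc_list (L e)) e)"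
  let ?B = "\<lambda>e. size (enc_list (L e)) * (b (?s e) + 1)"
  have "pt (\<lambda>e. foldl (\<lambda>a x. enc_list (dec_list a @ f x e)) NIL (L e))"
  proof (rule pt_foldl[where h = "\<lambda>x a e. enc_list (dec_list a @ f x e)" and B = ?B])
    have "ptl (\<lambda>e. f (left e) (right (right e)))"
      unfolding ptl_def
      by (rule pt_apply2[where h = "\<lambda>x y. enc_list (f x y)", OF f[unfolded ptl_def]])
        (intro pt_left pt_right pt_id)+
    then show "pt (\<lambda>e. enc_list (dec_list (left (right e)) @ f (left e) (right (right e))))"
      by (intro pt_enc_list ptl_append ptl_dec_list pt_left pt_right pt_id)
    show "pbd ?B"
      by (intro pbd_mult pbd_add pbd_const pbd_comp[OF b(1)] pt_pbd pt_CONS pt_id) (use L in \<open>auto simp: ptl_def\<close>)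
    fix e j
    have "size (enc_list (concat (map (\<lambda>x. f x e) xs))) \<le> length xs * (b (?s e))"
      if "set xs \<subseteq> set (L e)" for xs
      using that
    proof (induction xs)
      case (Cons x xs)
      have "size (enc_list (f x e)) \<le> b (size (CONS x e))" using b(3)[of "CONS x e"] by simp
      also have "\<dots> \<le> b (?s e)" using size_member[of x "L e"] Cons.prems by (intro monoD[OF b(2)]) auto
      finally show ?case using Cons by (simp add: size_enc_list_append)
    qed simp
    from this[of "take j (L e)"] have "size (enc_list (concat (map (\<lambda>x. f x e) (take j (L e)))))
        \<le> length (take j (L e)) * b (?s e)"
      by (meson set_take_subset)
    also have "\<dots> \<le> ?B e"
      using length_le_size[of "L e"] by (intro mult_le_mono) auto
    finally show "size (foldl (\<lambda>a x. enc_list (dec_list a @ f x e)) NIL (take j (L e))) \<le> ?B e"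
      using foldl_enc_append[of "\<lambda>x. f x e" "[]" "take j (L e)"] by simp
  qed (use L in \<open>auto simp: ptl_def pt_NIL\<close>)
  then show ?thesis unfolding ptl_def
  proof (rule pt_cong)
    show "foldl (\<lambda>a x. enc_list (dec_list a @ f x e)) NIL (L e) = enc_list (concat (map (\<lambda>x. f x e) (L e)))" for e
    using foldl_enc_append[of "\<lambda>x. f x e" "[]" "L e"] by simp
  qed
qed

lemma ptl_map:
  assumes "ptl L" "pt (\<lambda>e. f (left e) (right e))"
  shows "ptl (\<lambda>e. map (\<lambda>x. f x e) (L e))"
  using ptl_concat_map[of L "\<lambda>x e. [f x e]"] assms by (simp add: ptl_Cons ptl_Nil)

lemma ptl_filter:
  assumes L: "ptl L" and "ptb (\<lambda>e. P (left e) (right e))"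
  shows "ptl (\<lambda>e. filter (\<lambda>x. P x e) (L e))"
proof -
  have "concat (map (\<lambda>x. if P x e then [x] else []) xs) = filter (\<lambda>x. P x e) xs" for xs e
    by (induction xs) auto
  moreover have "ptl (\<lambda>e. concat (map (\<lambda>x. if P x e then [x] else []) (L e)))"
    using assms by (intro ptl_concat_map[where f = "\<lambda>x e. if P x e then [x] else []"] ptl_If ptl_Cons ptl_Nil pt_left pt_id)
  ultimately show ?thesis by simp
qed

lemma ptb_Bex:
  assumes "ptl L" "ptb (\<lambda>e. P (left e) (right e))"
  shows "ptb (\<lambda>e. \<exists>x\<in>set (L e). P x e)"
  using ptb_not[OF ptb_eq_Nil[OF ptl_filter[OF assms]]] by (simp add: filter_empty_conv)

lemma ptb_Ball:
  assumes "ptl L" "ptb (\<lambda>e. P (left e) (right e))"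
  shows "ptb (\<lambda>e. \<forall>x\<in>set (L e). P x e)"
  using ptb_not[OF ptb_Bex[OF assms(1), of "\<lambda>x e. \<not> P x e"]] assms(2) ptb_not by simp

text \<open>Recursion on two trees is replaced by a stack, in \<open>left st\<close>, of pairs that
  remain to be compared. \<open>right st\<close> is the verdict; a mismatch empties the stack, which
  stops the loop, and sets the verdict to \<open>CONS NIL NIL\<close>.\<close>

definition eq_step :: "sexp \<Rightarrow> sexp" where
  "eq_step st = (let x = left (left (left st)); y = right (left (left st)); w = right (left st); r = right st in
     if x \<noteq> NIL then
       (if y \<noteq> NIL then CONS (CONS (CONS (left x) (left y)) (CONS (CONS (right x) (right y)) w)) r
        else CONS NIL (CONS NIL NIL))
     else (if y \<noteq> NIL then CONS NIL (CONS NIL NIL) else CONS w r))"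

lemma pt_eq_step: "pt eq_step"
  unfolding eq_step_def Let_def
  by (intro pt_ifnil pt_CONS pt_left pt_right pt_id pt_const)

definition halts :: "(sexp \<Rightarrow> sexp) \<Rightarrow> sexp \<Rightarrow> nat \<Rightarrow> sexp \<Rightarrow> nat \<Rightarrow> bool" where
  "halts g st k r b \<longleftrightarrow> (\<forall>j<k. left ((g ^^ j) st) \<noteq> NIL) \<and> (g ^^ k) st = CONS NIL r \<and>
     (\<forall>j\<le>k. size ((g ^^ j) st) \<le> b)"

lemma halts_0: "Suc (size r) \<le> b \<Longrightarrow> halts g (CONS NIL r) 0 r b"
  by (simp add: halts_def)

lemma halts_Suc:
  assumes "left st \<noteq> NIL" "size st \<le> b" "halts g (g st) k r b"
  shows "halts g st (Suc k) r b"
proof -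
  have *: "(g ^^ Suc j) st = (g ^^ j) (g st)" for j
    by (simp add: funpow_swap1)
  have "left ((g ^^ j) st) \<noteq> NIL" if "j < Suc k" for j
    using assms(1,3) that * by (cases j) (auto simp: halts_def simp del: funpow.simps(2))
  moreover have "size ((g ^^ j) st) \<le> b" if "j \<le> Suc k" for j
    using assms(2,3) that * by (cases j) (auto simp: halts_def simp del: funpow.simps(2))
  ultimately show ?thesis
    using assms(3) * unfolding halts_def by simp
qed

text \<open>Splitting a pair of two \<open>CONS\<close> trees lowers the weight by exactly one and
  keeps the size of the stack; removing a pair of two \<open>NIL\<close> lowers it by one as well.
  So the weight bounds the number of steps and the initial size bounds all states;
  \<open>2 \<le> b\<close> leaves room for the verdict of a mismatch.\<close>

lemma eq_step_halts:
  assumes "(\<Sum>(x, y)\<leftarrow>ps. 2 * size x + 1) \<le> m"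
    and "Suc (size (enc_list (map (\<lambda>(x, y). CONS x y) ps))) \<le> b" "2 \<le> b"
  shows "\<exists>k r. k \<le> m \<and> halts eq_step (CONS (enc_list (map (\<lambda>(x, y). CONS x y) ps)) NIL) k r b \<and>
    (r = NIL \<longleftrightarrow> (\<forall>(x, y)\<in>set ps. x = y))"
  using assms(1,2)
proof (induction m arbitrary: ps)
  case 0
  then have "ps = []" by (cases ps) auto
  then show ?case using halts_0[of NIL b] assms(3) by auto
next
  case (Suc m)
  show ?case
  proof (cases ps)
    case Nil
    then show ?thesis using halts_0[of NIL b] assms(3) by (intro exI[of _ 0] exI[of _ NIL]) auto
  next
    case (Cons xy qs)
    obtain x y where xy: "xy = (x, y)" by (cases xy)
    have again: ?thesis
      if step: "eq_step (CONS (enc_list (map (\<lambda>(x, y). CONS x y) ps)) NIL) =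
          CONS (enc_list (map (\<lambda>(x, y). CONS x y) qs')) NIL"
        and m: "(\<Sum>(x, y)\<leftarrow>qs'. 2 * size x + 1) \<le> m"
        and sz: "Suc (size (enc_list (map (\<lambda>(x, y). CONS x y) qs'))) \<le> b"
        and eq: "(\<forall>(x, y)\<in>set qs'. x = y) \<longleftrightarrow> (\<forall>(x, y)\<in>set ps. x = y)" for qs'
    proof -
      from Suc.IH[OF m sz] obtain k r where "k \<le> m"
        "halts eq_step (CONS (enc_list (map (\<lambda>(x, y). CONS x y) qs')) NIL) k r b"
        "r = NIL \<longleftrightarrow> (\<forall>(x, y)\<in>set qs'. x = y)" by (elim exE conjE)
      then show ?thesis
        using step eq Suc.prems(2) Cons
        by (intro exI[of _ "Suc k"] exI[of _ r] conjI halts_Suc) auto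
    qed
    have stop: ?thesis
      if "eq_step (CONS (enc_list (map (\<lambda>(x, y). CONS x y) ps)) NIL) = CONS NIL (CONS NIL NIL)" "x \<noteq> y"
      using that Cons xy Suc.prems(2) assms(3)
      by (intro exI[of _ "Suc 0"] exI[of _ "CONS NIL NIL"] conjI halts_Suc) (auto intro: halts_0)
    show ?thesis
    proof (cases x; cases y)
      assume "x = NIL" "y = NIL"
      then show ?thesis
        using Suc.prems by (intro again[of qs]) (auto simp: Cons xy eq_step_def)
    next
      fix x1 x2 y1 y2
      assume "x = CONS x1 x2" "y = CONS y1 y2"
      then show ?thesis
        using Suc.prems by (intro again[of "(x1, y1) # (x2, y2) # qs"]) (auto simp: Cons xy eq_step_def)
    qed (intro stop; simp add: Cons xy eq_step_def)+
  qed
qed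

lemma ptb_eq:
  assumes f: "pt f" and g: "pt g"
  shows "ptb (\<lambda>e. f e = g e)"
proof -
  let ?i = "\<lambda>e. CONS (CONS (CONS (f e) (g e)) NIL) NIL"
  let ?B = "\<lambda>e. 2 * size (f e) + size (g e) + 4"
  have "\<exists>r k. k \<le> ?B e \<and> halts eq_step (?i e) k r (?B e) \<and> (r = NIL \<longleftrightarrow> f e = g e)" for e
    using eq_step_halts[of "[(f e, g e)]" "?B e" "?B e"] by auto
  then obtain R where R: "\<And>e. \<exists>k. k \<le> ?B e \<and> halts eq_step (?i e) k (R e) (?B e) \<and> (R e = NIL \<longleftrightarrow> f e = g e)"
    by metis
  have "pt (\<lambda>e. CONS NIL (R e))"
  proof (rule pt_iter[OF pt_eq_step, of ?i])
    show "pt ?i" by (intro pt_CONS f g pt_const)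
    show "pbd ?B" by (intro pbd_add pbd_mult pbd_const pt_pbd f g)
    fix e
    from R[of e] obtain k where "k \<le> ?B e" "halts eq_step (?i e) k (R e) (?B e)" by (elim exE conjE)
    then show "\<exists>k\<le>?B e. (\<forall>j<k. left ((eq_step ^^ j) (?i e)) \<noteq> NIL) \<and>
      left ((eq_step ^^ k) (?i e)) = NIL \<and>
      (\<forall>j\<le>k. size ((eq_step ^^ j) (?i e)) \<le> ?B e) \<and> CONS NIL (R e) = (eq_step ^^ k) (?i e)"
      unfolding halts_def by (intro exI[of _ k]) simp
  qed
  then have "ptb (\<lambda>e. right (CONS NIL (R e)) = NIL)" by (intro ptb_eq_NIL pt_right)
  moreover have "R e = NIL \<longleftrightarrow> f e = g e" for e
    using R[of e] by (elim exE conjE)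
  ultimately show ?thesis by simp
qed

lemma ptb_mem: "pt f \<Longrightarrow> ptl L \<Longrightarrow> ptb (\<lambda>e. f e \<in> set (L e))"
  using ptb_Bex[of L "\<lambda>x e. f e = x"] pt_comp[OF pt_right[OF pt_id], of f]
    ptb_eq[of "\<lambda>e. f (right e)" left] pt_left[OF pt_id] by simp

section \<open>Binary arithmetic on S-expressions\<close>

lemma pt_enc_bool: "ptb P \<Longrightarrow> pt (\<lambda>e. enc_bool (P e))"
  by (simp add: ptb_def)

text \<open>One closure rule per construct: with them, polynomial time follows by recursion over the
  text of a definition.\<close>

lemmas pt_intros = pt_id pt_const pt_left pt_right pt_CONS pt_If pt_enc_list
  ptl_dec_list ptl_Nil ptl_Cons ptl_append ptl_rev ptl_If ptl_concat_map ptl_map ptl_filter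
  ptb_const ptb_conj ptb_disj ptb_imp ptb_not ptb_If ptb_eq_NIL ptb_eq_Nil ptb_eq ptb_mem ptb_Bex ptb_Ball

fun val :: "sexp \<Rightarrow> nat" where
  "val NIL = 0"
| "val (CONS b r) = (if b = NIL then 0 else 1) + 2 * val r"

lemma val_div2: "val x div 2 = val (right x)"
  by (cases x) auto

lemma val_enc_nat [simp]: "val (enc_nat n) = n"
proof (induction n rule: bits.induct)
  case (1 n)
  show ?case
  proof (cases "n = 0")
    case True
    then show ?thesis by (simp add: enc_nat_def bits.simps[of 0])
  next
    case False
    then have "enc_nat n = CONS (enc_bool (odd n)) (enc_nat (n div 2))"
      by (subst enc_nat_def, subst bits.simps) (simp add: enc_nat_def)
    with 1 False show ?thesis by (simp add: odd_two_times_div_two_succ)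
  qed
qed

lemma enc_nat_inject [simp]: "enc_nat m = enc_nat n \<longleftrightarrow> m = n"
  by (metis val_enc_nat)

text \<open>Digits come least significant first, so \<open>r\<close>, the verdict on the digits
  already read, is overruled by every later digit in which the numbers differ. The list is a clock
  of which only the length matters.\<close>

fun less_bits :: "'a list \<Rightarrow> bool \<Rightarrow> sexp \<Rightarrow> sexp \<Rightarrow> bool" where
  "less_bits [] r a b = r"
| "less_bits (_ # ks) r a b =
    less_bits ks (if left a = NIL \<longleftrightarrow> left b = NIL then r else left b \<noteq> NIL) (right a) (right b)"

lemma less_bits_val: "val a < 2 ^ length ks \<Longrightarrow> val b < 2 ^ length ks \<Longrightarrow>
    less_bits ks r a b \<longleftrightarrow> (if val a = val b then r else val a < val b)"
proof (induction ks arbitrary: r a b)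
  case (Cons k ks)
  have "val (right a) < 2 ^ length ks" "val (right b) < 2 ^ length ks"
    using Cons.prems by (auto simp flip: val_div2)
  from Cons.IH[OF this] show ?case
    by (cases a; cases b) auto
qed auto

lemma val_less: "val a < 2 ^ length (dec_list a)"
  by (induction a rule: dec_list.induct) auto

lemma less_bits_iff:
  "less_bits (dec_list a @ dec_list b) False a b \<longleftrightarrow> val a < val b"
proof -
  have "val a < 2 ^ (length (dec_list a) + length (dec_list b))"
    using val_less[of a] by (rule less_le_trans) (simp add: power_increasing)
  moreover have "val b < 2 ^ (length (dec_list a) + length (dec_list b))"
    using val_less[of b] by (rule less_le_trans) (simp add: power_increasing)
  ultimately show ?thesis by (simp add: less_bits_val)
qed

definition less_step :: "sexp \<Rightarrow> sexp" where
  "less_step st = CONS (if left (left (right st)) = NIL \<longleftrightarrow> left (right (right st)) = NIL then left st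
     else left (right (right st))) (CONS (right (left (right st))) (right (right (right st))))"

lemma foldl_less_step:
  "left (foldl (\<lambda>st _. less_step st) (CONS r (CONS a b)) ks) \<noteq> NIL \<longleftrightarrow> less_bits ks (r \<noteq> NIL) a b"
  by (induction ks arbitrary: r a b) (auto simp: less_step_def)

lemma size_less_step: "size (less_step st) \<le> size st + 2"
proof (cases st)
  case (CONS r ab)
  then show ?thesis
  proof (cases ab)
    case (CONS a b)
    then show ?thesis using \<open>st = CONS r ab\<close>
      by (cases a; cases b) (auto simp: less_step_def)
  qed (simp add: less_step_def)
qed (simp add: less_step_def)

lemma size_foldl_le:
  assumes "\<And>st x. size (f st x) \<le> size st + c"
  shows "size (foldl f i xs) \<le> size i + c * length xs"
proof (induction xs arbitrary: i)
  case (Cons x xs)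
  show ?case using Cons[of "f i x"] assms[of i x] by simp
qed simp

lemma pbd_length: "ptl L \<Longrightarrow> pbd (\<lambda>e. length (L e))"
  by (rule pbd_mono[OF pt_pbd[OF pt_enc_list]]) (auto intro: length_le_size)

text \<open>If each element adds at most \<open>c\<close> cells, the accumulator stays linear in the
  length of the list, which settles the size condition of \<open>pt_foldl\<close>.\<close>

lemma pt_foldl_linear:
  assumes L: "ptl L" and i: "pt i"
    and h: "pt (\<lambda>e. h (left e) (left (right e)) (right (right e)))"
    and c: "\<And>a x e. size (h x a e) \<le> size a + c"
  shows "pt (\<lambda>e. foldl (\<lambda>a x. h x a e) (i e) (L e))"
proof (rule pt_foldl[OF _ i h])
  show "pbd (\<lambda>e. size (i e) + c * length (L e))"
    by (intro pbd_add pbd_mult pbd_const pbd_length L pt_pbd i)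
  fix e j
  have "size (foldl (\<lambda>a x. h x a e) (i e) (take j (L e))) \<le> size (i e) + c * length (take j (L e))"
    by (rule size_foldl_le) (rule c)
  also have "\<dots> \<le> size (i e) + c * length (L e)" by simp
  finally show "size (foldl (\<lambda>a x. h x a e) (i e) (take j (L e))) \<le> size (i e) + c * length (L e)" .
qed (use L in \<open>simp add: ptl_def\<close>)

lemma ptb_iff:
  assumes "ptb P" "ptb Q"
  shows "ptb (\<lambda>e. P e \<longleftrightarrow> Q e)"
proof -
  have "(\<lambda>e. P e \<longleftrightarrow> Q e) = (\<lambda>e. if P e then Q e else \<not> Q e)" by auto
  then show ?thesis using ptb_If[OF assms(1) assms(2) ptb_not[OF assms(2)]] by simp
qed

lemma ptb_less:
  assumes "pt f" "pt g"
  shows "ptb (\<lambda>e. val (f e) < val (g e))"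
proof -
  have "pt (\<lambda>e. foldl (\<lambda>st _. less_step st) (CONS NIL (CONS (f e) (g e)))
      (dec_list (f e) @ dec_list (g e)))"
  proof (rule pt_foldl_linear[where h = "\<lambda>x a e. less_step a" and c = 2])
    show "pt (\<lambda>e. less_step (left (right e)))"
      unfolding less_step_def by (intro pt_intros ptb_iff)
    show "ptl (\<lambda>e. dec_list (f e) @ dec_list (g e))" "pt (\<lambda>e. CONS NIL (CONS (f e) (g e)))"
      by (intro pt_intros assms)+
  qed (rule size_less_step)
  then have "ptb (\<lambda>e. left (foldl (\<lambda>st _. less_step st) (CONS NIL (CONS (f e) (g e)))
      (dec_list (f e) @ dec_list (g e))) \<noteq> NIL)" by (intro pt_intros)
  then show ?thesis unfolding foldl_less_step by (simp add: less_bits_iff)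
qed

lemma ptb_pos: "pt f \<Longrightarrow> ptb (\<lambda>e. 0 < val (f e))"
  using ptb_less[of "\<lambda>_. NIL" f] pt_const by simp

lemma ptb_list_eq: "ptl L \<Longrightarrow> ptl M \<Longrightarrow> ptb (\<lambda>e. L e = M e)"
  using ptb_eq[of "\<lambda>e. enc_list (L e)" "\<lambda>e. enc_list (M e)"] by (simp add: ptl_def)

text \<open>Each rule for a quantifier, map or filter moves the environment from \<open>e\<close> to
  \<open>right e\<close>. These are the forms of a parameter under up to four such binders, as with
  de Bruijn shifts.\<close>

lemma pt_shifts:
  assumes "pt f"
  shows "pt f" "pt (\<lambda>e. f (right e))" "pt (\<lambda>e. f (right (right e)))"
    "pt (\<lambda>e. f (right (right (right e))))" "pt (\<lambda>e. f (right (right (right (right e)))))"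
  by (intro assms pt_comp[OF _ assms] pt_intros)+

lemma ptl_shifts:
  assumes "ptl L"
  shows "ptl L" "ptl (\<lambda>e. L (right e))" "ptl (\<lambda>e. L (right (right e)))"
    "ptl (\<lambda>e. L (right (right (right e))))" "ptl (\<lambda>e. L (right (right (right (right e)))))"
  using pt_shifts[of "\<lambda>e. enc_list (L e)"] assms unfolding ptl_def by blast+

lemma ptb_le: "pt f \<Longrightarrow> pt g \<Longrightarrow> ptb (\<lambda>e. val (f e) \<le> val (g e))"
  using ptb_not[OF ptb_less[of g f]] by (simp add: not_less)

text \<open>Ripple-carry addition with carry \<open>c\<close>; as in \<open>less_bits\<close> the
  list is a clock, which makes the result a sum modulo a power of 2.\<close>

fun add_bits :: "'a list \<Rightarrow> bool \<Rightarrow> sexp \<Rightarrow> sexp \<Rightarrow> bool list" where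
  "add_bits [] c a b = []"
| "add_bits (_ # ks) c a b = (let x = left a \<noteq> NIL; y = left b \<noteq> NIL in
    ((x \<longleftrightarrow> y) \<longleftrightarrow> c) # add_bits ks ((x \<and> y) \<or> (c \<and> (x \<or> y))) (right a) (right b))"

lemma add_bits_val:
  "val (enc_list (map enc_bool (add_bits ks c a b))) = (val a + val b + of_bool c) mod 2 ^ length ks"
proof (induction ks arbitrary: c a b)
  case (Cons k ks)
  have m: "m mod (2 * 2 ^ n) = m mod 2 + 2 * (m div 2 mod 2 ^ n)" for m n :: nat
    by (simp add: mod_mult2_eq)
  show ?case
    unfolding length_Cons power_Suc m
    by (cases a; cases b) (auto simp: Cons Let_def)
qed simp

definition add_step :: "sexp \<Rightarrow> sexp" where
  "add_step st = (let out = left st; c = left (right st) \<noteq> NIL; a = left (right (right st)); b = right (right (right st));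
      x = left a \<noteq> NIL; y = left b \<noteq> NIL in
    CONS (CONS (enc_bool ((x \<longleftrightarrow> y) \<longleftrightarrow> c)) out)
      (CONS (enc_bool ((x \<and> y) \<or> (c \<and> (x \<or> y)))) (CONS (right a) (right b))))"

lemma foldl_add_step:
  "left (foldl (\<lambda>st _. add_step st) (CONS (enc_list out) (CONS (enc_bool c) (CONS a b))) ks) =
    enc_list (rev (map enc_bool (add_bits ks c a b)) @ out)"
proof (induction ks arbitrary: out c a b)
  case (Cons k ks)
  let ?x = "left a \<noteq> NIL" and ?y = "left b \<noteq> NIL"
  have "add_step (CONS (enc_list out) (CONS (enc_bool c) (CONS a b))) =
      CONS (enc_list (enc_bool ((?x \<longleftrightarrow> ?y) \<longleftrightarrow> c) # out))
        (CONS (enc_bool ((?x \<and> ?y) \<or> (c \<and> (?x \<or> ?y)))) (CONS (right a) (right b)))"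
    by (simp add: add_step_def Let_def)
  then show ?case
    by (simp only: foldl_Cons Cons.IH add_bits.simps Let_def) simp
qed simp

lemma size_add_step: "size (add_step st) \<le> size st + 7"
proof -
  obtain p q where "add_step st = CONS (CONS (enc_bool p) (left st))
      (CONS (enc_bool q) (CONS (right (left (right (right st)))) (right (right (right (right st))))))"
    unfolding add_step_def Let_def by blast
  then have "size (add_step st) \<le> 1 + size (left st) + 1 + 1 + 1 + 1 + 1 +
      (size (right (left (right (right st)))) + size (right (right (right (right st)))))"
    by (auto simp: enc_bool_def)
  also have "\<dots> \<le> 1 + size (left st) + 1 + 1 + 1 + 1 + 1 +
      (size (left (right (right st))) + size (right (right (right st))))"
    by (intro add_mono) auto
  also have "\<dots> \<le> size st + 7"
  proof -
    have *: "size (left x) + size (right x) \<le> size x" for x by (cases x) auto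
    show ?thesis using *[of st] *[of "right st"] *[of "right (right st)"] by linarith
  qed
  finally show ?thesis .
qed

definition add :: "sexp \<Rightarrow> sexp \<Rightarrow> sexp \<Rightarrow> sexp" where
  "add ks a b = enc_list (map enc_bool (add_bits (dec_list ks) False a b))"

lemma val_add: "val (add ks a b) = (val a + val b) mod 2 ^ length (dec_list ks)"
  by (simp add: add_def add_bits_val)

lemma pt_add:
  assumes "pt f" "pt g" "pt h"
  shows "pt (\<lambda>e. add (f e) (g e) (h e))"
proof -
  let ?i = "\<lambda>e. CONS (enc_list []) (CONS (enc_bool False) (CONS (g e) (h e)))"
  have "pt (\<lambda>e. foldl (\<lambda>st _. add_step st) (?i e) (dec_list (f e)))"
  proof (rule pt_foldl_linear[where h = "\<lambda>x a e. add_step a" and c = 7])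
    show "pt (\<lambda>e. add_step (left (right e)))"
      unfolding add_step_def Let_def by (intro pt_intros ptb_iff pt_enc_bool)
    show "ptl (\<lambda>e. dec_list (f e))" "pt ?i" by (intro pt_intros assms)+
  qed (rule size_add_step)
  then have "pt (\<lambda>e. enc_list (rev (dec_list (left (foldl (\<lambda>st _. add_step st) (?i e) (dec_list (f e)))))))"
    by (intro pt_intros)
  then show ?thesis unfolding foldl_add_step by (simp add: add_def)
qed

lemma length_add_bits [simp]: "length (add_bits ks c a b) = length ks"
  by (induction ks arbitrary: c a b) (auto simp: Let_def)

lemma size_add: "size (add ks a b) \<le> 2 * length (dec_list ks)"
proof -
  have "size (add ks a b) \<le> length (dec_list ks) * (1 + 1)"
    unfolding add_def by (rule size_enc_list_le) (auto simp: enc_bool_def)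
  then show ?thesis by simp
qed

text \<open>Sums are truncated at \<open>t\<close>, which keeps them short.\<close>

definition clamp :: "sexp \<Rightarrow> sexp \<Rightarrow> sexp" where
  "clamp t a = (if val t \<le> val a then t else a)"

definition cadd :: "sexp \<Rightarrow> sexp \<Rightarrow> sexp \<Rightarrow> sexp" where
  "cadd t a b = clamp t (add (CONS NIL t) (clamp t a) (clamp t b))"

lemma val_clamp: "val (clamp t a) = min (val t) (val a)"
  by (simp add: clamp_def)

lemma val_cadd: "val (cadd t a b) = min (val t) (val a + val b)"
proof -
  \<comment> \<open>The clock has one digit more than \<open>t\<close>, so the sum of two numbers of
    at most that length does not overflow.\<close>
  have "min (val t) (val a) + min (val t) (val b) < 2 ^ length (dec_list (CONS NIL t))"
    using val_less[of t] by simp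
  then show ?thesis by (simp add: cadd_def val_clamp val_add)
qed

text \<open>The bound mentions only \<open>t\<close>: sums and table entries keep the same size
  however many summands and levels of recursion contribute.\<close>

lemma size_cadd: "size (cadd t a b) \<le> 2 * size t + 2"
proof -
  have "size (add (CONS NIL t) x y) \<le> 2 * size t + 2" for x y
    using size_add[of "CONS NIL t" x y] length_le_size[of "dec_list t"] by simp
  then show ?thesis by (simp add: cadd_def clamp_def)
qed

lemma pt_clamp: "pt f \<Longrightarrow> pt g \<Longrightarrow> pt (\<lambda>e. clamp (f e) (g e))"
  unfolding clamp_def by (intro pt_intros ptb_le)

lemma pt_cadd: "pt f \<Longrightarrow> pt g \<Longrightarrow> pt h \<Longrightarrow> pt (\<lambda>e. cadd (f e) (g e) (h e))"
  unfolding cadd_def by (intro pt_intros pt_clamp pt_add)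

definition csum :: "sexp \<Rightarrow> sexp list \<Rightarrow> sexp" where
  "csum t xs = foldl (\<lambda>a x. cadd t x a) NIL xs"

lemma val_csum: "val (csum t xs) = min (val t) (\<Sum>x\<leftarrow>xs. val x)"
proof -
  have "val (foldl (\<lambda>a x. cadd t x a) i xs) = min (val t) (val i + (\<Sum>x\<leftarrow>xs. val x))" if "val i \<le> val t" for i
    using that by (induction xs arbitrary: i) (auto simp: val_cadd)
  then show ?thesis by (simp add: csum_def)
qed

lemma size_csum: "size (csum t xs) \<le> 2 * size t + 2"
proof -
  have "size (foldl (\<lambda>a x. cadd t x a) i xs) \<le> 2 * size t + 2" if "size i \<le> 2 * size t + 2" for i
    using that
  proof (induction xs arbitrary: i)
    case (Cons x xs)
    show ?case using Cons.IH[OF size_cadd[of t x i]] by simp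
  qed simp
  then show ?thesis by (simp add: csum_def)
qed

lemma pt_csum:
  assumes "pt f" "ptl L"
  shows "pt (\<lambda>e. csum (f e) (L e))"
  unfolding csum_def
proof (rule pt_foldl[where h = "\<lambda>x a e. cadd (f e) x a"])
  show "pbd (\<lambda>e. 2 * size (f e) + 2)" by (intro pbd_add pbd_mult pbd_const pt_pbd assms)
  show "size (foldl (\<lambda>a x. cadd (f e) x a) NIL (take j (L e))) \<le> 2 * size (f e) + 2" for e j
    using size_csum[of "f e" "take j (L e)"] by (simp add: csum_def)
  have "pt (\<lambda>e. f (right (right e)))"
    by (rule pt_comp[OF _ assms(1)]) (intro pt_intros)
  then show "pt (\<lambda>e. cadd (f (right (right e))) (left e) (left (right e)))"
    by (intro pt_cadd pt_intros)
qed (use assms in \<open>auto intro: pt_const simp: ptl_def\<close>)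

text \<open>A sum reaches \<open>val (f e)\<close> iff it does so after truncation at that value,
  hence \<open>csum\<close> decides the comparison without computing the sum.\<close>

lemma ptb_sum_ge:
  assumes "pt f" "ptl L"
  shows "ptb (\<lambda>e. val (f e) \<le> (\<Sum>x\<leftarrow>L e. val x))"
proof -
  have "ptb (\<lambda>e. val (f e) \<le> val (csum (f e) (L e)))"
    by (intro ptb_le pt_csum assms)
  then show ?thesis by (simp add: val_csum)
qed

definition smax :: "sexp list \<Rightarrow> sexp" where
  "smax xs = foldl (\<lambda>a x. if val a \<le> val x then x else a) NIL xs"

lemma smax_ge: "x \<in> set xs \<Longrightarrow> val x \<le> val (smax xs)"
proof -
  have "val i \<le> val (foldl (\<lambda>a x. if val a \<le> val x then x else a) i xs) \<and>
    (\<forall>x\<in>set xs. val x \<le> val (foldl (\<lambda>a x. if val a \<le> val x then x else a) i xs))" for i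
  proof (induction xs arbitrary: i)
    case (Cons y ys)
    show ?case using Cons[of y] Cons[of i] by auto
  qed simp
  then show "x \<in> set xs \<Longrightarrow> val x \<le> val (smax xs)" by (simp add: smax_def)
qed

lemma foldl_max_mem: "foldl (\<lambda>a x. if val a \<le> val x then x else a) i xs \<in> insert i (set xs)"
proof (induction xs arbitrary: i)
  case (Cons y ys)
  show ?case using Cons[of y] Cons[of i] by auto
qed simp

text \<open>The comparison in \<open>smax\<close> is not strict, so the first element replaces the
  initial \<open>NIL\<close> even if its value is 0.\<close>

lemma smax_mem: "xs \<noteq> [] \<Longrightarrow> smax xs \<in> set xs"
  using foldl_max_mem[of "hd xs" "tl xs"] by (cases xs) (auto simp: smax_def)

lemma pt_smax:
  assumes "ptl L"
  shows "pt (\<lambda>e. smax (L e))"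
  unfolding smax_def
proof (rule pt_foldl[where h = "\<lambda>x a e. if val a \<le> val x then x else a"])
  show "pbd (\<lambda>e. size (enc_list (L e)))" by (intro pt_pbd pt_enc_list assms)
  show "size (foldl (\<lambda>a x. if val a \<le> val x then x else a) NIL (take j (L e))) \<le> size (enc_list (L e))" for e j
  proof -
    let ?m = "foldl (\<lambda>a x. if val a \<le> val x then x else a) NIL (take j (L e))"
    have "?m = NIL \<or> ?m \<in> set (L e)"
      using foldl_max_mem[of NIL "take j (L e)"] set_take_subset[of j "L e"] by auto
    then show ?thesis using size_member[of ?m "L e"] by auto
  qed
  show "pt (\<lambda>e. if val (left (right e)) \<le> val (left e) then left e else left (right e))"
    by (intro pt_intros ptb_le)
qed (use assms in \<open>auto intro: pt_const simp: ptl_def\<close>)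

definition binary :: "sexp \<Rightarrow> sexp" where
  "binary u = foldl (\<lambda>a _. add u a (CONS (CONS NIL NIL) NIL)) NIL (dec_list u)"

lemma val_binary: "val (binary u) = length (dec_list u)"
proof -
  have "val (foldl (\<lambda>a _. add u a (CONS (CONS NIL NIL) NIL)) i xs) = val i + length xs"
    if "val i + length xs \<le> length (dec_list u)" for i and xs :: "sexp list"
    using that
  proof (induction xs arbitrary: i)
    case (Cons x xs)
    \<comment> \<open>For \<open>u\<close> of length \<open>n\<close>, the clock has
      \<open>n\<close> digits and the counter stays at most \<open>n\<close>; as
      \<open>n < 2 ^ n\<close>, no increment overflows.\<close>
    have "Suc (val i) < 2 ^ length (dec_list u)"
      using Cons.prems by (intro le_less_trans[OF _ less_exp]) simp
    then have "val (add u i (CONS (CONS NIL NIL) NIL)) = Suc (val i)"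
      by (simp add: val_add)
    then show ?case using Cons by simp
  qed simp
  from this[of NIL "dec_list u"] show ?thesis by (simp add: binary_def)
qed

lemma pt_binary:
  assumes "pt f"
  shows "pt (\<lambda>e. binary (f e))"
  unfolding binary_def
proof (rule pt_foldl[where h = "\<lambda>x a e. add (f e) a (CONS (CONS NIL NIL) NIL)"])
  show "pbd (\<lambda>e. 2 * length (dec_list (f e)))"
    by (intro pbd_mult pbd_const pbd_length pt_intros assms)
  show "size (foldl (\<lambda>a _. add (f e) a (CONS (CONS NIL NIL) NIL)) NIL (take j (dec_list (f e)))) \<le>
      2 * length (dec_list (f e))" for e j
    by (cases "take j (dec_list (f e))" rule: rev_cases) (auto intro: size_add)
  have "pt (\<lambda>e. f (right (right e)))"
    by (rule pt_comp[OF _ assms]) (intro pt_intros)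
  then show "pt (\<lambda>e. add (f (right (right e))) (left (right e)) (CONS (CONS NIL NIL) NIL))"
    by (intro pt_add pt_intros)
qed (use assms in \<open>auto intro: pt_const\<close>)

lemma ptb_length_less:
  assumes L: "ptl L" and M: "ptl M"
  shows "ptb (\<lambda>e. length (L e) < length (M e))"
proof -
  have "pt (\<lambda>e. foldl (\<lambda>a _. right a) (enc_list (M e)) (L e))"
    by (rule pt_foldl_linear[where h = "\<lambda>x a e. right a" and c = 0]) (auto intro!: pt_intros assms)
  moreover have "foldl (\<lambda>a _. right a) (enc_list xs) ys = enc_list (drop (length ys) xs)" for xs and ys :: "sexp list"
    by (induction ys arbitrary: xs) (auto simp: right_enc_list drop_Suc)
  ultimately have "pt (\<lambda>e. enc_list (drop (length (L e)) (M e)))" by simp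
  then have "ptb (\<lambda>e. enc_list (drop (length (L e)) (M e)) \<noteq> NIL)"
    by (intro ptb_not ptb_eq_NIL)
  then show ?thesis by (simp add: not_le)
qed

lemma ptb_length_le: "ptl L \<Longrightarrow> ptl M \<Longrightarrow> ptb (\<lambda>e. length (L e) \<le> length (M e))"
  using ptb_not[OF ptb_length_less[of M L]] by (simp add: not_less)

section \<open>The algorithm\<close>

abbreviation (input) "in_verts x \<equiv> dec_list (left x)"
abbreviation (input) "in_edges x \<equiv> dec_list (left (right x))"
abbreviation (input) "in_tasks x \<equiv> dec_list (left (right (right x)))"
abbreviation (input) "in_target x \<equiv> left (right (right (right x)))"
abbreviation (input) "in_bound x \<equiv> left (right (right (right (right x))))"

abbreviation (input) "edge_fst e \<equiv> left e"
abbreviation (input) "edge_snd e \<equiv> left (right e)"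
abbreviation (input) "edge_cap e \<equiv> dec_list (left (right (right e)))"

abbreviation (input) "task_src a \<equiv> left a"
abbreviation (input) "task_snk a \<equiv> left (right a)"
abbreviation (input) "task_dem a \<equiv> left (right (right a))"
abbreviation (input) "task_prf a \<equiv> left (right (right (right a)))"

text \<open>An item \<open>(v, a, i, q)\<close> says that the path of task \<open>a\<close> visits \<open>v\<close>, that at most \<open>i\<close> further
  edges (in unary) may be used, and that the next vertex is \<open>q\<close>; at the sink, \<open>q\<close> is irrelevant.\<close>

abbreviation (input) "item_loc z \<equiv> left z"
abbreviation (input) "item_task z \<equiv> left (right z)"
abbreviation (input) "item_idx z \<equiv> left (right (right z))"
abbreviation (input) "item_next z \<equiv> right (right (right z))"

section \<open>Adjacency and breadth-first search\<close>

definition adj :: "sexp \<Rightarrow> sexp \<Rightarrow> sexp \<Rightarrow> bool" where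
  "adj x u v \<longleftrightarrow> (\<exists>e\<in>set (in_edges x). (edge_fst e = u \<and> edge_snd e = v) \<or> (edge_fst e = v \<and> edge_snd e = u))"

lemma ptb_adj:
  assumes "pt x" "pt u" "pt v"
  shows "ptb (\<lambda>e. adj (x e) (u e) (v e))"
  unfolding adj_def by (intro pt_intros pt_shifts[OF assms(2)] pt_shifts[OF assms(3)] pt_shifts[OF assms(1)] assms)

text \<open>\<open>ks\<close> only counts rounds. Every round filters \<open>in_verts x\<close>
  anew: this bounds the size of the list and, after at least one round, gives it the order of
  \<open>in_verts x\<close>.\<close>

definition reach :: "sexp \<Rightarrow> sexp list \<Rightarrow> sexp list \<Rightarrow> sexp \<Rightarrow> sexp list" where
  "reach x B ks v = dec_list (foldl (\<lambda>R _. enc_list (filter (\<lambda>u. u \<in> set (dec_list R) \<or>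
     (u \<notin> set B \<and> (\<exists>w\<in>set (dec_list R). adj x w u))) (in_verts x))) (enc_list [v]) ks)"

lemma ptl_reach:
  assumes x: "pt x" and B: "ptl B" and ks: "ptl ks" and v: "pt v"
  shows "ptl (\<lambda>e. reach (x e) (B e) (ks e) (v e))"
  unfolding reach_def
proof (intro ptl_dec_list, rule pt_foldl[where h = "\<lambda>k R e. enc_list (filter (\<lambda>u. u \<in> set (dec_list R) \<or>
     (u \<notin> set (B e) \<and> (\<exists>w\<in>set (dec_list R). adj (x e) w u))) (in_verts (x e)))"])
  show "pbd (\<lambda>e. size (left (x e)) + (size (v e) + 1))"
    by (intro pbd_add pbd_const pt_pbd pt_intros x v)
  show "size (foldl (\<lambda>R _. enc_list (filter (\<lambda>u. u \<in> set (dec_list R) \<or>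
     (u \<notin> set (B e) \<and> (\<exists>w\<in>set (dec_list R). adj (x e) w u))) (in_verts (x e)))) (enc_list [v e]) (take j (ks e)))
      \<le> size (left (x e)) + (size (v e) + 1)" for e j
  proof (cases "take j (ks e)" rule: rev_cases)
    case (snoc ys y)
    have "size (enc_list (filter P xs)) \<le> size (enc_list xs)" for P xs
      by (induction xs) auto
    then have "size (enc_list (filter P (in_verts (x e)))) \<le> size (left (x e)) + (size (v e) + 1)" for P
      by (metis enc_dec trans_le_add1)
    then show ?thesis by (simp only: snoc foldl_append foldl_Cons foldl_Nil)
  qed (simp only: foldl_Nil, simp)
  show "pt (\<lambda>e. enc_list [v e])" by (intro pt_intros v)
  show "pt (\<lambda>e. enc_list (filter (\<lambda>u. u \<in> set (dec_list (left (right e))) \<or> (u \<notin> set (B (right (right e))) \<and>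
      (\<exists>w\<in>set (dec_list (left (right e))). adj (x (right (right e))) w u))) (in_verts (x (right (right e))))))"
    by (intro pt_intros ptb_adj pt_shifts[OF x] ptl_shifts[OF B])
qed (use ks in \<open>simp add: ptl_def\<close>)

text \<open>The clock has \<open>n * n\<close> entries for \<open>n\<close> vertices, no fewer than
  the pairs of the step relation; within that many steps \<open>rtrancl_finite_eq_relpow\<close>
  finds everything reachable.\<close>

definition component :: "sexp \<Rightarrow> sexp list \<Rightarrow> sexp \<Rightarrow> sexp list" where
  "component x B v = reach x B (concat (map (\<lambda>_. in_verts x) (in_verts x))) v"

lemma ptl_component:
  assumes "pt x" "ptl B" "pt v"
  shows "ptl (\<lambda>e. component (x e) (B e) (v e))"
  unfolding component_def by (intro ptl_reach pt_intros ptl_shifts[OF assms(2)] pt_shifts[OF assms(1)] pt_shifts[OF assms(3)] assms)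

definition unaries :: "sexp list \<Rightarrow> sexp list" where
  "unaries xs = dec_list (foldl (\<lambda>a _. CONS (CONS NIL (left a)) a) (CONS NIL NIL) xs)"

lemma enc_unary_Suc: "enc_unary (Suc n) = CONS NIL (enc_unary n)"
  by (simp add: enc_unary_def)

lemma size_enc_unary [simp]: "size (enc_unary n) = n"
  by (induction n) (auto simp: enc_unary_def)

lemma length_dec_enc_unary [simp]: "length (dec_list (enc_unary n)) = n"
  by (simp add: enc_unary_def)

lemma enc_unary_inject [simp]: "enc_unary m = enc_unary n \<longleftrightarrow> m = n"
  by (metis size_enc_unary)

lemma foldl_unaries:
  "foldl (\<lambda>a _. CONS (CONS NIL (left a)) a) (CONS NIL NIL) xs = enc_list (rev (map enc_unary [0..<Suc (length xs)]))"
  by (induction xs rule: rev_induct) (auto simp: enc_unary_Suc enc_unary_def[of 0])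

lemma set_unaries: "set (unaries xs) = enc_unary ` {..length xs}"
  by (auto simp: unaries_def foldl_unaries less_Suc_eq_le)

lemma distinct_unaries: "distinct (unaries xs)"
  by (auto simp: unaries_def foldl_unaries distinct_map inj_on_def)

lemma ptl_unaries:
  assumes "ptl L"
  shows "ptl (\<lambda>e. unaries (L e))"
  unfolding unaries_def
proof (intro ptl_dec_list, rule pt_foldl[where h = "\<lambda>x a e. CONS (CONS NIL (left a)) a"])
  show "pbd (\<lambda>e. (length (L e) + 1) * (length (L e) + 1))"
    by (intro pbd_mult pbd_add pbd_const pbd_length assms)
  show "size (foldl (\<lambda>a _. CONS (CONS NIL (left a)) a) (CONS NIL NIL) (take j (L e)))
      \<le> (length (L e) + 1) * (length (L e) + 1)" for e j
    unfolding foldl_unaries by (rule size_enc_list_le) auto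
qed (use assms in \<open>auto simp: ptl_def intro!: pt_intros\<close>)

text \<open>Routes are simple paths, so budgets up to the number of vertices suffice for any length
  bound and the unary code stays short. A negative bound yields the empty list.\<close>

definition indices :: "sexp \<Rightarrow> sexp list" where
  "indices x = filter (\<lambda>i. left (in_bound x) = NIL \<and> val (binary i) \<le> val (right (in_bound x))) (unaries (in_verts x))"

lemma ptl_indices:
  assumes "pt x"
  shows "ptl (\<lambda>e. indices (x e))"
  unfolding indices_def
  by (intro ptl_filter ptl_unaries pt_intros ptb_le pt_binary pt_shifts[OF assms(1)] assms)

section \<open>Free tasks, items and their constraints\<close>

definition nonfree :: "sexp \<Rightarrow> bool" where
  "nonfree a \<longleftrightarrow> 0 < val (task_dem a) \<and> task_src a \<noteq> task_snk a"

lemma ptb_nonfree: "pt f \<Longrightarrow> ptb (\<lambda>e. nonfree (f e))"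
  unfolding nonfree_def by (intro pt_intros ptb_pos)

text \<open>The unary index \<open>i\<close> itself is the clock of the search, which then finds the
  vertices at distance at most \<open>i\<close>.\<close>

definition free_profits :: "sexp \<Rightarrow> sexp list" where
  "free_profits x = map (\<lambda>a. task_prf a) (filter (\<lambda>a. \<not> nonfree a \<and>
     (\<exists>i\<in>set (indices x). task_snk a \<in> set (reach x [] (dec_list i) (task_src a)))) (in_tasks x))"

lemma ptl_free_profits:
  assumes "pt x"
  shows "ptl (\<lambda>e. free_profits (x e))"
  unfolding free_profits_def
  by (intro ptl_filter ptl_map ptl_reach ptb_nonfree ptl_indices pt_intros pt_shifts[OF assms(1)] assms)

text \<open>Away from the sink the budget must be positive, so a chain of items with falling budgets
  cannot stop before the sink.\<close>

definition items :: "sexp \<Rightarrow> sexp list" where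
  "items x = concat (map (\<lambda>v. concat (map (\<lambda>a. concat (map (\<lambda>i. map (\<lambda>q. CONS v (CONS a (CONS i q)))
     (filter (\<lambda>q. v = task_snk a \<or> (i \<noteq> NIL \<and> adj x v q)) (in_verts x))) (indices x)))
     (filter nonfree (in_tasks x)))) (in_verts x))"

lemma ptl_items:
  assumes "pt x"
  shows "ptl (\<lambda>e. items (x e))"
  unfolding items_def
  by (intro ptl_indices ptb_nonfree ptb_adj pt_intros pt_shifts[OF assms(1)] assms)

text \<open>A number in unary, like the capacities it is made of. It bounds the size of a bag and
  also the number of items that a routing places on it.\<close>

definition load :: "sexp \<Rightarrow> sexp list \<Rightarrow> sexp list" where
  "load x B = concat (map (\<lambda>v. NIL # concat (map (\<lambda>e. if edge_fst e = v \<or> edge_snd e = v then edge_cap e else [])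
     (in_edges x))) B)"

lemma ptl_load:
  assumes "pt x" "ptl B"
  shows "ptl (\<lambda>e. load (x e) (B e))"
  unfolding load_def
  by (intro pt_intros pt_shifts[OF assms(1)] assms)

text \<open>An item at its sink also counts if its arbitrary next vertex happens to be the other
  end. This only tightens the capacity constraint, and items made from a routing avoid it, see
  \<open>next_vertex\<close>.\<close>

definition uses :: "sexp \<Rightarrow> sexp \<Rightarrow> bool" where
  "uses e z \<longleftrightarrow> (item_loc z = edge_fst e \<and> item_next z = edge_snd e) \<or> (item_loc z = edge_snd e \<and> item_next z = edge_fst e)"

lemma ptb_uses: "pt f \<Longrightarrow> pt g \<Longrightarrow> ptb (\<lambda>e. uses (f e) (g e))"
  unfolding uses_def by (intro pt_intros)

text \<open>The last clause says that the demands do not exceed the capacity, as the negation of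
  reaching capacity plus one, which is the form decided by \<open>ptb_sum_ge\<close>; the additional
  \<open>NIL\<close> supplies the one. An item that leaves \<open>B\<close> is left to a bag that
  holds both ends.\<close>

definition consistent :: "sexp \<Rightarrow> sexp list \<Rightarrow> sexp list \<Rightarrow> bool" where
  "consistent x B F \<longleftrightarrow>
     (\<forall>y\<in>set F. \<forall>z\<in>set F. item_loc y = item_loc z \<and> item_task y = item_task z \<longrightarrow> y = z) \<and>
     (\<forall>z\<in>set F. item_loc z = task_snk (item_task z) \<or> item_next z \<notin> set B \<or>
       (\<exists>y\<in>set F. item_loc y = item_next z \<and> item_task y = item_task z \<and> item_idx y = right (item_idx z))) \<and>
     (\<forall>e\<in>set (in_edges x). edge_fst e \<in> set B \<and> edge_snd e \<in> set B \<longrightarrow>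
       \<not> val (binary (CONS NIL (enc_list (edge_cap e)))) \<le> (\<Sum>d\<leftarrow>map (\<lambda>z. task_dem (item_task z)) (filter (uses e) F). val d))"

lemma ptb_consistent:
  assumes "pt x" "ptl B" "ptl F"
  shows "ptb (\<lambda>e. consistent (x e) (B e) (F e))"
  unfolding consistent_def
  by (intro pt_intros ptb_sum_ge ptb_uses pt_binary pt_shifts[OF assms(1)] ptl_shifts[OF assms(2)] ptl_shifts[OF assms(3)] assms)

section \<open>The table of the dynamic program\<close>

definition neighbours :: "sexp \<Rightarrow> sexp list \<Rightarrow> sexp list \<Rightarrow> sexp list" where
  "neighbours x B C = filter (\<lambda>u. \<exists>w\<in>set C. adj x u w) B"

lemma ptl_neighbours:
  assumes "pt x" "ptl B" "ptl C"
  shows "ptl (\<lambda>e. neighbours (x e) (B e) (C e))"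
  unfolding neighbours_def
  by (intro pt_intros ptb_adj pt_shifts[OF assms(1)] ptl_shifts[OF assms(2)] ptl_shifts[OF assms(3)] assms)

text \<open>\<open>B\<close> is the next bag for the vertex set \<open>C\<close> with boundary \<open>N\<close>, and \<open>G\<close> the set of items on \<open>B\<close>,
  which must agree on \<open>N\<close> with the given items \<open>F\<close>. Sets are represented by sublists of
  \<open>in_verts x\<close> and \<open>items x\<close>, so that no element is counted twice.\<close>

definition admissible :: "sexp \<Rightarrow> sexp \<Rightarrow> sexp list \<Rightarrow> sexp list \<Rightarrow> sexp list \<Rightarrow> sexp list \<Rightarrow> sexp list \<Rightarrow> bool" where
  "admissible x K C N F B G \<longleftrightarrow>
     B = filter (\<lambda>v. v \<in> set B) (in_verts x) \<and> length (load x B) \<le> length (dec_list K) \<and>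
     (\<forall>u\<in>set N. u \<in> set B) \<and> (\<forall>u\<in>set B. u \<in> set N \<or> u \<in> set C) \<and>
     G = filter (\<lambda>z. z \<in> set G) (items x) \<and> (\<forall>z\<in>set G. item_loc z \<in> set B) \<and> consistent x B G \<and>
     (\<forall>z\<in>set F. item_loc z \<in> set N \<longrightarrow> z \<in> set G) \<and> (\<forall>z\<in>set G. item_loc z \<in> set N \<longrightarrow> z \<in> set F)"

lemma ptb_admissible:
  assumes "pt x" "pt K" "ptl C" "ptl N" "ptl F" "ptl B" "ptl G"
  shows "ptb (\<lambda>e. admissible (x e) (K e) (C e) (N e) (F e) (B e) (G e))"
  unfolding admissible_def
  by (intro pt_intros ptb_list_eq ptb_length_le ptl_load ptl_items ptb_consistent
      pt_shifts[OF assms(1)] pt_shifts[OF assms(2)] ptl_shifts[OF assms(3)] ptl_shifts[OF assms(4)]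
      ptl_shifts[OF assms(5)] ptl_shifts[OF assms(6)] ptl_shifts[OF assms(7)] assms)

text \<open>Each component is represented by its first vertex in the order of
  \<open>in_verts x\<close>, so its value is added exactly once.\<close>

definition reps :: "sexp \<Rightarrow> sexp list \<Rightarrow> sexp list \<Rightarrow> sexp list" where
  "reps x C B = filter (\<lambda>u. u \<in> set C \<and> u \<notin> set B \<and> left (enc_list (component x B u)) = u) (in_verts x)"

lemma ptl_reps:
  assumes "pt x" "ptl C" "ptl B"
  shows "ptl (\<lambda>e. reps (x e) (C e) (B e))"
  unfolding reps_def
  by (intro pt_intros ptl_component pt_shifts[OF assms(1)] ptl_shifts[OF assms(2)] ptl_shifts[OF assms(3)] assms)

definition key :: "sexp list \<Rightarrow> sexp list \<Rightarrow> sexp \<Rightarrow> sexp" where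
  "key B F v = CONS (enc_list B) (CONS (enc_list F) v)"

lemma pt_key: "ptl B \<Longrightarrow> ptl F \<Longrightarrow> pt v \<Longrightarrow> pt (\<lambda>e. key (B e) (F e) (v e))"
  unfolding key_def by (intro pt_intros)

definition lookup :: "sexp list \<Rightarrow> sexp \<Rightarrow> sexp" where
  "lookup T k = right (left (enc_list (filter (\<lambda>t. left t = k) T)))"

lemma pt_lookup:
  assumes "ptl T" "pt k"
  shows "pt (\<lambda>e. lookup (T e) (k e))"
  unfolding lookup_def by (intro pt_intros pt_shifts[OF assms(2)] assms)

text \<open>A task earns its profit at its source. Items on the boundary are left out here: they
  were counted by the bag that took their vertex out of the set still to be processed.\<close>

definition bag_value :: "sexp \<Rightarrow> sexp list \<Rightarrow> sexp list \<Rightarrow> sexp list \<Rightarrow> sexp list \<Rightarrow> sexp" where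
  "bag_value x T C B G = csum (in_target x)
     (map (\<lambda>z. task_prf (item_task z)) (filter (\<lambda>z. item_loc z \<in> set C \<and> item_loc z = task_src (item_task z)) G) @
      map (\<lambda>u. lookup T (key B G u)) (reps x C B))"

lemma pt_bag_value:
  assumes "pt x" "ptl T" "ptl C" "ptl B" "ptl G"
  shows "pt (\<lambda>e. bag_value (x e) (T e) (C e) (B e) (G e))"
  unfolding bag_value_def
  by (intro pt_csum pt_intros pt_lookup pt_key ptl_reps pt_shifts[OF assms(1)] ptl_shifts[OF assms(2)]
      ptl_shifts[OF assms(3)] ptl_shifts[OF assms(4)] ptl_shifts[OF assms(5)] assms)

text \<open>A choice counts only if every component has an entry. A missing entry means that no
  recursion has been found there, so the presence of an entry carries information besides its
  value.\<close>

definition candidates :: "sexp \<Rightarrow> sexp \<Rightarrow> sexp \<Rightarrow> sexp list \<Rightarrow> sexp list \<Rightarrow> sexp list \<Rightarrow> sexp list \<Rightarrow> sexp list" where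
  "candidates x K U T C N F = concat (map (\<lambda>b. concat (map (\<lambda>g.
     if admissible x K C N F (dec_list b) (dec_list g) \<and>
       (\<forall>u\<in>set (reps x C (dec_list b)). \<exists>t\<in>set T. left t = key (dec_list b) (dec_list g) u)
     then [bag_value x T C (dec_list b) (dec_list g)] else []) (dec_list U))) (dec_list U))"

lemma ptl_candidates:
  assumes "pt x" "pt K" "pt U" "ptl T" "ptl C" "ptl N" "ptl F"
  shows "ptl (\<lambda>e. candidates (x e) (K e) (U e) (T e) (C e) (N e) (F e))"
  unfolding candidates_def
  by (intro ptl_concat_map ptl_If ptb_admissible pt_bag_value pt_key ptl_reps pt_intros
      pt_shifts[OF assms(1)] pt_shifts[OF assms(2)] pt_shifts[OF assms(3)]
      ptl_shifts[OF assms(4)] ptl_shifts[OF assms(5)] ptl_shifts[OF assms(6)] ptl_shifts[OF assms(7)] assms)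

definition entry :: "sexp \<Rightarrow> sexp list \<Rightarrow> sexp list" where
  "entry k c = (if c = [] then [] else [CONS k (smax c)])"

lemma ptl_entry: "pt k \<Longrightarrow> ptl c \<Longrightarrow> ptl (\<lambda>e. entry (k e) (c e))"
  unfolding entry_def by (intro pt_intros pt_smax)

definition table_step :: "sexp \<Rightarrow> sexp \<Rightarrow> sexp \<Rightarrow> sexp list \<Rightarrow> sexp list" where
  "table_step x K U T = concat (map (\<lambda>b. concat (map (\<lambda>f. concat (map (\<lambda>v.
     if v \<in> set (dec_list b) then [] else entry (key (dec_list b) (dec_list f) v)
       (candidates x K U T (component x (dec_list b) v)
         (neighbours x (dec_list b) (component x (dec_list b) v)) (dec_list f)))
     (in_verts x))) (dec_list U))) (dec_list U))"

lemma ptl_table_step: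
  assumes "pt x" "pt K" "pt U" "ptl T"
  shows "ptl (\<lambda>e. table_step (x e) (K e) (U e) (T e))"
  unfolding table_step_def
  by (intro pt_intros ptl_entry pt_key ptl_candidates ptl_component ptl_neighbours
      pt_shifts[OF assms(1)] pt_shifts[OF assms(2)] pt_shifts[OF assms(3)] ptl_shifts[OF assms(4)] assms)

lemma length_concat_map_le:
  assumes "\<And>x. x \<in> set xs \<Longrightarrow> length (f x) \<le> m"
  shows "length (concat (map f xs)) \<le> length xs * m"
  using assms by (induction xs) (auto simp: add_mono)

text \<open>Keys range over two words and a vertex, and values are sums truncated at the target. The
  bound is thus independent of \<open>T\<close> and remains the same in all rounds.\<close>

lemma size_table_step:
  "size (enc_list (table_step x K U T)) \<le>
    (size U * (size U * size x)) * (2 * size U + 3 * size x + 5 + 1)"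
proof (rule size_enc_list_le)
  have l: "length (dec_list y) \<le> size y" for y using length_le_size[of "dec_list y"] by simp
  have s: "length (in_verts x) \<le> size x" using l[of "left x"] size_left[of x] by linarith
  have "length (table_step x K U T) \<le> length (dec_list U) * (length (dec_list U) * (length (in_verts x) * 1))"
    unfolding table_step_def by (intro length_concat_map_le) (auto simp: entry_def)
  also have "\<dots> \<le> size U * (size U * size x)"
    using l[of U] s by (intro mult_le_mono) auto
  finally show "length (table_step x K U T) \<le> size U * (size U * size x)" .
next
  fix y assume "y \<in> set (table_step x K U T)"
  then obtain b f v where bfv: "b \<in> set (dec_list U)" "f \<in> set (dec_list U)" "v \<in> set (in_verts x)"
    and y: "y \<in> set (entry (key (dec_list b) (dec_list f) v)
       (candidates x K U T (component x (dec_list b) v)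
         (neighbours x (dec_list b) (component x (dec_list b) v)) (dec_list f)))"
    unfolding table_step_def by (auto split: if_splits)
  then obtain c where "y = CONS (key (dec_list b) (dec_list f) v) c"
    "c \<in> set (candidates x K U T (component x (dec_list b) v)
         (neighbours x (dec_list b) (component x (dec_list b) v)) (dec_list f))"
    by (auto simp: entry_def smax_mem split: if_splits)
  moreover from this(2) obtain ys where "c = csum (in_target x) ys"
    by (auto simp: candidates_def bag_value_def split: if_splits)
  then have "size c \<le> 2 * size (in_target x) + 2"
    using size_csum by blast
  moreover have "size (in_target x) \<le> size x"
    by (meson le_trans size_left size_right)
  moreover have "size b \<le> size U" "size f \<le> size U" "size v \<le> size x"
    using bfv size_member[of b "dec_list U"] size_member[of f "dec_list U"] size_member[of v "in_verts x"]
      size_left[of x] by (auto intro: Suc_leD le_trans)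
  ultimately show "size y \<le> 2 * size U + 3 * size x + 5"
    by (simp add: key_def)
qed

definition tables :: "sexp \<Rightarrow> sexp \<Rightarrow> sexp \<Rightarrow> sexp list \<Rightarrow> sexp list" where
  "tables x K U ks = dec_list (foldl (\<lambda>T _. enc_list (table_step x K U (dec_list T))) NIL ks)"

lemma tables_Nil [simp]: "tables x K U [] = []"
  by (simp add: tables_def)

lemma tables_snoc [simp]: "tables x K U (ks @ [k]) = table_step x K U (tables x K U ks)"
  by (simp add: tables_def)

lemma ptl_tables:
  assumes "pt x" "pt K" "pt U" "ptl ks"
  shows "ptl (\<lambda>e. tables (x e) (K e) (U e) (ks e))"
  unfolding tables_def
proof (intro ptl_dec_list, rule pt_foldl[where h = "\<lambda>k T e. enc_list (table_step (x e) (K e) (U e) (dec_list T))"])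
  show "pbd (\<lambda>e. (size (U e) * (size (U e) * size (x e))) * (2 * size (U e) + 3 * size (x e) + 5 + 1))"
    by (intro pbd_mult pbd_add pbd_const pt_pbd assms)
  show "size (foldl (\<lambda>T _. enc_list (table_step (x e) (K e) (U e) (dec_list T))) NIL (take j (ks e)))
      \<le> (size (U e) * (size (U e) * size (x e))) * (2 * size (U e) + 3 * size (x e) + 5 + 1)" for e j
    by (cases "take j (ks e)" rule: rev_cases) (simp only: foldl_Nil, simp, simp only: foldl_append foldl_Cons foldl_Nil size_table_step)
  show "pt (\<lambda>e. enc_list (table_step (x (right (right e))) (K (right (right e))) (U (right (right e))) (dec_list (left (right e)))))"
    by (intro pt_intros ptl_table_step pt_shifts[OF assms(1)] pt_shifts[OF assms(2)] pt_shifts[OF assms(3)] assms)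
qed (use assms in \<open>auto simp: ptl_def intro: pt_const\<close>)

section \<open>Rounds of the main loop\<close>

definition results :: "sexp \<Rightarrow> sexp \<Rightarrow> sexp \<Rightarrow> sexp list" where
  "results x K U = candidates x K U (tables x K U (in_verts x)) (in_verts x) [] []"

definition enough :: "sexp \<Rightarrow> sexp \<Rightarrow> sexp \<Rightarrow> bool" where
  "enough x K U \<longleftrightarrow> val (in_target x) \<le> (\<Sum>p\<leftarrow>smax (results x K U) # free_profits x. val p)"

definition letters :: "sexp \<Rightarrow> sexp list" where
  "letters x = in_verts x @ items x"

text \<open>Adding the empty word again keeps the shorter words, so iteration from the empty word
  yields all lengths up to the number of rounds.\<close>

definition words :: "sexp \<Rightarrow> sexp list \<Rightarrow> sexp list" where
  "words x U = NIL # concat (map (\<lambda>a. map (\<lambda>l. CONS a l) U) (letters x))"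

text \<open>The state of the main loop consists of a flag that is not NIL as long as the loop continues,
  the input, the current size bound \<open>K\<close> in unary, and the list \<open>U\<close> of all words of length at most \<open>K\<close>
  over \<open>letters x\<close>. In the end, the part behind the flag is replaced by the answer.\<close>

definition round_step :: "sexp \<Rightarrow> sexp" where
  "round_step st = (let x = left (right st); K = left (right (right st)); U = right (right (right st)) in
     if results x K U = [] then CONS (CONS NIL NIL) (CONS x (CONS (CONS NIL K) (enc_list (words x (dec_list U)))))
     else CONS NIL (enc_bool (enough x K U)))"

lemma ptl_results: "pt x \<Longrightarrow> pt K \<Longrightarrow> pt U \<Longrightarrow> ptl (\<lambda>e. results (x e) (K e) (U e))"
  unfolding results_def by (intro ptl_candidates ptl_tables pt_intros)

lemma ptl_letters: "pt x \<Longrightarrow> ptl (\<lambda>e. letters (x e))"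
  unfolding letters_def by (intro ptl_items pt_intros)

lemma pt_round_step: "pt round_step"
  unfolding round_step_def Let_def enough_def words_def
  by (intro pt_intros ptl_results pt_enc_bool ptb_sum_ge pt_smax ptl_free_profits ptl_letters)

section \<open>Correctness of the dynamic program\<close>

locale uf_input =
  fixes x :: sexp
  assumes distinct_verts: "distinct (in_verts x)"
    and distinct_items: "distinct (items x)"
    and edges_wf: "e \<in> set (in_edges x) \<Longrightarrow> edge_fst e \<in> set (in_verts x) \<and> edge_snd e \<in> set (in_verts x)"
begin

abbreviation "V \<equiv> set (in_verts x)"

lemma adj_sym: "adj x u v \<Longrightarrow> adj x v u"
  unfolding adj_def by blast

lemma adj_verts: "adj x u v \<Longrightarrow> u \<in> V \<and> v \<in> V"
  unfolding adj_def using edges_wf by blast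

section \<open>Components of vertex-deleted subgraphs and their neighbours\<close>

definition rel :: "sexp set \<Rightarrow> (sexp \<times> sexp) set" where
  "rel B = {(u, w). adj x u w \<and> u \<notin> B \<and> w \<notin> B}"

definition cc :: "sexp set \<Rightarrow> sexp \<Rightarrow> sexp set" where
  "cc B v = {w. (v, w) \<in> (rel B)\<^sup>*}"

definition NB :: "sexp set \<Rightarrow> sexp set" where
  "NB C = {u \<in> V - C. \<exists>w\<in>C. adj x u w}"

lemma rel_sym: "sym (rel B)"
  unfolding sym_def rel_def using adj_sym by blast

lemma cc_refl: "v \<in> cc B v"
  by (simp add: cc_def)

lemma cc_subset: "v \<in> V - B \<Longrightarrow> cc B v \<subseteq> V - B"
proof
  fix w assume "v \<in> V - B" "w \<in> cc B v"
  from this(2) have "(v, w) \<in> (rel B)\<^sup>*" by (simp add: cc_def)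
  then show "w \<in> V - B" using \<open>v \<in> V - B\<close>
    by (induction rule: rtrancl_induct) (auto simp: rel_def dest: adj_verts)
qed

lemma cc_eq: "u \<in> cc B v \<Longrightarrow> cc B u = cc B v"
proof -
  assume "u \<in> cc B v"
  then have "(v, u) \<in> (rel B)\<^sup>*" by (simp add: cc_def)
  moreover have "(u, v) \<in> (rel B)\<^sup>*"
    using \<open>(v, u) \<in> (rel B)\<^sup>*\<close> rel_sym by (meson sym_rtrancl symD)
  ultimately show ?thesis unfolding cc_def by (auto intro: rtrancl_trans)
qed

lemma cc_disjoint: "cc B u \<noteq> cc B v \<Longrightarrow> cc B u \<inter> cc B v = {}"
  using cc_eq by blast

lemma cc_step: "v \<in> V - B \<Longrightarrow> w \<in> cc B v \<Longrightarrow> adj x w u \<Longrightarrow> u \<notin> B \<Longrightarrow> u \<in> cc B v"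
  using cc_subset[of v B] by (auto simp: cc_def rel_def intro: rtrancl_into_rtrancl)

lemma NB_cc: "v \<in> V - B \<Longrightarrow> NB (cc B v) \<subseteq> B"
  unfolding NB_def using cc_step adj_sym by blast

text \<open>A walk that leaves \<open>C\<close> has to enter \<open>NB C\<close>, and these vertices
  are removed with \<open>B\<close>. This is what makes the recursion descend to parts of
  \<open>C\<close>.\<close>

lemma cc_inside:
  assumes "C \<subseteq> V" "NB C \<subseteq> B" "u \<in> C - B"
  shows "cc B u \<subseteq> C - B"
proof
  fix w assume "w \<in> cc B u"
  then have "(u, w) \<in> (rel B)\<^sup>*" by (simp add: cc_def)
  then show "w \<in> C - B"
  proof (induction rule: rtrancl_induct)
    case (step y z)
    then have "adj x y z" "z \<notin> B" by (auto simp: rel_def)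
    then show ?case using step assms(2) adj_verts[of y z] adj_sym unfolding NB_def by blast
  qed (use assms in auto)
qed

lemma set_reach:
  assumes "v \<in> V - set B"
  shows "set (reach x B ks v) = {w. \<exists>j\<le>length ks. (v, w) \<in> rel (set B) ^^ j}"
proof (induction ks rule: rev_induct)
  case Nil
  then show ?case by (auto simp: reach_def)
next
  case (snoc k ks)
  have "set (reach x B (ks @ [k]) v) = {u \<in> V. u \<in> set (reach x B ks v) \<or>
      (u \<notin> set B \<and> (\<exists>w\<in>set (reach x B ks v). adj x w u))}"
    by (auto simp: reach_def)
  also have "\<dots> = {u. u \<in> set (reach x B ks v) \<or> (\<exists>w\<in>set (reach x B ks v). (w, u) \<in> rel (set B))}"
  proof -
    have "u \<in> V - set B" if "u \<in> set (reach x B ks v)" for u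
    proof -
      have "u \<in> cc (set B) v" using that snoc relpow_imp_rtrancl unfolding cc_def by blast
      then show ?thesis using cc_subset[OF assms] by blast
    qed
    then show ?thesis by (auto simp: rel_def dest: adj_verts)
  qed
  also have "\<dots> = {w. \<exists>j\<le>length (ks @ [k]). (v, w) \<in> rel (set B) ^^ j}"
  proof (intro equalityI subsetI)
    fix u assume "u \<in> {u. u \<in> set (reach x B ks v) \<or> (\<exists>w\<in>set (reach x B ks v). (w, u) \<in> rel (set B))}"
    then consider "\<exists>j\<le>length ks. (v, u) \<in> rel (set B) ^^ j"
      | w j where "j \<le> length ks" "(v, w) \<in> rel (set B) ^^ j" "(w, u) \<in> rel (set B)"
      using snoc by blast
    then show "u \<in> {w. \<exists>j\<le>length (ks @ [k]). (v, w) \<in> rel (set B) ^^ j}"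
    proof cases
      case 1
      then show ?thesis by (auto intro: le_SucI)
    next
      case 2
      then have "(v, u) \<in> rel (set B) ^^ Suc j" by auto
      then show ?thesis using 2(1) by (intro CollectI exI[of _ "Suc j"]) auto
    qed
  next
    fix u assume "u \<in> {w. \<exists>j\<le>length (ks @ [k]). (v, w) \<in> rel (set B) ^^ j}"
    then obtain j where j: "j \<le> Suc (length ks)" "(v, u) \<in> rel (set B) ^^ j" by auto
    show "u \<in> {u. u \<in> set (reach x B ks v) \<or> (\<exists>w\<in>set (reach x B ks v). (w, u) \<in> rel (set B))}"
    proof (cases j)
      case (Suc i)
      then obtain w where "(v, w) \<in> rel (set B) ^^ i" "(w, u) \<in> rel (set B)"
        using j(2) by (auto elim: relpow_Suc_E)
      then show ?thesis using snoc j(1) Suc by auto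
    qed (use j snoc in auto)
  qed
  finally show ?case .
qed

lemma set_component:
  assumes "v \<in> V - set B"
  shows "set (component x B v) = cc (set B) v"
proof -
  have fin: "finite (rel (set B))" and card: "card (rel (set B)) \<le> length (concat (map (\<lambda>_. in_verts x) (in_verts x)))"
  proof -
    have sub: "rel (set B) \<subseteq> V \<times> V" using adj_verts by (auto simp: rel_def)
    then show "finite (rel (set B))" by (rule finite_subset) simp
    have "card (rel (set B)) \<le> card (V \<times> V)" by (rule card_mono[OF _ sub]) simp
    also have "\<dots> = length (in_verts x) * length (in_verts x)"
      using distinct_verts by (simp add: card_cartesian_product distinct_card)
    also have "\<dots> = length (concat (map (\<lambda>_. in_verts x) (in_verts x)))"
    proof -
      have "length (concat (map (\<lambda>_. in_verts x) ys)) = length ys * length (in_verts x)" for ys :: "sexp list"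
        by (induction ys) auto
      then show ?thesis by simp
    qed
    finally show "card (rel (set B)) \<le> length (concat (map (\<lambda>_. in_verts x) (in_verts x)))" .
  qed
  show ?thesis
    unfolding component_def set_reach[OF assms] cc_def
  proof (intro Collect_cong iffI)
    fix w assume "(v, w) \<in> (rel (set B))\<^sup>*"
    then obtain j where "j \<le> card (rel (set B))" "(v, w) \<in> rel (set B) ^^ j"
      using rtrancl_finite_eq_relpow[OF fin] by auto
    then show "\<exists>j\<le>length (concat (map (\<lambda>_. in_verts x) (in_verts x))). (v, w) \<in> rel (set B) ^^ j"
      using card le_trans by blast
  qed (use relpow_imp_rtrancl in blast)
qed

text \<open>Being a filtered copy of \<open>in_verts x\<close>, the list depends on the set
  \<open>cc (set B) v\<close> only. All vertices of a component share it, so its head can serve as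
  representative.\<close>

lemma component_canonical:
  assumes "v \<in> V - set B"
  shows "component x B v = filter (\<lambda>u. u \<in> cc (set B) v) (in_verts x)"
proof -
  \<comment> \<open>The clock is nonempty because \<open>v\<close> is a vertex, so there is a last
    round whose filter produced the list.\<close>
  obtain ks k where ks: "concat (map (\<lambda>_. in_verts x) (in_verts x)) = ks @ [k]"
    using assms by (cases "concat (map (\<lambda>_. in_verts x) (in_verts x))" rule: rev_cases) auto
  obtain P where "component x B v = filter P (in_verts x)"
    unfolding component_def reach_def ks by auto
  moreover have "filter P (in_verts x) = filter (\<lambda>u. u \<in> set (filter P (in_verts x))) (in_verts x)" for P
    by (rule filter_cong) auto
  ultimately show ?thesis using set_component[OF assms] by metis
qed

definition rep :: "sexp set \<Rightarrow> sexp \<Rightarrow> sexp" where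
  "rep B u = hd (filter (\<lambda>w. w \<in> cc B u) (in_verts x))"

lemma rep_in_cc: "u \<in> V - B \<Longrightarrow> rep B u \<in> cc B u"
proof -
  assume u: "u \<in> V - B"
  then have "filter (\<lambda>w. w \<in> cc B u) (in_verts x) \<noteq> []"
    using cc_refl[of u B] by (auto simp: filter_empty_conv)
  then have "rep B u \<in> set (filter (\<lambda>w. w \<in> cc B u) (in_verts x))"
    unfolding rep_def by (rule hd_in_set)
  then show ?thesis by auto
qed

lemma set_reps: "C \<subseteq> V \<Longrightarrow> set C' = C \<Longrightarrow> set (reps x C' B) = {u \<in> C - set B. rep (set B) u = u}"
proof -
  assume C: "C \<subseteq> V" "set C' = C"
  have "left (enc_list (component x B u)) = rep (set B) u" if "u \<in> V - set B" for u
    using that cc_refl[of u "set B"]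
    by (auto simp: component_canonical left_enc_list rep_def filter_empty_conv)
  then show ?thesis using C unfolding reps_def by auto
qed

lemma reps_partition:
  assumes C: "C \<subseteq> V" "NB C \<subseteq> B"
  shows "(\<Union>u\<in>{u \<in> C - B. rep B u = u}. cc B u) = C - B"
    and "\<And>u v. u \<in> {u \<in> C - B. rep B u = u} \<Longrightarrow> v \<in> {u \<in> C - B. rep B u = u} \<Longrightarrow> u \<noteq> v \<Longrightarrow> cc B u \<inter> cc B v = {}"
proof -
  show "(\<Union>u\<in>{u \<in> C - B. rep B u = u}. cc B u) = C - B"
  proof (intro equalityI subsetI)
    fix w assume w: "w \<in> C - B"
    then have r: "rep B w \<in> cc B w" using C rep_in_cc by blast
    then have "cc B (rep B w) = cc B w" by (rule cc_eq)
    moreover from this have "rep B (rep B w) = rep B w" by (simp add: rep_def)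
    moreover have "rep B w \<in> C - B" using cc_inside[OF C w] r by blast
    ultimately show "w \<in> (\<Union>u\<in>{u \<in> C - B. rep B u = u}. cc B u)"
      using cc_refl[of w B] by blast
  qed (use cc_inside[OF C] in blast)
next
  fix u v assume uv: "u \<in> {u \<in> C - B. rep B u = u}" "v \<in> {u \<in> C - B. rep B u = u}" "u \<noteq> v"
  then have "cc B u \<noteq> cc B v" by (auto simp: rep_def)
  then show "cc B u \<inter> cc B v = {}" by (rule cc_disjoint)
qed

section \<open>Locality of the constraints\<close>

definition valid :: "sexp set \<Rightarrow> sexp set \<Rightarrow> bool" where
  "valid X \<Phi> \<longleftrightarrow>
     (\<forall>y\<in>\<Phi>. \<forall>z\<in>\<Phi>. item_loc y \<in> X \<and> item_loc y = item_loc z \<and> item_task y = item_task z \<longrightarrow> y = z) \<and>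
     (\<forall>z\<in>\<Phi>. item_loc z \<in> X \<longrightarrow> item_loc z = task_snk (item_task z) \<or> item_next z \<notin> X \<or>
       (\<exists>y\<in>\<Phi>. item_loc y = item_next z \<and> item_task y = item_task z \<and> item_idx y = right (item_idx z))) \<and>
     (\<forall>e\<in>set (in_edges x). edge_fst e \<in> X \<and> edge_snd e \<in> X \<longrightarrow>
       (\<Sum>z\<in>{z\<in>\<Phi>. uses e z}. val (task_dem (item_task z))) \<le> length (edge_cap e))"

lemma valid_unique: "valid X \<Phi> \<Longrightarrow> y \<in> \<Phi> \<Longrightarrow> z \<in> \<Phi> \<Longrightarrow> item_loc y \<in> X \<Longrightarrow> item_loc y = item_loc z \<Longrightarrow>
    item_task y = item_task z \<Longrightarrow> y = z"
  unfolding valid_def by blast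

lemma valid_next: "valid X \<Phi> \<Longrightarrow> z \<in> \<Phi> \<Longrightarrow> item_loc z \<in> X \<Longrightarrow> item_next z \<in> X \<Longrightarrow>
    item_loc z \<noteq> task_snk (item_task z) \<Longrightarrow>
    \<exists>y\<in>\<Phi>. item_loc y = item_next z \<and> item_task y = item_task z \<and> item_idx y = right (item_idx z)"
  unfolding valid_def by blast

lemma valid_cap: "valid X \<Phi> \<Longrightarrow> e \<in> set (in_edges x) \<Longrightarrow> edge_fst e \<in> X \<Longrightarrow> edge_snd e \<in> X \<Longrightarrow>
    (\<Sum>z\<in>{z\<in>\<Phi>. uses e z}. val (task_dem (item_task z))) \<le> length (edge_cap e)"
  unfolding valid_def by blast

lemma consistent_iff:
  assumes "distinct F" "\<And>z. z \<in> set F \<Longrightarrow> item_loc z \<in> set B"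
  shows "consistent x B F \<longleftrightarrow> valid (set B) (set F)"
proof -
  have "(\<Sum>d\<leftarrow>map (\<lambda>z. task_dem (item_task z)) (filter (uses e) F). val d) =
      (\<Sum>z\<in>{z\<in>set F. uses e z}. val (task_dem (item_task z)))" for e
    using assms(1) by (simp add: sum_list_distinct_conv_sum_set o_def)
  moreover have "val (binary (CONS NIL y)) = Suc (length (dec_list y))" for y
    by (simp add: val_binary)
  ultimately show ?thesis
    unfolding consistent_def valid_def using assms(2) by (auto simp: not_le less_Suc_eq_le)
qed

text \<open>The clauses of \<open>valid Y\<close> read only items located in \<open>Y\<close>: an
  item that uses an edge is located at one of its ends. Items elsewhere may be exchanged.\<close>

lemma valid_restrict:
  assumes "valid X \<Phi>" "Y \<subseteq> X" "{z\<in>\<Phi>. item_loc z \<in> Y} = {z\<in>\<Psi>. item_loc z \<in> Y}"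
  shows "valid Y \<Psi>"
proof -
  have eq: "z \<in> \<Psi> \<longleftrightarrow> z \<in> \<Phi>" if "item_loc z \<in> Y" for z
    using assms(3) that by blast
  have "{z\<in>\<Psi>. uses e z} = {z\<in>\<Phi>. uses e z}" if "edge_fst e \<in> Y" "edge_snd e \<in> Y" for e
    using that eq by (auto simp: uses_def)
  then have "(\<Sum>z\<in>{z\<in>\<Psi>. uses e z}. val (task_dem (item_task z))) \<le> length (edge_cap e)"
    if "e \<in> set (in_edges x)" "edge_fst e \<in> Y" "edge_snd e \<in> Y" for e
    using valid_cap[OF assms(1) that(1)] that assms(2) by auto
  moreover have "item_loc z = task_snk (item_task z) \<or> item_next z \<notin> Y \<or>
      (\<exists>y\<in>\<Psi>. item_loc y = item_next z \<and> item_task y = item_task z \<and> item_idx y = right (item_idx z))"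
    if "z \<in> \<Psi>" "item_loc z \<in> Y" for z
  proof (cases "item_loc z = task_snk (item_task z) \<or> item_next z \<notin> Y")
    case False
    then have "z \<in> \<Phi>" "item_loc z \<in> X" "item_next z \<in> X" using that eq assms(2) by blast+
    then obtain y where "y \<in> \<Phi>" "item_loc y = item_next z" "item_task y = item_task z" "item_idx y = right (item_idx z)"
      using assms(1) False unfolding valid_def by blast
    then show ?thesis using eq[of y] False by auto
  qed blast
  moreover have "y = z" if "y \<in> \<Psi>" "z \<in> \<Psi>" "item_loc y \<in> Y" "item_loc y = item_loc z" "item_task y = item_task z" for y z
  proof -
    have "y \<in> \<Phi>" "z \<in> \<Phi>" "item_loc y \<in> X" using that eq[of y] eq[of z] assms(2) by auto
    then show ?thesis using assms(1) that(4,5) unfolding valid_def by blast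
  qed
  ultimately show ?thesis unfolding valid_def by blast
qed

lemma items_adj: "z \<in> set (items x) \<Longrightarrow> item_loc z \<noteq> task_snk (item_task z) \<Longrightarrow> adj x (item_loc z) (item_next z)"
  unfolding items_def by auto

lemma items_loc: "z \<in> set (items x) \<Longrightarrow> item_loc z \<in> V"
  unfolding items_def by auto

text \<open>Each clause concerns one vertex or the two ends of an edge, because an item away from
  its sink points to a neighbour. So a cover of the vertices and edges of \<open>X\<close> is
  enough.\<close>

lemma valid_glue:
  assumes "\<Phi> \<subseteq> set (items x)" "\<And>u. u \<in> X \<Longrightarrow> \<exists>Y\<in>\<Y>. u \<in> Y"
    and pair: "\<And>u v. u \<in> X \<Longrightarrow> v \<in> X \<Longrightarrow> adj x u v \<Longrightarrow> \<exists>Y\<in>\<Y>. u \<in> Y \<and> v \<in> Y"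
    and Y: "\<And>Y. Y \<in> \<Y> \<Longrightarrow> valid Y \<Phi>"
  shows "valid X \<Phi>"
  unfolding valid_def
proof (intro conjI ballI impI)
  fix y z assume "y \<in> \<Phi>" "z \<in> \<Phi>" "item_loc y \<in> X \<and> item_loc y = item_loc z \<and> item_task y = item_task z"
  then show "y = z" using assms(2)[of "item_loc y"] Y valid_unique by metis
next
  fix z assume z: "z \<in> \<Phi>" "item_loc z \<in> X"
  show "item_loc z = task_snk (item_task z) \<or> item_next z \<notin> X \<or>
       (\<exists>y\<in>\<Phi>. item_loc y = item_next z \<and> item_task y = item_task z \<and> item_idx y = right (item_idx z))"
  proof (cases "item_loc z \<noteq> task_snk (item_task z) \<and> item_next z \<in> X")
    case True
    then have "adj x (item_loc z) (item_next z)" using items_adj z assms(1) by blast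
    then obtain Y where "Y \<in> \<Y>" "item_loc z \<in> Y" "item_next z \<in> Y"
      using pair z True by blast
    then show ?thesis using valid_next[OF Y z(1)] True by blast
  qed blast
next
  fix e assume e: "e \<in> set (in_edges x)" "edge_fst e \<in> X \<and> edge_snd e \<in> X"
  then have "adj x (edge_fst e) (edge_snd e)" unfolding adj_def by blast
  then obtain Y where "Y \<in> \<Y>" "edge_fst e \<in> Y" "edge_snd e \<in> Y"
    using pair e by blast
  then show "(\<Sum>z\<in>{z\<in>\<Phi>. uses e z}. val (task_dem (item_task z))) \<le> length (edge_cap e)"
    using valid_cap[OF Y e(1)] by blast
qed

section \<open>Partial solutions and table invariants\<close>

definition wt :: "sexp \<Rightarrow> nat" where
  "wt z = (if item_loc z = task_src (item_task z) then val (task_prf (item_task z)) else 0)"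

text \<open>A solution below a boundary: only those items of \<open>F\<close> matter that sit on
  neighbours of \<open>C\<close>, and for \<open>C = V\<close> there are none.\<close>

definition sol :: "sexp set \<Rightarrow> sexp set \<Rightarrow> sexp set \<Rightarrow> bool" where
  "sol C F \<Psi> \<longleftrightarrow> \<Psi> \<subseteq> set (items x) \<and> (\<forall>z\<in>\<Psi>. item_loc z \<in> C) \<and>
     valid (NB C \<union> C) ({z\<in>F. item_loc z \<in> NB C} \<union> \<Psi>)"

definition bw :: "sexp \<Rightarrow> nat" where
  "bw v = length (load x [v])"

lemma length_load: "distinct B \<Longrightarrow> length (load x B) = (\<Sum>v\<in>set B. bw v)"
  by (induction B) (auto simp: bw_def load_def)

text \<open>The property of routings that makes their restriction to a bag a word of bounded length.
  The algorithm does not test it; it is a hypothesis of completeness.\<close>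

definition thin :: "sexp set \<Rightarrow> bool" where
  "thin \<Phi> \<longleftrightarrow> (\<forall>u. card {z\<in>\<Phi>. item_loc z = u} \<le> bw u)"

lemma card_thin:
  assumes "thin \<Phi>" "finite \<Phi>" "finite B"
  shows "card {z\<in>\<Phi>. item_loc z \<in> B} \<le> (\<Sum>v\<in>B. bw v)"
proof -
  have "{z\<in>\<Phi>. item_loc z \<in> B} = (\<Union>v\<in>B. {z\<in>\<Phi>. item_loc z = v})" by blast
  then have "card {z\<in>\<Phi>. item_loc z \<in> B} \<le> (\<Sum>v\<in>B. card {z\<in>\<Phi>. item_loc z = v})"
    by (simp add: card_UN_le assms(3))
  also have "\<dots> \<le> (\<Sum>v\<in>B. bw v)"
    by (rule sum_mono) (use assms(1) in \<open>auto simp: thin_def\<close>)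
  finally show ?thesis .
qed

definition contains_words :: "sexp \<Rightarrow> sexp \<Rightarrow> bool" where
  "contains_words K U \<longleftrightarrow> (\<forall>l. set l \<subseteq> set (letters x) \<longrightarrow> length l \<le> length (dec_list K) \<longrightarrow> enc_list l \<in> set (dec_list U))"

text \<open>The recursion over bags without items: \<open>r\<close> bounds its depth,
  \<open>k\<close> the load of its bags. Every table entry implies it, and under it no thin solution
  is missed, which links the emptiness test of the loop to completeness.\<close>

fun solvable :: "nat \<Rightarrow> nat \<Rightarrow> sexp set \<Rightarrow> bool" where
  "solvable k 0 C = False"
| "solvable k (Suc r) C = (\<exists>B\<subseteq>V. NB C \<subseteq> B \<and> B \<subseteq> NB C \<union> C \<and> (\<Sum>v\<in>B. bw v) \<le> k \<and>
     (\<forall>u\<in>C - B. solvable k r (cc B u)))"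

definition entries_solvable :: "nat \<Rightarrow> nat \<Rightarrow> sexp list \<Rightarrow> bool" where
  "entries_solvable k r T \<longleftrightarrow> (\<forall>t\<in>set T. \<forall>B F u. left t = key B F u \<longrightarrow> solvable k r (cc (set B) u))"

definition sound :: "sexp list \<Rightarrow> bool" where
  "sound T \<longleftrightarrow> (\<forall>t\<in>set T. \<forall>B F u. left t = key B F u \<longrightarrow>
     (\<exists>\<Psi>. sol (cc (set B) u) (set F) \<Psi> \<and> val (right t) \<le> sum wt \<Psi>))"

text \<open>Stated for every entry with the key, because the table may hold several and
  \<open>lookup\<close> takes the first. Values are compared after truncation, the only form in
  which they are stored.\<close>

definition complete :: "nat \<Rightarrow> nat \<Rightarrow> sexp \<Rightarrow> sexp list \<Rightarrow> bool" where
  "complete k r U T \<longleftrightarrow> (\<forall>B F u \<Psi>. enc_list B \<in> set (dec_list U) \<longrightarrow> enc_list F \<in> set (dec_list U) \<longrightarrow>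
     set F \<subseteq> set (items x) \<longrightarrow> u \<in> V - set B \<longrightarrow> solvable k r (cc (set B) u) \<longrightarrow> sol (cc (set B) u) (set F) \<Psi> \<longrightarrow>
     thin ({z\<in>set F. item_loc z \<in> NB (cc (set B) u)} \<union> \<Psi>) \<longrightarrow>
     (\<exists>t\<in>set T. left t = key B F u) \<and>
     (\<forall>t\<in>set T. left t = key B F u \<longrightarrow> min (val (in_target x)) (sum wt \<Psi>) \<le> val (right t)))"

lemma mem_concat_map: "y \<in> set (concat (map f ys)) \<longleftrightarrow> (\<exists>z\<in>set ys. y \<in> set (f z))"
  by simp

lemma mem_if: "y \<in> set (if P then [z] else []) \<longleftrightarrow> P \<and> y = z" "y \<in> set (if P then [] else ys) \<longleftrightarrow> \<not> P \<and> y \<in> set ys"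
  by auto

lemma mem_candidates: "c \<in> set (candidates x K U T C N F) \<longleftrightarrow> (\<exists>b\<in>set (dec_list U). \<exists>g\<in>set (dec_list U).
    admissible x K C N F (dec_list b) (dec_list g) \<and>
    (\<forall>u\<in>set (reps x C (dec_list b)). \<exists>t\<in>set T. left t = key (dec_list b) (dec_list g) u) \<and>
    c = bag_value x T C (dec_list b) (dec_list g))"
  unfolding candidates_def mem_concat_map mem_if by (simp only: conj_assoc)

lemma candidatesE:
  assumes "c \<in> set (candidates x K U T C N F)"
  obtains B G where "enc_list B \<in> set (dec_list U)" "enc_list G \<in> set (dec_list U)"
    "admissible x K C N F B G" "\<forall>u\<in>set (reps x C B). \<exists>t\<in>set T. left t = key B G u"
    "c = bag_value x T C B G"
proof -
  from assms obtain b g where "b \<in> set (dec_list U)" "g \<in> set (dec_list U)"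
    "admissible x K C N F (dec_list b) (dec_list g)"
    "\<forall>u\<in>set (reps x C (dec_list b)). \<exists>t\<in>set T. left t = key (dec_list b) (dec_list g) u"
    "c = bag_value x T C (dec_list b) (dec_list g)"
    unfolding mem_candidates by (elim bexE conjE)
  then show ?thesis by (intro that[of "dec_list b" "dec_list g"]) auto
qed

lemma candidatesI:
  assumes "enc_list B \<in> set (dec_list U)" "enc_list G \<in> set (dec_list U)"
    "admissible x K C N F B G" "\<And>u. u \<in> set (reps x C B) \<Longrightarrow> \<exists>t\<in>set T. left t = key B G u"
  shows "bag_value x T C B G \<in> set (candidates x K U T C N F)"
  unfolding mem_candidates
  by (rule bexI[OF _ assms(1)], rule bexI[OF _ assms(2)]) (use assms(3,4) in simp)

lemma lookup_mem: "\<exists>t\<in>set T. left t = k \<Longrightarrow> \<exists>t\<in>set T. left t = k \<and> lookup T k = right t"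
proof -
  assume "\<exists>t\<in>set T. left t = k"
  then have ne: "filter (\<lambda>t. left t = k) T \<noteq> []" by (auto simp: filter_empty_conv)
  then have "hd (filter (\<lambda>t. left t = k) T) \<in> set (filter (\<lambda>t. left t = k) T)" by (rule hd_in_set)
  then show ?thesis using ne by (auto simp: lookup_def left_enc_list)
qed

lemma val_bag_value:
  assumes "distinct G"
  shows "val (bag_value x T C B G) = min (val (in_target x))
    (sum wt {z\<in>set G. item_loc z \<in> set C} + (\<Sum>u\<in>set (reps x C B). val (lookup T (key B G u))))"
proof -
  have "(\<Sum>z\<leftarrow>filter (\<lambda>z. item_loc z \<in> set C \<and> item_loc z = task_src (item_task z)) G. val (task_prf (item_task z))) =
    (\<Sum>z\<in>{z\<in>set G. item_loc z \<in> set C \<and> item_loc z = task_src (item_task z)}. val (task_prf (item_task z)))"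
    using assms by (simp add: sum_list_distinct_conv_sum_set)
  also have "\<dots> = sum wt {z\<in>set G. item_loc z \<in> set C}"
    by (rule sum.mono_neutral_cong_left) (auto simp: wt_def)
  finally show ?thesis
    using distinct_verts
    by (simp add: bag_value_def val_csum o_def sum_list_distinct_conv_sum_set reps_def)
qed

lemma admissible_facts:
  assumes "admissible x K C N F B G" "set N = NB (set C)"
  shows "set B \<subseteq> V" "distinct B" "(\<Sum>v\<in>set B. bw v) \<le> length (dec_list K)" "NB (set C) \<subseteq> set B"
    "set B \<subseteq> NB (set C) \<union> set C" "set G \<subseteq> set (items x)" "distinct G"
    "\<And>z. z \<in> set G \<Longrightarrow> item_loc z \<in> set B" "valid (set B) (set G)"
    "{z\<in>set F. item_loc z \<in> NB (set C)} = {z\<in>set G. item_loc z \<in> NB (set C)}"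
proof -
  note a = assms(1)[unfolded admissible_def]
  have B: "B = filter (\<lambda>v. v \<in> set B) (in_verts x)" and G: "G = filter (\<lambda>z. z \<in> set G) (items x)"
    using a by blast+
  show "distinct B" by (subst B) (simp add: distinct_verts)
  then show "(\<Sum>v\<in>set B. bw v) \<le> length (dec_list K)" using a length_load by simp
  show "distinct G" by (subst G) (simp add: distinct_items)
  then show "valid (set B) (set G)" using a consistent_iff by blast
  show "set B \<subseteq> V" by (subst B) auto
  show "set G \<subseteq> set (items x)" by (subst G) auto
  show "NB (set C) \<subseteq> set B" "set B \<subseteq> NB (set C) \<union> set C"
    "{z\<in>set F. item_loc z \<in> NB (set C)} = {z\<in>set G. item_loc z \<in> NB (set C)}"
    "\<And>z. z \<in> set G \<Longrightarrow> item_loc z \<in> set B"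
    using a assms(2) by blast+
qed

text \<open>The bag of the candidate is the witness. Entries are known for representatives only, but
  each vertex of \<open>C - B\<close> has the same component as some representative.\<close>

lemma candidates_solvable:
  assumes "entries_solvable (length (dec_list K)) r T" "set C \<subseteq> V" "set N = NB (set C)"
    and "c \<in> set (candidates x K U T C N F)"
  shows "solvable (length (dec_list K)) (Suc r) (set C)"
proof -
  from assms(4) obtain B G where a: "admissible x K C N F B G"
    and t: "\<forall>u\<in>set (reps x C B). \<exists>t\<in>set T. left t = key B G u" by (rule candidatesE) blast
  note f = admissible_facts[OF a assms(3)]
  have "solvable (length (dec_list K)) r (cc (set B) u)" if u: "u \<in> set C - set B" for u
  proof -
    obtain w where "w \<in> {u \<in> set C - set B. rep (set B) u = u}" "u \<in> cc (set B) w"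
      using reps_partition(1)[OF assms(2) f(4)] u by blast
    then have "w \<in> set (reps x C B)" "cc (set B) u = cc (set B) w"
      using set_reps[OF assms(2) refl] cc_eq by auto
    then show ?thesis using t assms(1) unfolding entries_solvable_def by metis
  qed
  then show ?thesis using f(1,3,4,5) by auto
qed

lemma sum_wt_Un:
  assumes "finite I" "\<And>i. i \<in> I \<Longrightarrow> \<Psi> i \<subseteq> {z\<in>set (items x). item_loc z \<in> D i}"
    and "\<And>i j. i \<in> I \<Longrightarrow> j \<in> I \<Longrightarrow> i \<noteq> j \<Longrightarrow> D i \<inter> D j = {}"
    and "A \<subseteq> set (items x)" "\<And>z i. z \<in> A \<Longrightarrow> i \<in> I \<Longrightarrow> item_loc z \<notin> D i"
  shows "sum wt (A \<union> (\<Union>i\<in>I. \<Psi> i)) = sum wt A + (\<Sum>i\<in>I. sum wt (\<Psi> i))"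
proof -
  have fin: "finite (\<Psi> i)" if "i \<in> I" for i
    by (rule finite_subset[OF assms(2)[OF that]]) simp
  have "sum wt (A \<union> (\<Union>i\<in>I. \<Psi> i)) = sum wt A + sum wt (\<Union>i\<in>I. \<Psi> i)"
  proof (rule sum.union_disjoint)
    show "finite A" by (rule finite_subset[OF assms(4)]) simp
    show "finite (\<Union>i\<in>I. \<Psi> i)" using assms(1) fin by blast
    show "A \<inter> (\<Union>i\<in>I. \<Psi> i) = {}" using assms(2,5) by blast
  qed
  also have "sum wt (\<Union>i\<in>I. \<Psi> i) = (\<Sum>i\<in>I. sum wt (\<Psi> i))"
  proof (rule sum.UNION_disjoint)
    show "\<forall>i\<in>I. \<forall>j\<in>I. i \<noteq> j \<longrightarrow> \<Psi> i \<inter> \<Psi> j = {}"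
      using assms(2,3) by blast
  qed (use assms(1) fin in blast)+
  finally show ?thesis .
qed

text \<open>The items on the bag are glued with one solution per component. The bag and the closed
  neighbourhoods of the components cover all edges, since an edge with an end outside
  \<open>B\<close> stays in the closed neighbourhood of the component of that end.\<close>

lemma candidates_sound:
  assumes T: "sound T" and C: "set C \<subseteq> V" and N: "set N = NB (set C)"
    and c: "c \<in> set (candidates x K U T C N F)"
  shows "\<exists>\<Psi>. sol (set C) (set F) \<Psi> \<and> val c \<le> sum wt \<Psi>"
proof -
  from c obtain B G where a: "admissible x K C N F B G"
    and t: "\<forall>u\<in>set (reps x C B). \<exists>t\<in>set T. left t = key B G u"
    and c: "c = bag_value x T C B G" by (rule candidatesE) blast
  note f = admissible_facts[OF a N]
  let ?R = "set (reps x C B)"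
  have R: "?R = {u \<in> set C - set B. rep (set B) u = u}" by (rule set_reps[OF C refl])
  note part = reps_partition[OF C f(4), folded R]
  have "\<exists>\<Psi>. sol (cc (set B) u) (set G) \<Psi> \<and> val (lookup T (key B G u)) \<le> sum wt \<Psi>" if u: "u \<in> ?R" for u
  proof -
    obtain y where "y \<in> set T" "left y = key B G u" "lookup T (key B G u) = right y"
      using lookup_mem[OF bspec[OF t u]] by blast
    then show ?thesis using T unfolding sound_def by metis
  qed
  then obtain \<psi> where \<psi>: "\<And>u. u \<in> ?R \<Longrightarrow> sol (cc (set B) u) (set G) (\<psi> u) \<and> val (lookup T (key B G u)) \<le> sum wt (\<psi> u)"
    by metis
  let ?A = "{z\<in>set G. item_loc z \<in> set C}"
  let ?\<Psi> = "?A \<union> (\<Union>u\<in>?R. \<psi> u)"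
  have inside: "cc (set B) u \<subseteq> set C - set B" if "u \<in> ?R" for u
    using part(1) that by blast
  have NBcc: "NB (cc (set B) u) \<subseteq> set B" if "u \<in> ?R" for u
    using NB_cc[of u "set B"] that C R by blast
  have \<psi>': "\<psi> u \<subseteq> {z\<in>set (items x). item_loc z \<in> cc (set B) u}" if "u \<in> ?R" for u
    using \<psi>[OF that] unfolding sol_def by blast
  have "sum wt ?\<Psi> = sum wt ?A + (\<Sum>u\<in>?R. sum wt (\<psi> u))"
  proof (rule sum_wt_Un[where D = "cc (set B)"])
    show "item_loc z \<notin> cc (set B) u" if "z \<in> ?A" "u \<in> ?R" for z u
      using that f(8)[of z] inside[of u] by blast
  qed (use \<psi>' part(2) f(6) in auto)
  moreover have "(\<Sum>u\<in>?R. val (lookup T (key B G u))) \<le> (\<Sum>u\<in>?R. sum wt (\<psi> u))"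
    by (rule sum_mono) (use \<psi> in blast)
  ultimately have "val c \<le> sum wt ?\<Psi>"
    unfolding c val_bag_value[OF f(7)] by simp
  moreover have "sol (set C) (set F) ?\<Psi>"
    unfolding sol_def
  proof (intro conjI ballI)
    show "?\<Psi> \<subseteq> set (items x)" using f(6) \<psi>' by blast
    show "item_loc z \<in> set C" if "z \<in> ?\<Psi>" for z using that \<psi>' inside by blast
    let ?\<Phi> = "{z\<in>set F. item_loc z \<in> NB (set C)} \<union> ?\<Psi>"
    have \<Phi>: "?\<Phi> = set G \<union> (\<Union>u\<in>?R. \<psi> u)"
      using f(5,8,10) by blast
    let ?D = "\<lambda>u. NB (cc (set B) u) \<union> cc (set B) u"
    have covered: "\<exists>u\<in>?R. v \<in> cc (set B) u" if "v \<in> NB (set C) \<union> set C" "v \<notin> set B" for v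
    proof -
      have "v \<in> set C - set B" using that f(4) by blast
      then show ?thesis using part(1) by blast
    qed
    have nb: "w \<in> ?D u" if "u \<in> ?R" "v \<in> cc (set B) u" "adj x v w" for u v w
      using that(2,3) adj_verts[OF that(3)] adj_sym unfolding NB_def by blast
    show "valid (NB (set C) \<union> set C) ?\<Phi>"
    proof (rule valid_glue[where \<Y> = "insert (set B) (?D ` ?R)"])
      show "?\<Phi> \<subseteq> set (items x)" unfolding \<Phi> using f(6) \<psi>' by blast
      show "\<exists>Y\<in>insert (set B) (?D ` ?R). v \<in> Y" if "v \<in> NB (set C) \<union> set C" for v
      proof (cases "v \<in> set B")
        case False
        then show ?thesis using covered[OF that] by auto
      qed auto
      show "\<exists>Y\<in>insert (set B) (?D ` ?R). v \<in> Y \<and> w \<in> Y"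
        if v: "v \<in> NB (set C) \<union> set C" and w: "w \<in> NB (set C) \<union> set C" and vw: "adj x v w" for v w
      proof -
        consider "v \<in> set B" "w \<in> set B" | "v \<notin> set B" | "w \<notin> set B" by blast
        then show ?thesis
        proof cases
          case 2
          then obtain u where "u \<in> ?R" "v \<in> cc (set B) u" using covered v by blast
          then show ?thesis using nb[OF _ _ vw] by auto
        next
          case 3
          then obtain u where "u \<in> ?R" "w \<in> cc (set B) u" using covered w by blast
          then show ?thesis using nb[OF _ _ adj_sym[OF vw]] by auto
        qed auto
      qed
      fix Y assume "Y \<in> insert (set B) (?D ` ?R)"
      then consider "Y = set B" | u where "u \<in> ?R" "Y = ?D u" by auto
      then show "valid Y ?\<Phi>"
      proof cases
        case 1
        have "z \<notin> \<psi> u" if "item_loc z \<in> set B" "u \<in> ?R" for z u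
          using \<psi>'[OF that(2)] inside[OF that(2)] that(1) by blast
        then have "{z\<in>set G. item_loc z \<in> set B} = {z\<in>?\<Phi>. item_loc z \<in> set B}"
          unfolding \<Phi> by auto
        then show ?thesis using valid_restrict[OF f(9)] 1 by blast
      next
        case 2
        have v: "valid Y ({z\<in>set G. item_loc z \<in> NB (cc (set B) u)} \<union> \<psi> u)"
          using \<psi>[OF 2(1)] 2(2) unfolding sol_def by blast
        \<comment> \<open>Items of one component are invisible in the closed neighbourhood of
          another, which adds only vertices of \<open>B\<close> to a disjoint component.\<close>
        have "z \<in> \<psi> u" if "z \<in> \<psi> w" "w \<in> ?R" "item_loc z \<in> ?D u" for z w
        proof -
          have z: "item_loc z \<in> cc (set B) w" using \<psi>'[OF that(2)] that(1) by blast
          then have "item_loc z \<notin> set B" using inside[OF that(2)] by blast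
          then have "item_loc z \<in> cc (set B) u" using that(3) NBcc[OF 2(1)] by blast
          then have "u = w" using part(2)[OF 2(1) that(2)] z by blast
          then show ?thesis using that(1) by simp
        qed
        moreover have "item_loc z \<in> NB (cc (set B) u)" if "z \<in> set G" "item_loc z \<in> ?D u" for z
          using that f(8)[OF that(1)] inside[OF 2(1)] by blast
        ultimately have "z \<in> {z\<in>set G. item_loc z \<in> NB (cc (set B) u)} \<union> \<psi> u \<longleftrightarrow> z \<in> ?\<Phi>" if "item_loc z \<in> Y" for z
          using that 2 unfolding \<Phi> 2(2) by blast
        then have "{z\<in>{z\<in>set G. item_loc z \<in> NB (cc (set B) u)} \<union> \<psi> u. item_loc z \<in> Y} = {z\<in>?\<Phi>. item_loc z \<in> Y}"
          by blast
        then show ?thesis using valid_restrict[OF v] by blast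
      qed
    qed
  qed
  ultimately show ?thesis by blast
qed

text \<open>The bag comes from \<open>solvable\<close>, the items on it from the given solution,
  which is cut into its parts on the components. Thinness and the load bound make both lists words
  of length at most \<open>K\<close>, so \<open>U\<close> offers them.\<close>

lemma candidates_complete:
  assumes T: "complete (length (dec_list K)) r U T" and C: "set C \<subseteq> V" and N: "set N = NB (set C)"
    and solvable: "solvable (length (dec_list K)) (Suc r) (set C)"
    and sol: "sol (set C) (set F) \<Psi>" and thin: "thin ({z\<in>set F. item_loc z \<in> NB (set C)} \<union> \<Psi>)"
    and F: "{z\<in>set F. item_loc z \<in> NB (set C)} \<subseteq> set (items x)"
    and U: "contains_words K U"
  shows "\<exists>c\<in>set (candidates x K U T C N F). min (val (in_target x)) (sum wt \<Psi>) \<le> val c"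
proof -
  let ?\<Phi> = "{z\<in>set F. item_loc z \<in> NB (set C)} \<union> \<Psi>"
  have \<Psi>: "\<Psi> \<subseteq> set (items x)" "\<And>z. z \<in> \<Psi> \<Longrightarrow> item_loc z \<in> set C" and valid: "valid (NB (set C) \<union> set C) ?\<Phi>"
    using sol unfolding sol_def by blast+
  have \<Phi>i: "?\<Phi> \<subseteq> set (items x)" using \<Psi>(1) F by blast
  have fin: "finite ?\<Phi>" using \<Psi>(1) by (auto intro: finite_subset)
  obtain B' where B': "B' \<subseteq> V" "NB (set C) \<subseteq> B'" "B' \<subseteq> NB (set C) \<union> set C"
    "(\<Sum>v\<in>B'. bw v) \<le> length (dec_list K)" "\<forall>u\<in>set C - B'. solvable (length (dec_list K)) r (cc B' u)"
    using solvable unfolding solvable.simps by (elim exE conjE) (rule that)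
  define B where "B = filter (\<lambda>v. v \<in> B') (in_verts x)"
  define G where "G = filter (\<lambda>z. z \<in> ?\<Phi> \<and> item_loc z \<in> B') (items x)"
  have setB: "set B = B'" using B'(1) by (auto simp: B_def)
  have distB: "distinct B" by (simp add: B_def distinct_verts)
  have setG: "set G = {z\<in>?\<Phi>. item_loc z \<in> B'}" using \<Psi>(1) F by (auto simp: G_def)
  have distG: "distinct G" by (simp add: G_def distinct_items)
  have NBdisj: "NB (set C) \<inter> set C = {}" by (auto simp: NB_def)
  have valB: "valid B' (set G)"
    by (rule valid_restrict[OF valid B'(3)]) (auto simp: setG)
  have adm: "admissible x K C N F B G"
    unfolding admissible_def
  proof (intro conjI ballI impI)
    show "B = filter (\<lambda>v. v \<in> set B) (in_verts x)"
      unfolding setB by (simp add: B_def)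
    show "length (load x B) \<le> length (dec_list K)"
      using B'(4) by (simp add: length_load[OF distB] setB)
    show "G = filter (\<lambda>z. z \<in> set G) (items x)"
      unfolding setG by (simp add: G_def)
    show "consistent x B G"
      using consistent_iff[OF distG, of B] valB setB setG by auto
    show "u \<in> set B" if "u \<in> set N" for u using that N B'(2) setB by blast
    show "u \<in> set N \<or> u \<in> set C" if "u \<in> set B" for u using that N B'(3) setB by blast
    show "item_loc z \<in> set B" if "z \<in> set G" for z using that setG setB by simp
    show "z \<in> set G" if "z \<in> set F" "item_loc z \<in> set N" for z
      using that B'(2) unfolding N setG by blast
    show "z \<in> set F" if "z \<in> set G" "item_loc z \<in> set N" for z
      using that \<Psi>(2)[of z] NBdisj unfolding N setG by blast
  qed
  \<comment> \<open>Each vertex has weight at least 1, so the load also bounds the number of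
    vertices in the bag.\<close>
  have bwpos: "1 \<le> bw v" for v by (simp add: bw_def load_def)
  have lenB: "length B \<le> length (dec_list K)"
  proof -
    have "length B = (\<Sum>v\<in>B'. 1)" using distB setB by (simp add: distinct_card[symmetric])
    also have "\<dots> \<le> (\<Sum>v\<in>B'. bw v)" by (rule sum_mono) (rule bwpos)
    finally show ?thesis using B'(4) by simp
  qed
  have lenG: "length G \<le> length (dec_list K)"
  proof -
    have "length G = card {z\<in>?\<Phi>. item_loc z \<in> B'}"
      using distinct_card[OF distG] setG by simp
    also have "\<dots> \<le> (\<Sum>v\<in>B'. bw v)"
      by (rule card_thin[OF thin fin]) (use setB in \<open>metis List.finite_set\<close>)
    finally show ?thesis using B'(4) by simp
  qed
  have word: "enc_list l \<in> set (dec_list U)" if "set l \<subseteq> set (letters x)" "length l \<le> length (dec_list K)" for l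
    using U that unfolding contains_words_def by blast
  have BU: "enc_list B \<in> set (dec_list U)"
    by (rule word[OF _ lenB]) (auto simp: letters_def B_def)
  have GU: "enc_list G \<in> set (dec_list U)"
    by (rule word[OF _ lenG]) (auto simp: letters_def G_def)
  let ?R = "set (reps x C B)"
  have R: "?R = {u \<in> set C - B'. rep B' u = u}" using set_reps[OF C refl] setB by metis
  note part = reps_partition[OF C B'(2), folded R]
  have inside: "cc B' u \<subseteq> set C - B'" if "u \<in> ?R" for u using part(1) that by blast
  have NBcc: "NB (cc B' u) \<subseteq> B'" if "u \<in> ?R" for u using NB_cc[of u B'] that C R by blast
  let ?\<psi> = "\<lambda>u. {z\<in>\<Psi>. item_loc z \<in> cc B' u}"
  have sub: "(\<exists>t\<in>set T. left t = key B G u) \<and>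
      (\<forall>t\<in>set T. left t = key B G u \<longrightarrow> min (val (in_target x)) (sum wt (?\<psi> u)) \<le> val (right t))"
    if u: "u \<in> ?R" for u
  proof -
    have \<Phi>u: "{z\<in>set G. item_loc z \<in> NB (cc B' u)} \<union> ?\<psi> u \<subseteq> ?\<Phi>" using setG by blast
    have "sol (cc B' u) (set G) (?\<psi> u)"
      unfolding sol_def
    proof (intro conjI ballI)
      show "valid (NB (cc B' u) \<union> cc B' u) ({z\<in>set G. item_loc z \<in> NB (cc B' u)} \<union> ?\<psi> u)"
      proof (rule valid_restrict[OF valid])
        show "NB (cc B' u) \<union> cc B' u \<subseteq> NB (set C) \<union> set C"
          using NBcc[OF u] inside[OF u] B'(3) by blast
        show "{z\<in>?\<Phi>. item_loc z \<in> NB (cc B' u) \<union> cc B' u} =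
          {z\<in>{z\<in>set G. item_loc z \<in> NB (cc B' u)} \<union> ?\<psi> u. item_loc z \<in> NB (cc B' u) \<union> cc B' u}"
          unfolding setG using NBcc[OF u] inside[OF u] NBdisj by blast
      qed
    qed (use \<Psi> in auto)
    moreover have "thin ({z\<in>set G. item_loc z \<in> NB (cc B' u)} \<union> ?\<psi> u)"
      unfolding thin_def
    proof
      fix v
      have "card {z\<in>{z\<in>set G. item_loc z \<in> NB (cc B' u)} \<union> ?\<psi> u. item_loc z = v} \<le> card {z\<in>?\<Phi>. item_loc z = v}"
        by (rule card_mono) (use fin \<Phi>u in auto)
      also have "\<dots> \<le> bw v" using thin unfolding thin_def by blast
      finally show "card {z\<in>{z\<in>set G. item_loc z \<in> NB (cc B' u)} \<union> ?\<psi> u. item_loc z = v} \<le> bw v" .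
    qed
    moreover have "u \<in> V - B'" "solvable (length (dec_list K)) r (cc B' u)" using u R C B'(5) by blast+
    ultimately show ?thesis
      using T[unfolded complete_def, rule_format, OF BU GU, of u "?\<psi> u"] setG \<Phi>i unfolding setB by blast
  qed
  have "bag_value x T C B G \<in> set (candidates x K U T C N F)"
    by (rule candidatesI[OF BU GU adm]) (use sub in blast)
  moreover have "min (val (in_target x)) (sum wt \<Psi>) \<le> val (bag_value x T C B G)"
  proof -
    let ?A = "{z\<in>\<Psi>. item_loc z \<in> B'}"
    have "\<Psi> = ?A \<union> (\<Union>u\<in>?R. ?\<psi> u)" using part(1) \<Psi>(2) by blast
    then have "sum wt \<Psi> = sum wt (?A \<union> (\<Union>u\<in>?R. ?\<psi> u))" by simp
    also have "\<dots> = sum wt ?A + (\<Sum>u\<in>?R. sum wt (?\<psi> u))"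
    proof (rule sum_wt_Un[where D = "cc B'"])
      show "item_loc z \<notin> cc B' u" if "z \<in> ?A" "u \<in> ?R" for z u
        using that inside[of u] by blast
    qed (use \<Psi>(1) part(2) in auto)
    also have "?A = {z\<in>set G. item_loc z \<in> set C}" unfolding setG using \<Psi>(2) NBdisj by blast
    finally have wt: "sum wt \<Psi> = sum wt {z\<in>set G. item_loc z \<in> set C} + (\<Sum>u\<in>?R. sum wt (?\<psi> u))" .
    let ?t = "val (in_target x)"
    \<comment> \<open>Table values dominate the true ones only up to truncation, so truncation has
      to be carried through the sum, by induction over subsets of \<open>?R\<close>.\<close>
    have "min ?t (\<Sum>u\<in>I. sum wt (?\<psi> u)) \<le> (\<Sum>u\<in>I. val (lookup T (key B G u)))" if "I \<subseteq> ?R" for I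
    proof -
      have "finite I" using that finite_subset by blast
      then show ?thesis using that
      proof (induction I)
        case (insert u I)
        obtain y where "y \<in> set T" "left y = key B G u" "lookup T (key B G u) = right y"
          using lookup_mem sub[of u] insert.prems by blast
        then have "min ?t (sum wt (?\<psi> u)) \<le> val (lookup T (key B G u))"
          using sub[of u] insert.prems by auto
        then show ?case using insert by simp
      qed simp
    qed
    from this[of ?R] show ?thesis
      unfolding val_bag_value[OF distG] wt by simp
  qed
  ultimately show ?thesis by blast
qed

lemma mem_table_step: "t \<in> set (table_step x K U T) \<longleftrightarrow> (\<exists>b\<in>set (dec_list U). \<exists>f\<in>set (dec_list U). \<exists>v\<in>V - set (dec_list b).
    t \<in> set (entry (key (dec_list b) (dec_list f) v) (candidates x K U T (component x (dec_list b) v)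
         (neighbours x (dec_list b) (component x (dec_list b) v)) (dec_list f))))"
  unfolding table_step_def mem_concat_map mem_if by blast

lemma table_stepE:
  assumes "t \<in> set (table_step x K U T)"
  obtains B F v where "enc_list B \<in> set (dec_list U)" "enc_list F \<in> set (dec_list U)" "v \<in> V - set B"
    "left t = key B F v" "right t \<in> set (candidates x K U T (component x B v) (neighbours x B (component x B v)) F)"
    "\<forall>c\<in>set (candidates x K U T (component x B v) (neighbours x B (component x B v)) F). val c \<le> val (right t)"
proof -
  from assms obtain b f v where bfv: "b \<in> set (dec_list U)" "f \<in> set (dec_list U)" "v \<in> V - set (dec_list b)"
    "t \<in> set (entry (key (dec_list b) (dec_list f) v)
       (candidates x K U T (component x (dec_list b) v)
         (neighbours x (dec_list b) (component x (dec_list b) v)) (dec_list f)))"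
    unfolding mem_table_step by (elim bexE)
  then show ?thesis
    by (intro that[of "dec_list b" "dec_list f" v])
      (auto simp: entry_def smax_mem smax_ge split: if_splits)
qed

lemma table_stepI:
  assumes "enc_list B \<in> set (dec_list U)" "enc_list F \<in> set (dec_list U)" "v \<in> V - set B"
    "c \<in> set (candidates x K U T (component x B v) (neighbours x B (component x B v)) F)"
  shows "\<exists>t\<in>set (table_step x K U T). left t = key B F v"
proof
  let ?c = "candidates x K U T (component x B v) (neighbours x B (component x B v)) F"
  show "CONS (key B F v) (smax ?c) \<in> set (table_step x K U T)"
    unfolding mem_table_step
  proof (rule bexI[OF _ assms(1)], rule bexI[OF _ assms(2)], rule bexI[of _ v])
    show "CONS (key B F v) (smax ?c) \<in> set (entry (key (dec_list (enc_list B)) (dec_list (enc_list F)) v)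
      (candidates x K U T (component x (dec_list (enc_list B)) v)
        (neighbours x (dec_list (enc_list B)) (component x (dec_list (enc_list B)) v)) (dec_list (enc_list F))))"
      using assms(4) unfolding dec_enc entry_def by auto
  qed (use assms(3) in simp)
qed simp

lemma key_inject [simp]: "key B F u = key B' F' u' \<longleftrightarrow> B = B' \<and> F = F' \<and> u = u'"
  by (auto simp: key_def)

lemma set_neighbours:
  assumes "v \<in> V - set B"
  shows "set (neighbours x B (component x B v)) = NB (cc (set B) v)"
proof -
  have "set (neighbours x B (component x B v)) = {u\<in>set B. \<exists>w\<in>cc (set B) v. adj x u w}"
    by (simp add: neighbours_def set_component[OF assms])
  also have "\<dots> = NB (cc (set B) v)"
    using NB_cc[OF assms] cc_subset[OF assms] adj_verts unfolding NB_def by blast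
  finally show ?thesis .
qed

lemma entries_solvable_step:
  assumes "entries_solvable (length (dec_list K)) r T"
  shows "entries_solvable (length (dec_list K)) (Suc r) (table_step x K U T)"
  unfolding entries_solvable_def
proof (intro ballI allI impI)
  fix t B F u assume t: "t \<in> set (table_step x K U T)" "left t = key B F u"
  from t(1) obtain B' F' v where v: "v \<in> V - set B'" "left t = key B' F' v"
    and c: "right t \<in> set (candidates x K U T (component x B' v) (neighbours x B' (component x B' v)) F')"
    by (rule table_stepE) blast
  note s = set_component[OF v(1)]
  have "solvable (length (dec_list K)) (Suc r) (set (component x B' v))"
    by (rule candidates_solvable[OF assms _ _ c])
      (use cc_subset[OF v(1)] s set_neighbours[OF v(1)] in auto)
  then show "solvable (length (dec_list K)) (Suc r) (cc (set B) u)"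
    using t(2) v(2) s by simp
qed

lemma sound_step:
  assumes "sound T"
  shows "sound (table_step x K U T)"
  unfolding sound_def
proof (intro ballI allI impI)
  fix t B F u assume t: "t \<in> set (table_step x K U T)" "left t = key B F u"
  from t(1) obtain B' F' v where v: "v \<in> V - set B'" "left t = key B' F' v"
    and c: "right t \<in> set (candidates x K U T (component x B' v) (neighbours x B' (component x B' v)) F')"
    by (rule table_stepE) blast
  note s = set_component[OF v(1)]
  have "\<exists>\<Psi>. sol (set (component x B' v)) (set F') \<Psi> \<and> val (right t) \<le> sum wt \<Psi>"
    by (rule candidates_sound[OF assms _ _ c])
      (use cc_subset[OF v(1)] s set_neighbours[OF v(1)] in auto)
  then show "\<exists>\<Psi>. sol (cc (set B) u) (set F) \<Psi> \<and> val (right t) \<le> sum wt \<Psi>"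
    using t(2) v(2) s by simp
qed

lemma complete_step:
  assumes T: "complete (length (dec_list K)) r U T"
    and U: "contains_words K U"
  shows "complete (length (dec_list K)) (Suc r) U (table_step x K U T)"
  unfolding complete_def
proof (intro allI impI)
  fix B F u \<Psi>
  assume BF: "enc_list B \<in> set (dec_list U)" "enc_list F \<in> set (dec_list U)" "set F \<subseteq> set (items x)" and u: "u \<in> V - set B"
    and solv: "solvable (length (dec_list K)) (Suc r) (cc (set B) u)"
    and sol: "sol (cc (set B) u) (set F) \<Psi>" "thin ({z\<in>set F. item_loc z \<in> NB (cc (set B) u)} \<union> \<Psi>)"
  note s = set_component[OF u]
  have "\<exists>c\<in>set (candidates x K U T (component x B u) (neighbours x B (component x B u)) F). min (val (in_target x)) (sum wt \<Psi>) \<le> val c"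
    by (rule candidates_complete[OF T]) (use cc_subset[OF u] s set_neighbours[OF u] solv sol U BF(3) in auto)
  then obtain c where c: "c \<in> set (candidates x K U T (component x B u) (neighbours x B (component x B u)) F)"
    "min (val (in_target x)) (sum wt \<Psi>) \<le> val c" by blast
  have "min (val (in_target x)) (sum wt \<Psi>) \<le> val (right t)"
    if "t \<in> set (table_step x K U T)" "left t = key B F u" for t
  proof -
    from that(1) obtain B' F' v where "left t = key B' F' v"
      and "\<forall>c\<in>set (candidates x K U T (component x B' v) (neighbours x B' (component x B' v)) F'). val c \<le> val (right t)"
      by (rule table_stepE) blast
    then have "val c \<le> val (right t)" using c(1) that(2) by simp
    then show ?thesis using c(2) by simp
  qed
  then show "(\<exists>t\<in>set (table_step x K U T). left t = key B F u) \<and>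
     (\<forall>t\<in>set (table_step x K U T). left t = key B F u \<longrightarrow> min (val (in_target x)) (sum wt \<Psi>) \<le> val (right t))"
    using table_stepI[OF BF(1,2) u c(1)] by blast
qed

lemma tables_invariant:
  shows "entries_solvable (length (dec_list K)) (length ks) (tables x K U ks)"
    and "sound (tables x K U ks)"
    and "contains_words K U \<Longrightarrow>
      complete (length (dec_list K)) (length ks) U (tables x K U ks)"
proof (induction ks rule: rev_induct)
  case Nil
  {
    case 1 show ?case by (simp add: entries_solvable_def)
  next
    case 2 show ?case by (simp add: sound_def)
  next
    case 3 show ?case by (simp add: complete_def)
  }
next
  case (snoc k ks)
  {
    case 1 show ?case using entries_solvable_step snoc(1) by simp
  next
    case 2 show ?case using sound_step snoc(2) by simp
  next
    case 3 show ?case using complete_step[OF snoc(3)] 3 by simp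
  }
qed

lemma NB_V: "NB V = {}"
  by (auto simp: NB_def)

lemma enough_sound:
  assumes "results x K U \<noteq> []" "enough x K U"
  shows "\<exists>\<Psi>. sol V {} \<Psi> \<and> val (in_target x) \<le> sum wt \<Psi> + (\<Sum>p\<leftarrow>free_profits x. val p)"
proof -
  have "smax (results x K U) \<in> set (candidates x K U (tables x K U (in_verts x)) (in_verts x) [] [])"
    using smax_mem[OF assms(1)] unfolding results_def .
  from candidates_sound[OF tables_invariant(2) _ _ this]
  obtain \<Psi> where "sol V {} \<Psi>" "val (smax (results x K U)) \<le> sum wt \<Psi>" by (auto simp: NB_V)
  then show ?thesis using assms(2) unfolding enough_def by auto
qed

lemma results_complete:
  assumes U: "contains_words K U"
    and "solvable (length (dec_list K)) (Suc (length (in_verts x))) V" "sol V {} \<Psi>" "thin \<Psi>"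
  shows "results x K U \<noteq> [] \<and> min (val (in_target x)) (sum wt \<Psi>) \<le> val (smax (results x K U))"
proof -
  have "\<exists>c\<in>set (candidates x K U (tables x K U (in_verts x)) (in_verts x) [] []). min (val (in_target x)) (sum wt \<Psi>) \<le> val c"
    by (rule candidates_complete[OF tables_invariant(3)[OF U]]) (use assms in \<open>auto simp: NB_V\<close>)
  then show ?thesis using smax_ge unfolding results_def by fastforce
qed

lemma results_nonempty:
  assumes "contains_words K U"
    and "solvable (length (dec_list K)) (Suc (length (in_verts x))) V"
  shows "results x K U \<noteq> []"
proof -
  have "sol V {} {}" "thin {}" by (auto simp: sol_def valid_def thin_def)
  then show ?thesis using results_complete[OF assms] by blast
qed

text \<open>A nonempty result list gives \<open>solvable\<close> back through
  \<open>candidates_solvable\<close>, and this is the premise that \<open>results_complete\<close>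
  asks for. The argument applies at whatever \<open>K\<close> the loop stops.\<close>

lemma enough_complete:
  assumes U: "contains_words K U"
    and "results x K U \<noteq> []" "sol V {} \<Psi>" "thin \<Psi>"
    and "val (in_target x) \<le> sum wt \<Psi> + (\<Sum>p\<leftarrow>free_profits x. val p)"
  shows "enough x K U"
proof -
  obtain c where "c \<in> set (candidates x K U (tables x K U (in_verts x)) (in_verts x) [] [])"
    using assms(2) unfolding results_def by (meson last_in_set)
  then have "solvable (length (dec_list K)) (Suc (length (in_verts x))) V"
    by (intro candidates_solvable[OF tables_invariant(1)]) (auto simp: NB_V)
  from results_complete[OF U this assms(3,4)] show ?thesis
    using assms(5) unfolding enough_def by auto
qed

end

section \<open>Bags from a tree decomposition\<close>

text \<open>Induction along the walk: if its next vertex already lies on the simple path found so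
  far, the path is cut there, and otherwise extended.\<close>

lemma relpow_simple_path:
  assumes "(a, b) \<in> R ^^ n"
  shows "\<exists>p. p \<noteq> [] \<and> hd p = a \<and> last p = b \<and> distinct p \<and> successively (\<lambda>u v. (u, v) \<in> R) p \<and>
    length p \<le> Suc n \<and> set p \<subseteq> {w. (a, w) \<in> R\<^sup>*}"
  using assms
proof (induction n arbitrary: b)
  case 0
  then show ?case by (intro exI[of _ "[a]"]) auto
next
  case (Suc n)
  then obtain c where c: "(a, c) \<in> R ^^ n" "(c, b) \<in> R" by (auto elim: relpow_Suc_E)
  from Suc.IH[OF c(1)] obtain p where p: "p \<noteq> []" "hd p = a" "last p = c" "distinct p"
    "successively (\<lambda>u v. (u, v) \<in> R) p" "length p \<le> Suc n" "set p \<subseteq> {w. (a, w) \<in> R\<^sup>*}"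
    by (elim exE conjE)
  show ?case
  proof (cases "b \<in> set p")
    case True
    then obtain xs ys where xy: "p = xs @ b # ys" by (meson split_list)
    then have "hd (xs @ [b]) = a" using p(2) by (cases xs) auto
    then show ?thesis using p xy
      by (intro exI[of _ "xs @ [b]"]) (auto simp: successively_append_iff)
  next
    case False
    have "(a, b) \<in> R\<^sup>*" using c relpow_imp_rtrancl rtrancl_into_rtrancl by metis
    then show ?thesis using p c(2) False
      by (intro exI[of _ "p @ [b]"]) (auto simp: successively_append_iff)
  qed
qed

lemma rtrancl_simple_path:
  assumes "(a, b) \<in> R\<^sup>*"
  obtains p where "p \<noteq> []" "hd p = a" "last p = b" "distinct p" "successively (\<lambda>u v. (u, v) \<in> R) p"
    "set p \<subseteq> {w. (a, w) \<in> R\<^sup>*}"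
  using assms relpow_simple_path rtrancl_imp_relpow by metis

lemma successively_rtrancl:
  "p \<noteq> [] \<Longrightarrow> successively P p \<Longrightarrow> (\<And>u v. u \<in> set p \<Longrightarrow> v \<in> set p \<Longrightarrow> P u v \<Longrightarrow> (u, v) \<in> R) \<Longrightarrow> (hd p, last p) \<in> R\<^sup>*"
proof (induction p rule: induct_list012)
  case (3 a b p)
  then have "(a, b) \<in> R" "(b, last (b # p)) \<in> R\<^sup>*" by auto
  then show ?case by (auto intro: converse_rtrancl_into_rtrancl)
qed auto

definition tree_rel :: "nat sgraph \<Rightarrow> nat set \<Rightarrow> (nat \<times> nat) set" where
  "tree_rel T S = {(i, j). {i, j} \<in> edges T \<and> i \<in> S \<and> j \<in> S}"

lemma sym_tree_rel: "sym (tree_rel T S)"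
  by (auto simp: sym_def tree_rel_def insert_commute)

lemma tree_rel_rtrancl_in: "(i, j) \<in> (tree_rel T S)\<^sup>* \<Longrightarrow> i \<in> S \<Longrightarrow> j \<in> S"
  by (induction rule: rtrancl_induct) (auto simp: tree_rel_def)

lemma induced_connected:
  assumes "is_connected (induced T W)" "i \<in> verts T \<inter> W" "j \<in> verts T \<inter> W"
  shows "(i, j) \<in> (tree_rel T W)\<^sup>*"
proof -
  obtain p where "is_path (induced T W) i j p"
    using assms unfolding is_connected_def by (auto simp: induced_def)
  then have p: "p \<noteq> []" "hd p = i" "last p = j" "successively (\<lambda>u v. {u, v} \<in> edges (induced T W)) p"
    by (auto simp: is_path_def)
  have "(hd p, last p) \<in> (tree_rel T W)\<^sup>*"
    by (rule successively_rtrancl[OF p(1,4)]) (auto simp: induced_def tree_rel_def)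
  then show ?thesis using p by simp
qed

text \<open>Two edges with different ends in \<open>S\<close> would close a cycle together with a
  path through \<open>Q\<close> and a path through \<open>S\<close>.\<close>

lemma crossing_unique:
  assumes tree: "is_tree T" and S: "\<And>j j'. j \<in> S \<Longrightarrow> j' \<in> S \<Longrightarrow> (j, j') \<in> (tree_rel T S)\<^sup>*" "S \<subseteq> verts T"
    and Q: "\<And>k k'. k \<in> Q \<Longrightarrow> k' \<in> Q \<Longrightarrow> (k, k') \<in> (tree_rel T Q)\<^sup>*" "Q \<subseteq> verts T" "Q \<inter> S = {}"
    and e: "k \<in> Q" "j \<in> S" "{k, j} \<in> edges T" and e': "k' \<in> Q" "j' \<in> S" "{k', j'} \<in> edges T"
  shows "j = j'"
proof (rule ccontr)
  assume ne: "j \<noteq> j'"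
  obtain p where p: "p \<noteq> []" "hd p = k" "last p = k'" "distinct p"
    "successively (\<lambda>u v. (u, v) \<in> tree_rel T Q) p" "set p \<subseteq> {w. (k, w) \<in> (tree_rel T Q)\<^sup>*}"
    using rtrancl_simple_path[OF Q(1)[OF e(1) e'(1)]] .
  obtain q where q: "q \<noteq> []" "hd q = j'" "last q = j" "distinct q"
    "successively (\<lambda>u v. (u, v) \<in> tree_rel T S) q" "set q \<subseteq> {w. (j', w) \<in> (tree_rel T S)\<^sup>*}"
    using rtrancl_simple_path[OF S(1)[OF e'(2) e(2)]] .
  have pQ: "set p \<subseteq> Q" using p(6) tree_rel_rtrancl_in e(1) by blast
  have qS: "set q \<subseteq> S" using q(6) tree_rel_rtrancl_in e'(2) by blast
  have "successively (\<lambda>u v. {u, v} \<in> edges T) p" "successively (\<lambda>u v. {u, v} \<in> edges T) q"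
    using p(5) q(5) by (auto elim!: successively_mono simp: tree_rel_def)
  then have "is_path T (hd (p @ q)) (last (p @ q)) (p @ q)"
    using p(1,3,4) q(1,2,4) e' pQ qS Q(2,3) S(2)
    by (auto simp: is_path_def successively_append_iff)
  moreover have "{last (p @ q), hd (p @ q)} \<in> edges T"
    using p(1,2) q(1,3) e by (simp add: insert_commute)
  \<comment> \<open>\<open>k = k'\<close> is possible, but \<open>j\<close> and \<open>j'\<close>
    differ, so \<open>q\<close> has at least two vertices and the cycle the required three.\<close>
  moreover have "3 \<le> length (p @ q)"
  proof -
    have "2 \<le> length q" using q(1,2,3) ne by (cases q; cases "tl q") auto
    moreover have "1 \<le> length p" using p(1) by (cases p) auto
    ultimately show ?thesis by simp
  qed
  ultimately have "is_cycle T (p @ q)" unfolding is_cycle_def by blast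
  then show False using tree unfolding is_tree_def by blast
qed

text \<open>All edges between the component \<open>Q\<close> of \<open>i\<close> in \<open>T - S\<close> and the subtree \<open>S\<close> end in the same node of \<open>S\<close>,
  which is therefore passed by each of the subtrees of the elements of \<open>N\<close>.\<close>

lemma gate:
  assumes tree: "is_tree T" and S: "\<And>j j'. j \<in> S \<Longrightarrow> j' \<in> S \<Longrightarrow> (j, j') \<in> (tree_rel T S)\<^sup>*" "S \<subseteq> verts T"
    and i: "i \<in> verts T - S"
    and N: "N \<noteq> {}" "\<And>u. u \<in> N \<Longrightarrow> is_connected (induced T {i. u \<in> bag i})" "N \<subseteq> bag i"
      "\<And>u. u \<in> N \<Longrightarrow> \<exists>j\<in>S. u \<in> bag j"
  shows "\<exists>j\<in>S. N \<subseteq> bag j"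
proof -
  define Q where "Q = {k. (i, k) \<in> (tree_rel T (verts T - S))\<^sup>*}"
  have Q_sub: "Q \<subseteq> verts T - S" using tree_rel_rtrancl_in i by (auto simp: Q_def)
  have Q_conn: "(k, k') \<in> (tree_rel T Q)\<^sup>*" if "k \<in> Q" "k' \<in> Q" for k k'
  proof -
    have "(i, l) \<in> (tree_rel T Q)\<^sup>*" if "(i, l) \<in> (tree_rel T (verts T - S))\<^sup>*" for l
      using that
    proof (induction rule: rtrancl_induct)
      case (step y z)
      then have "y \<in> Q" "z \<in> Q" unfolding Q_def by auto
      then have "(y, z) \<in> tree_rel T Q" using step(2) by (auto simp: tree_rel_def)
      then show ?case using step by auto
    qed simp
    then have "(i, k) \<in> (tree_rel T Q)\<^sup>*" "(i, k') \<in> (tree_rel T Q)\<^sup>*" using that by (auto simp: Q_def)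
    then show ?thesis using sym_tree_rel by (meson rtrancl_trans sym_rtrancl symD)
  qed
  have crossing: "\<exists>k\<in>Q. \<exists>j\<in>S. {k, j} \<in> edges T \<and> u \<in> bag j" if u: "u \<in> N" for u
  proof -
    obtain m where m: "m \<in> S" "u \<in> bag m" using N(4) u by blast
    have "(i, m) \<in> (tree_rel T {i. u \<in> bag i})\<^sup>*"
      using induced_connected[OF N(2)[OF u]] i m S(2) N(3) u by auto
    \<comment> \<open>Follow the subtree of \<open>u\<close> from \<open>i\<close>: each node is
      still in \<open>Q\<close>, or an edge from \<open>Q\<close> into \<open>S\<close> has been
      passed, and the end of that edge has \<open>u\<close> in its bag.\<close>
    then have "m \<in> Q \<or> (\<exists>k\<in>Q. \<exists>j\<in>S. {k, j} \<in> edges T \<and> u \<in> bag j)"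
    proof (induction rule: rtrancl_induct)
      case base
      then show ?case by (simp add: Q_def)
    next
      case (step y z)
      have yz: "{y, z} \<in> edges T" "u \<in> bag z" using step(2) by (auto simp: tree_rel_def)
      show ?case
      proof (cases "y \<in> Q \<and> z \<notin> S")
        case True
        have "z \<in> verts T" using yz(1) tree by (auto simp: is_tree_def simple_graph_def doubleton_eq_iff dest!: bspec)
        then have "(y, z) \<in> tree_rel T (verts T - S)" using True yz Q_sub by (auto simp: tree_rel_def)
        then have "z \<in> Q" using True by (auto simp: Q_def)
        then show ?thesis by blast
      next
        case False
        then show ?thesis using step.IH yz by blast
      qed
    qed
    then show ?thesis using m Q_sub by blast
  qed
  obtain u where "u \<in> N" using N(1) by blast
  then obtain k j where kj: "k \<in> Q" "j \<in> S" "{k, j} \<in> edges T" using crossing by blast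
  have "v \<in> bag j" if "v \<in> N" for v
  proof -
    obtain k' j' where kj': "k' \<in> Q" "j' \<in> S" "{k', j'} \<in> edges T" "v \<in> bag j'" using crossing[OF \<open>v \<in> N\<close>] by blast
    have "j = j'"
      by (rule crossing_unique[OF tree S, of Q k j k' j']) (use Q_conn Q_sub kj kj' in auto)
    then show ?thesis using kj'(4) by simp
  qed
  then show ?thesis using kj(2) by blast
qed

context uf_input
begin

context
  fixes T :: "nat sgraph" and bag :: "nat \<Rightarrow> sexp set" and k :: nat
  assumes tree: "is_tree T"
    and bag_V: "(\<Union>i\<in>verts T. bag i) = V"
    and bag_adj: "adj x u v \<Longrightarrow> \<exists>i\<in>verts T. u \<in> bag i \<and> v \<in> bag i"
    and bag_conn: "v \<in> V \<Longrightarrow> is_connected (induced T {i. v \<in> bag i})"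
    and bag_bw: "i \<in> verts T \<Longrightarrow> (\<Sum>v\<in>bag i. bw v) \<le> k"
begin

text \<open>The subtrees of adjacent vertices share a node, so their union over a connected vertex
  set is connected.\<close>

lemma bags_connected:
  assumes v: "v \<in> V - B" and j: "j \<in> verts T" "bag j \<inter> cc B v \<noteq> {}" and j': "j' \<in> verts T" "bag j' \<inter> cc B v \<noteq> {}"
  shows "(j, j') \<in> (tree_rel T {j \<in> verts T. bag j \<inter> cc B v \<noteq> {}})\<^sup>*"
proof -
  let ?R = "tree_rel T {j \<in> verts T. bag j \<inter> cc B v \<noteq> {}}"
  have edge_verts: "a \<in> verts T \<and> b \<in> verts T" if "{a, b} \<in> edges T" for a b
    using that tree by (auto simp: is_tree_def simple_graph_def doubleton_eq_iff dest!: bspec)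
  have same: "(a, b) \<in> ?R\<^sup>*" if "w \<in> cc B v" "a \<in> verts T" "w \<in> bag a" "b \<in> verts T" "w \<in> bag b" for a b w
  proof -
    have "w \<in> V" using that bag_V by blast
    then have "(a, b) \<in> (tree_rel T {i. w \<in> bag i})\<^sup>*" using that by (intro induced_connected bag_conn) auto
    moreover have "tree_rel T {i. w \<in> bag i} \<subseteq> ?R" using that(1) edge_verts by (auto simp: tree_rel_def)
    ultimately show ?thesis using rtrancl_mono by blast
  qed
  obtain i where i: "i \<in> verts T" "v \<in> bag i" using v bag_V by blast
  have from_v: "(i, b) \<in> ?R\<^sup>*" if "w \<in> cc B v" "b \<in> verts T" "w \<in> bag b" for w b
  proof -
    have "(v, w) \<in> (rel B)\<^sup>*" using that(1) by (simp add: cc_def)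
    then show ?thesis using that(2,3)
    proof (induction arbitrary: b rule: rtrancl_induct)
      case base
      then show ?case using same[OF cc_refl i] by blast
    next
      case (step y z)
      have "adj x y z" using step(2) by (simp add: rel_def)
      then obtain m where m: "m \<in> verts T" "y \<in> bag m" "z \<in> bag m" using bag_adj by blast
      have "z \<in> cc B v" using step(1,2) by (auto simp: cc_def)
      then have "(m, b) \<in> ?R\<^sup>*" using same m step.prems by blast
      then show ?case using step.IH[OF m(1,2)] by (meson rtrancl_trans)
    qed
  qed
  have "(i, j) \<in> ?R\<^sup>*" "(i, j') \<in> ?R\<^sup>*" using from_v j j' by blast+
  then show ?thesis using sym_tree_rel by (meson rtrancl_trans sym_rtrancl symD)
qed

text \<open>Invariant: the neighbours of the component lie in one bag that misses the component.
  \<open>gate\<close> moves to a bag \<open>j\<close> that meets the component and still holds all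
  these neighbours; removing it leaves smaller components, for which \<open>j\<close> is the witness
  of the invariant.\<close>

lemma solvable_component:
  assumes "u \<in> V - B" "card (cc B u) \<le> r"
    and "NB (cc B u) = {} \<or> (\<exists>i\<in>verts T. NB (cc B u) \<subseteq> bag i \<and> bag i \<inter> cc B u = {})"
  shows "solvable k r (cc B u)"
  using assms
proof (induction r arbitrary: B u)
  case 0
  have "finite (cc B u)" using cc_subset[OF 0(1)] by (meson List.finite_set finite_Diff finite_subset)
  then show ?case using 0 cc_refl[of u B] by auto
next
  case (Suc r)
  let ?C = "cc B u"
  have CV: "?C \<subseteq> V" using cc_subset[OF Suc.prems(1)] by blast
  then have fin: "finite ?C" by (meson List.finite_set finite_subset)
  obtain j where j: "j \<in> verts T" "NB ?C \<subseteq> bag j" "bag j \<inter> ?C \<noteq> {}"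
  proof (cases "NB ?C = {}")
    case True
    obtain j where "j \<in> verts T" "u \<in> bag j" using Suc.prems(1) bag_V by blast
    then show ?thesis using that True cc_refl by blast
  next
    case False
    then obtain i where i: "i \<in> verts T" "NB ?C \<subseteq> bag i" "bag i \<inter> ?C = {}" using Suc.prems(3) by blast
    have "\<exists>j\<in>{j \<in> verts T. bag j \<inter> ?C \<noteq> {}}. NB ?C \<subseteq> bag j"
    proof (rule gate[OF tree])
      show "\<exists>j\<in>{j \<in> verts T. bag j \<inter> ?C \<noteq> {}}. w \<in> bag j" if w: "w \<in> NB ?C" for w
      proof -
        obtain y where "y \<in> ?C" "adj x w y" using w by (auto simp: NB_def)
        then show ?thesis using bag_adj by blast
      qed
      show "is_connected (induced T {i. w \<in> bag i})" if "w \<in> NB ?C" for w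
        using that by (intro bag_conn) (auto simp: NB_def)
    qed (use i False bags_connected[OF Suc.prems(1)] in auto)
    then show ?thesis using that by blast
  qed
  \<comment> \<open>Other vertices of \<open>bag j\<close> are dropped, since a bag has to lie
    between \<open>NB ?C\<close> and \<open>NB ?C \<union> ?C\<close>; the weight does not
    grow.\<close>
  let ?B = "NB ?C \<union> (bag j \<inter> ?C)"
  have "(\<Sum>v\<in>?B. bw v) \<le> (\<Sum>v\<in>bag j. bw v)"
  proof (rule sum_mono2)
    have "bag j \<subseteq> V" using bag_V j(1) by blast
    then show "finite (bag j)" by (meson List.finite_set finite_subset)
  qed (use j(2) in auto)
  then have w: "(\<Sum>v\<in>?B. bw v) \<le> k" using bag_bw[OF j(1)] by simp
  have "solvable k r (cc ?B w)" if w: "w \<in> ?C - ?B" for w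
  proof (rule Suc.IH)
    have inside: "cc ?B w \<subseteq> ?C - ?B" by (rule cc_inside[OF CV _ w]) blast
    show "w \<in> V - ?B" using w CV by blast
    have "cc ?B w \<subset> ?C" using inside j(3) by blast
    then have "card (cc ?B w) < card ?C" by (rule psubset_card_mono[OF fin])
    then show "card (cc ?B w) \<le> r" using Suc.prems(2) by simp
    have "NB (cc ?B w) \<subseteq> bag j" using NB_cc[OF \<open>w \<in> V - ?B\<close>] j(2) by blast
    moreover have "bag j \<inter> cc ?B w = {}" using inside by blast
    ultimately show "NB (cc ?B w) = {} \<or> (\<exists>i\<in>verts T. NB (cc ?B w) \<subseteq> bag i \<and> bag i \<inter> cc ?B w = {})"
      using j(1) by blast
  qed
  moreover have "NB ?C \<subseteq> V" by (auto simp: NB_def)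
  ultimately show ?case using w CV unfolding solvable.simps by (intro exI[of _ ?B]) blast
qed

lemma solvable_verts: "solvable k (Suc (length (in_verts x))) V"
proof -
  have "solvable k (length (in_verts x)) (cc {} u)" if "u \<in> V" for u
  proof (rule solvable_component)
    have "cc {} u \<subseteq> V" using cc_subset[of u "{}"] that by simp
    then have "card (cc {} u) \<le> card V" by (intro card_mono) auto
    also have "\<dots> \<le> length (in_verts x)" by (rule card_length)
    finally show "card (cc {} u) \<le> length (in_verts x)" .
    show "NB (cc {} u) = {} \<or> (\<exists>i\<in>verts T. NB (cc {} u) \<subseteq> bag i \<and> bag i \<inter> cc {} u = {})"
      using NB_cc[of u "{}"] that by simp
  qed (use that in simp)
  \<comment> \<open>The root bag is empty and merely separates the components of the graph, which
    accounts for the extra level.\<close>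
  then show ?thesis unfolding solvable.simps by (intro exI[of _ "{}"]) (simp add: NB_V)
qed

end

end

section \<open>Routings as sets of items\<close>

lemma sum_inj_le:
  fixes f :: "'a \<Rightarrow> nat"
  assumes "inj_on \<tau> S" "\<tau> ` S \<subseteq> T" "finite T" "\<And>z. z \<in> S \<Longrightarrow> f z \<le> g (\<tau> z)"
  shows "sum f S \<le> sum g T"
proof -
  have "sum f S \<le> (\<Sum>z\<in>S. g (\<tau> z))" by (rule sum_mono) (rule assms(4))
  also have "\<dots> = sum g (\<tau> ` S)" using sum.reindex[OF assms(1), of g] by simp
  also have "\<dots> \<le> sum g T" by (rule sum_mono2) (use assms in auto)
  finally show ?thesis .
qed

lemma path_edges_Cons:
  assumes "p \<noteq> []"
  shows "path_edges (v # p) = insert {v, hd p} (path_edges p)"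
proof -
  have "path_edges (v # p) = {{(v # p) ! i, (v # p) ! Suc i} | i. i < length p}"
    by (simp add: path_edges_def)
  also have "\<dots> = insert {v, hd p} (path_edges p)"
  proof (intro equalityI subsetI)
    fix e assume "e \<in> {{(v # p) ! i, (v # p) ! Suc i} | i. i < length p}"
    then obtain i where "i < length p" "e = {(v # p) ! i, (v # p) ! Suc i}" by blast
    then show "e \<in> insert {v, hd p} (path_edges p)"
      using assms by (cases i) (auto simp: path_edges_def hd_conv_nth)
  next
    fix e assume "e \<in> insert {v, hd p} (path_edges p)"
    then consider "e = {v, hd p}" | i where "Suc i < length p" "e = {p ! i, p ! Suc i}"
      by (auto simp: path_edges_def)
    then show "e \<in> {{(v # p) ! i, (v # p) ! Suc i} | i. i < length p}"
    proof cases
      case 1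
      then show ?thesis using assms by (intro CollectI exI[of _ 0]) (auto simp: hd_conv_nth)
    next
      case 2
      then show ?thesis by (intro CollectI exI[of _ "Suc i"]) auto
    qed
  qed
  finally show ?thesis .
qed

lemma successively_relpow:
  "p \<noteq> [] \<Longrightarrow> successively (\<lambda>u v. (u, v) \<in> R) p \<Longrightarrow> (hd p, last p) \<in> R ^^ (length p - 1)"
proof (induction p rule: induct_list012)
  case (3 a b p)
  then have "(a, b) \<in> R" "(b, last (b # p)) \<in> R ^^ length p" by auto
  then have "(a, last (b # p)) \<in> R ^^ Suc (length p)" by (rule relpow_Suc_I2)
  then show ?case by simp
qed auto

definition enc_item :: "nat \<Rightarrow> task \<Rightarrow> nat \<Rightarrow> nat \<Rightarrow> sexp" where
  "enc_item v a i q = CONS (enc_nat v) (CONS (enc_task a) (CONS (enc_unary i) (enc_nat q)))"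

lemma item_enc_item [simp]:
  "left (enc_item v a i q) = enc_nat v" "left (right (enc_item v a i q)) = enc_task a"
  "left (right (right (enc_item v a i q))) = enc_unary i" "right (right (right (enc_item v a i q))) = enc_nat q"
  by (auto simp: enc_item_def)

lemma enc_task_simps [simp]:
  "left (enc_task a) = enc_nat (source a)" "left (right (enc_task a)) = enc_nat (sink a)"
  "left (right (right (enc_task a))) = enc_nat (demand a)"
  "left (right (right (right (enc_task a)))) = enc_nat (profit a)"
  by (cases a; simp add: enc_task_def)+

lemma enc_task_inject [simp]: "enc_task a = enc_task b \<longleftrightarrow> a = b"
  by (cases a; cases b) (auto simp: enc_task_def)

lemma enc_item_inject [simp]: "enc_item v a i q = enc_item v' a' i' q' \<longleftrightarrow> v = v' \<and> a = a' \<and> i = i' \<and> q = q'"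
  by (auto simp: enc_item_def)

lemma enc_edge_simps [simp]:
  "left (enc_edge \<gamma> (u, v)) = enc_nat u" "left (right (enc_edge \<gamma> (u, v))) = enc_nat v"
  "length (dec_list (left (right (right (enc_edge \<gamma> (u, v)))))) = \<gamma> {u, v}"
  by (simp_all add: enc_edge_def)

lemma distinct_concat_map:
  assumes "distinct xs" "\<And>a. a \<in> set xs \<Longrightarrow> distinct (f a)"
    and "\<And>a b z. a \<in> set xs \<Longrightarrow> b \<in> set xs \<Longrightarrow> z \<in> set (f a) \<Longrightarrow> z \<in> set (f b) \<Longrightarrow> a = b"
  shows "distinct (concat (map f xs))"
  using assms
proof (induction xs)
  case (Cons a xs)
  have "distinct (concat (map f xs))" by (rule Cons.IH) (use Cons.prems in auto)
  moreover have "set (f a) \<inter> set (concat (map f xs)) = {}"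
    using Cons.prems(1,3) by fastforce
  ultimately show ?case using Cons.prems(2) by simp
qed simp

lemma distinct_items_aux:
  assumes "distinct (in_verts x)" "distinct (in_tasks x)"
  shows "distinct (items x)"
  unfolding items_def
proof (intro distinct_concat_map)
  show "distinct (map (\<lambda>q. CONS v (CONS a (CONS i q))) (filter P (in_verts x)))" for v a i P
    using assms(1) by (simp add: distinct_map inj_on_def)
  show "distinct (indices x)"
    unfolding indices_def by (rule distinct_filter) (rule distinct_unaries)
qed (use assms in auto)

locale uf_encoding =
  fixes I :: uf_instance and vs :: "nat list" and es :: "(nat \<times> nat) list" and as :: "task list" and x :: sexp
  assumes valid_I: "valid_instance I"
    and vs: "set vs = verts (graph I)" "distinct vs"
    and es: "set (map (\<lambda>(u, v). {u, v}) es) = edges (graph I)" "distinct (map (\<lambda>(u, v). {u, v}) es)"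
    and as: "set as = tasks I" "distinct as"
    and x_def: "x = enc_list [enc_list (map enc_nat vs), enc_list (map (enc_edge (capacity I)) es),
           enc_list (map enc_task as), enc_nat (target I), enc_int (len_bound I)]"
begin

lemma x_simps [simp]:
  "in_verts x = map enc_nat vs" "in_edges x = map (enc_edge (capacity I)) es"
  "in_tasks x = map enc_task as" "in_target x = enc_nat (target I)" "in_bound x = enc_int (len_bound I)"
  by (simp_all add: x_def)

abbreviation "G \<equiv> graph I"

lemma graph_facts:
  "finite (verts G)" "e \<in> edges G \<Longrightarrow> \<exists>u\<in>verts G. \<exists>v\<in>verts G. u \<noteq> v \<and> e = {u, v}"
  using valid_I unfolding valid_instance_def simple_graph_def by blast+

lemma edge_verts: "{u, v} \<in> edges G \<Longrightarrow> u \<in> verts G \<and> v \<in> verts G \<and> u \<noteq> v"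
  using graph_facts(2)[of "{u, v}"] by (auto simp: doubleton_eq_iff)

lemma finite_edges: "finite (edges G)"
  using es(1) by (metis List.finite_set)

lemma task_verts: "a \<in> tasks I \<Longrightarrow> source a \<in> verts G \<and> sink a \<in> verts G"
  using valid_I unfolding valid_instance_def by blast

lemma finite_tasks: "finite (tasks I)"
  using as(1) by (metis List.finite_set)

lemma edges_image: "edges G = (\<lambda>(u, v). {u, v}) ` set es"
  using es(1) by simp

lemma es_edges: "(u, v) \<in> set es \<Longrightarrow> {u, v} \<in> edges G"
  unfolding edges_image by (rule image_eqI[of _ _ "(u, v)"]) auto

lemma edges_es: "e \<in> edges G \<Longrightarrow> \<exists>u v. (u, v) \<in> set es \<and> e = {u, v}"
  unfolding edges_image by auto

lemma set_in_verts: "set (in_verts x) = enc_nat ` verts G"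
  using vs(1) by simp

sublocale uf_input x
proof
  show "distinct (in_verts x)" using vs(2) by (simp add: distinct_map inj_on_def)
  moreover have "distinct (in_tasks x)" using as(2) by (simp add: distinct_map inj_on_def)
  ultimately show "distinct (items x)" by (rule distinct_items_aux)
  fix e assume "e \<in> set (in_edges x)"
  then obtain u v where "e = enc_edge (capacity I) (u, v)" "{u, v} \<in> edges G"
    using es_edges by auto
  then show "edge_fst e \<in> set (in_verts x) \<and> edge_snd e \<in> set (in_verts x)"
    using edge_verts[of u v] vs(1) by auto
qed

lemma adj_enc [simp]: "adj x (enc_nat u) (enc_nat v) \<longleftrightarrow> {u, v} \<in> edges G"
proof -
  have "adj x (enc_nat u) (enc_nat v) \<longleftrightarrow> (\<exists>(a, b)\<in>set es. (a = u \<and> b = v) \<or> (a = v \<and> b = u))"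
    unfolding adj_def by (auto simp: split_beta) (metis (no_types, lifting) enc_edge_simps(1,2) prod.collapse enc_nat_inject)+
  also have "\<dots> \<longleftrightarrow> {u, v} \<in> edges G"
    using edges_es[of "{u, v}"] es_edges by (fastforce simp: doubleton_eq_iff insert_commute)
  finally show ?thesis .
qed

lemma set_indices: "set (indices x) = enc_unary ` {i. i \<le> length vs \<and> int i \<le> len_bound I}"
  unfolding indices_def
  by (auto simp: set_unaries enc_int_def val_binary)

abbreviation nf :: "task \<Rightarrow> bool" where
  "nf a \<equiv> 0 < demand a \<and> source a \<noteq> sink a"

lemma nonfree_enc [simp]: "nonfree (enc_task a) \<longleftrightarrow> nf a"
  by (simp add: nonfree_def)

lemma mem_items: "z \<in> set (items x) \<longleftrightarrow> (\<exists>v a i q. z = enc_item v a i q \<and> v \<in> verts G \<and> a \<in> tasks I \<and> nf a \<and>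
    i \<le> length vs \<and> int i \<le> len_bound I \<and> q \<in> verts G \<and> (v = sink a \<or> (i \<noteq> 0 \<and> {v, q} \<in> edges G)))"
proof -
  have nz: "enc_unary i = NIL \<longleftrightarrow> i = 0" for i by (cases i) (auto simp: enc_unary_def)
  have "z \<in> set (items x) \<longleftrightarrow> (\<exists>v\<in>set vs. \<exists>a\<in>{a\<in>set as. nf a}. \<exists>i\<in>{i. i \<le> length vs \<and> int i \<le> len_bound I}.
      \<exists>q\<in>{q\<in>set vs. v = sink a \<or> (i \<noteq> 0 \<and> {v, q} \<in> edges G)}. z = enc_item v a i q)"
    unfolding items_def mem_concat_map set_map set_filter set_indices x_simps enc_item_def
    by (auto simp: nz image_iff)
  then show ?thesis using vs(1) as(1) by blast
qed

section \<open>Breadth-first search and free tasks\<close>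

definition arcs :: "(nat \<times> nat) set" where
  "arcs = {(u, v). {u, v} \<in> edges G}"

lemma rel_relpow: "(enc_nat u, w) \<in> rel {} ^^ j \<longleftrightarrow> (\<exists>v. w = enc_nat v \<and> (u, v) \<in> arcs ^^ j)"
proof (induction j arbitrary: w)
  case (Suc j)
  have step: "(enc_nat v, w) \<in> rel {} \<longleftrightarrow> (\<exists>v'. w = enc_nat v' \<and> (v, v') \<in> arcs)" for v w
    using adj_verts[of "enc_nat v" w] vs(1) by (auto simp: rel_def arcs_def)
  show ?case unfolding relpow.simps relcomp_unfold using Suc step by auto blast
qed auto

lemma is_path_relpow: "is_path G s t p \<Longrightarrow> (s, t) \<in> arcs ^^ path_length p"
  using successively_relpow[of p arcs] by (auto simp: is_path_def path_length_def arcs_def)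

lemma relpow_is_path:
  assumes "(s, t) \<in> arcs ^^ j" "s \<in> verts G"
  shows "\<exists>p. is_path G s t p \<and> path_length p \<le> j"
proof -
  obtain p where p: "p \<noteq> []" "hd p = s" "last p = t" "distinct p" "successively (\<lambda>u v. (u, v) \<in> arcs) p"
    "length p \<le> Suc j" "set p \<subseteq> {w. (s, w) \<in> arcs\<^sup>*}"
    using relpow_simple_path[OF assms(1)] by blast
  have "w \<in> verts G" if "(s, w) \<in> arcs\<^sup>*" for w
    using that assms(2) by (induction rule: rtrancl_induct) (auto simp: arcs_def dest: edge_verts)
  then have "is_path G s t p" using p by (auto simp: is_path_def arcs_def)
  then show ?thesis using p(6) by (auto simp: path_length_def)
qed

lemma path_length_le: "is_path G s t p \<Longrightarrow> Suc (path_length p) \<le> length vs"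
proof -
  assume "is_path G s t p"
  then have "p \<noteq> []" "distinct p" "set p \<subseteq> set vs" using vs by (auto simp: is_path_def)
  then have "length p \<le> length vs" using vs(2) by (metis card_mono distinct_card List.finite_set)
  then show ?thesis using \<open>p \<noteq> []\<close> by (cases p) (auto simp: path_length_def)
qed

definition routable :: "task \<Rightarrow> bool" where
  "routable a \<longleftrightarrow> (\<exists>p. is_path G (source a) (sink a) p \<and> int (path_length p) \<le> len_bound I)"

text \<open>The search follows walks while a route is a simple path. Cutting a walk down to a path
  does not lengthen it, and the length of a simple path is below the number of vertices, hence among
  the indices.\<close>

lemma routable_iff:
  assumes "a \<in> tasks I"
  shows "(\<exists>i\<in>set (indices x). enc_nat (sink a) \<in> set (reach x [] (dec_list i) (enc_nat (source a)))) \<longleftrightarrow> routable a"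
proof -
  have s: "enc_nat (source a) \<in> V - set []" using task_verts[OF assms] set_in_verts by auto
  have "(\<exists>i\<in>set (indices x). enc_nat (sink a) \<in> set (reach x [] (dec_list i) (enc_nat (source a)))) \<longleftrightarrow>
      (\<exists>i j. i \<le> length vs \<and> int i \<le> len_bound I \<and> j \<le> i \<and> (source a, sink a) \<in> arcs ^^ j)"
    unfolding set_indices set_reach[OF s] by (auto simp: rel_relpow)
  also have "\<dots> \<longleftrightarrow> routable a"
  proof
    assume "\<exists>i j. i \<le> length vs \<and> int i \<le> len_bound I \<and> j \<le> i \<and> (source a, sink a) \<in> arcs ^^ j"
    then obtain i j where ij: "int i \<le> len_bound I" "j \<le> i" "(source a, sink a) \<in> arcs ^^ j" by blast
    then obtain p where "is_path G (source a) (sink a) p" "path_length p \<le> j"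
      using relpow_is_path task_verts[OF assms] by blast
    then show "routable a" using ij unfolding routable_def by (intro exI[of _ p]) auto
  next
    assume "routable a"
    then obtain p where "is_path G (source a) (sink a) p" "int (path_length p) \<le> len_bound I"
      unfolding routable_def by blast
    then show "\<exists>i j. i \<le> length vs \<and> int i \<le> len_bound I \<and> j \<le> i \<and> (source a, sink a) \<in> arcs ^^ j"
      using path_length_le is_path_relpow by (intro exI[of _ "path_length p"]) (auto dest: Suc_leD)
  qed
  finally show ?thesis .
qed

lemma sum_free_profits: "(\<Sum>p\<leftarrow>free_profits x. val p) = (\<Sum>a\<in>{a\<in>tasks I. \<not> nf a \<and> routable a}. profit a)"
proof -
  have "free_profits x = map (\<lambda>a. enc_nat (profit a)) (filter (\<lambda>a. \<not> nf a \<and> routable a) as)"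
    unfolding free_profits_def x_simps filter_map map_map o_def nonfree_enc enc_task_simps
    by (intro map_cong filter_cong refl) (use routable_iff as(1) in blast)
  then show ?thesis using as by (simp add: o_def sum_list_distinct_conv_sum_set)
qed

lemma uses_enc: "uses (enc_edge (capacity I) (u, v)) (enc_item w a i q) \<longleftrightarrow> {w, q} = {u, v}"
  by (auto simp: uses_def doubleton_eq_iff)

lemma path_loop: "is_path G s s p \<Longrightarrow> p = [s]"
proof -
  assume p: "is_path G s s p"
  then obtain q where q: "p = s # q" unfolding is_path_def by (cases p) auto
  then have "q = []" using p unfolding is_path_def by (cases q rule: rev_cases) auto
  then show ?thesis using q by simp
qed

section \<open>From item sets to routings\<close>

context
  fixes \<Psi> :: "sexp set"
  assumes sol: "sol V {} \<Psi>"
begin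

lemma \<Psi>_items: "\<Psi> \<subseteq> set (items x)" and \<Psi>_valid: "valid (V) \<Psi>"
  using sol unfolding sol_def NB_V by auto

text \<open>The items of \<open>a\<close> are followed from \<open>v\<close> on; budgets fall
  strictly, so the chain ends, which it can do only at the sink. All later items have a budget below
  \<open>i\<close>, and a task has at most one item per vertex, so \<open>v\<close> is not met again
  and the path is simple.\<close>

lemma item_path:
  assumes "enc_item v a i q \<in> \<Psi>"
  shows "\<exists>p. is_path G v (sink a) p \<and> path_length p \<le> i \<and>
    (\<forall>e\<in>path_edges p. \<exists>w j q. enc_item w a j q \<in> \<Psi> \<and> e = {w, q}) \<and>
    (\<forall>w\<in>set p. \<exists>j\<le>i. \<exists>q. enc_item w a j q \<in> \<Psi>)"
  using assms
proof (induction i arbitrary: v q rule: less_induct)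
  case (less i)
  have z: "v \<in> verts G" "q \<in> verts G" "v = sink a \<or> (i \<noteq> 0 \<and> {v, q} \<in> edges G)"
    using \<Psi>_items less.prems mem_items[of "enc_item v a i q"] by auto
  show ?case
  proof (cases "v = sink a")
    case True
    then show ?thesis using z(1) less.prems
      by (intro exI[of _ "[v]"]) (auto simp: is_path_def path_length_def path_edges_def)
  next
    case False
    then have i: "i \<noteq> 0" and vq: "{v, q} \<in> edges G" using z by auto
    have "\<exists>y\<in>\<Psi>. item_loc y = enc_nat q \<and> item_task y = enc_task a \<and> item_idx y = right (enc_unary i)"
      using valid_next[OF \<Psi>_valid less.prems] z False vs(1) by simp
    then obtain y where y: "y \<in> \<Psi>" "item_loc y = enc_nat q" "item_task y = enc_task a" "item_idx y = right (enc_unary i)"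
      by blast
    obtain i' where i': "i = Suc i'" using i by (cases i) auto
    obtain q' where q': "enc_item q a i' q' \<in> \<Psi>"
    proof -
      obtain v'' a'' i'' q'' where "y = enc_item v'' a'' i'' q''" using \<Psi>_items y(1) mem_items by blast
      then show ?thesis using that y i' by (simp add: enc_unary_Suc)
    qed
    obtain p where p: "is_path G q (sink a) p" "path_length p \<le> i'"
      "\<forall>e\<in>path_edges p. \<exists>w j q. enc_item w a j q \<in> \<Psi> \<and> e = {w, q}"
      "\<forall>w\<in>set p. \<exists>j\<le>i'. \<exists>q. enc_item w a j q \<in> \<Psi>"
      using less.IH[OF _ q'] i' by blast
    have pq: "p \<noteq> []" "hd p = q" using p(1) by (auto simp: is_path_def)
    have "v \<notin> set p"
    proof
      assume "v \<in> set p"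
      then obtain j r where "j \<le> i'" "enc_item v a j r \<in> \<Psi>" using p(4) by blast
      then show False
        using valid_unique[OF \<Psi>_valid less.prems, of "enc_item v a j r"] z(1) vs(1) i' by simp
    qed
    then have "is_path G v (sink a) (v # p)"
      using p(1) vq z(1) by (cases p) (auto simp: is_path_def)
    moreover have "path_length (v # p) \<le> i"
      using p(2) pq i' by (cases p) (auto simp: path_length_def)
    moreover have "\<forall>e\<in>path_edges (v # p). \<exists>w j q. enc_item w a j q \<in> \<Psi> \<and> e = {w, q}"
      using p(3) less.prems unfolding path_edges_Cons[OF pq(1)] pq(2) by blast
    moreover have "\<forall>w\<in>set (v # p). \<exists>j\<le>i. \<exists>q. enc_item w a j q \<in> \<Psi>"
      using p(4) less.prems unfolding i' by (auto dest: le_SucI) (meson le_SucI)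
    ultimately show ?thesis by blast
  qed
qed

text \<open>Selected are the routable free tasks and the other tasks with an item at their source.
  Items off the chosen paths can only make the sum in the capacity clause exceed the true
  load.\<close>

lemma sol_imp_yes:
  assumes "target I \<le> sum wt \<Psi> + (\<Sum>p\<leftarrow>free_profits x. val p)"
  shows "uf_yes I"
proof -
  define A1 where "A1 = {a\<in>tasks I. \<not> nf a \<and> routable a}"
  define A2 where "A2 = {a\<in>tasks I. nf a \<and> (\<exists>i q. enc_item (source a) a i q \<in> \<Psi>)}"
  have "\<exists>p. is_path G (source a) (sink a) p \<and> int (path_length p) \<le> len_bound I \<and>
      (nf a \<longrightarrow> (\<forall>e\<in>path_edges p. \<exists>w j q. enc_item w a j q \<in> \<Psi> \<and> e = {w, q}))" if a: "a \<in> A1 \<union> A2" for a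
  proof (cases "a \<in> A1")
    case True
    then show ?thesis unfolding A1_def routable_def by blast
  next
    case False
    then obtain i q where iq: "enc_item (source a) a i q \<in> \<Psi>" using a unfolding A2_def by blast
    then have "int i \<le> len_bound I" using \<Psi>_items mem_items[of "enc_item (source a) a i q"] by auto
    then show ?thesis using item_path[OF iq] by force
  qed
  then obtain R where R: "\<And>a. a \<in> A1 \<union> A2 \<Longrightarrow> is_path G (source a) (sink a) (R a) \<and> int (path_length (R a)) \<le> len_bound I \<and>
      (nf a \<longrightarrow> (\<forall>e\<in>path_edges (R a). \<exists>w j q. enc_item w a j q \<in> \<Psi> \<and> e = {w, q}))"
    by metis
  have fin\<Psi>: "finite \<Psi>" using \<Psi>_items by (rule finite_subset) simp
  have fin: "finite A1" "finite A2" using finite_tasks by (auto simp: A1_def A2_def)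
  have "(\<Sum>a | a \<in> A1 \<union> A2 \<and> e \<in> path_edges (R a). demand a) \<le> capacity I e" if e: "e \<in> edges G" for e
  proof -
    obtain u v where uv: "(u, v) \<in> set es" "e = {u, v}" using edges_es[OF e] by blast
    let ?e = "enc_edge (capacity I) (u, v)"
    let ?S = "{a\<in>A2. e \<in> path_edges (R a)}"
    have "(\<Sum>a | a \<in> A1 \<union> A2 \<and> e \<in> path_edges (R a). demand a) = sum demand ?S"
    proof (rule sum.mono_neutral_right)
      show "\<forall>a\<in>{a. a \<in> A1 \<union> A2 \<and> e \<in> path_edges (R a)} - ?S. demand a = 0"
      proof
        fix a assume a: "a \<in> {a. a \<in> A1 \<union> A2 \<and> e \<in> path_edges (R a)} - ?S"
        then have "\<not> nf a" "e \<in> path_edges (R a)" by (auto simp: A1_def)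
        \<comment> \<open>The only path from a vertex to itself is trivial, so a free task that uses
          an edge must be free by demand 0.\<close>
        moreover have "source a \<noteq> sink a"
        proof
          assume "source a = sink a"
          then have "R a = [source a]" using R[of a] a path_loop by auto
          then show False using a by (simp add: path_edges_def)
        qed
        ultimately show "demand a = 0" by simp
      qed
    qed (use fin in auto)
    also have "\<dots> \<le> (\<Sum>z\<in>{z\<in>\<Psi>. uses ?e z}. val (task_dem (item_task z)))"
    proof -
      have "\<exists>z. z \<in> \<Psi> \<and> uses ?e z \<and> item_task z = enc_task a" if a: "a \<in> ?S" for a
      proof -
        have "nf a" using a by (auto simp: A2_def)
        then obtain w j q where "enc_item w a j q \<in> \<Psi>" "e = {w, q}" using R[of a] a by blast
        then show ?thesis using uses_enc[of u v w a j q] uv(2) by (intro exI[of _ "enc_item w a j q"]) simp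
      qed
      then have "\<forall>a\<in>?S. \<exists>z. z \<in> \<Psi> \<and> uses ?e z \<and> item_task z = enc_task a" by blast
      from bchoice[OF this] obtain \<zeta> where \<zeta>: "\<forall>a\<in>?S. \<zeta> a \<in> \<Psi> \<and> uses ?e (\<zeta> a) \<and> item_task (\<zeta> a) = enc_task a" ..
      show ?thesis
      proof (rule sum_inj_le[where \<tau> = \<zeta>])
        show "inj_on \<zeta> ?S"
        proof (rule inj_onI)
          fix a b assume ab: "a \<in> ?S" "b \<in> ?S" "\<zeta> a = \<zeta> b"
          have "item_task (\<zeta> a) = enc_task a" "item_task (\<zeta> b) = enc_task b"
            using bspec[OF \<zeta> ab(1)] bspec[OF \<zeta> ab(2)] by blast+
          then have "enc_task a = enc_task b" unfolding ab(3) by (rule trans[OF sym])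
          then show "a = b" by simp
        qed
        show "\<zeta> ` ?S \<subseteq> {z\<in>\<Psi>. uses ?e z}"
        proof (rule image_subsetI)
          show "\<zeta> a \<in> {z\<in>\<Psi>. uses ?e z}" if "a \<in> ?S" for a
            using bspec[OF \<zeta> that] by blast
        qed
        show "demand a \<le> val (task_dem (item_task (\<zeta> a)))" if "a \<in> ?S" for a
          using bspec[OF \<zeta> that] by simp
      qed (use fin\<Psi> in simp)
    qed
    also have "\<dots> \<le> length (edge_cap ?e)"
      by (rule valid_cap[OF \<Psi>_valid]) (use uv e edge_verts[of u v] vs(1) in auto)
    also have "\<dots> = capacity I e" using uv(2) by simp
    finally show ?thesis .
  qed
  then have "flow_routing I (A1 \<union> A2) R" unfolding flow_routing_def using R by blast
  moreover have "target I \<le> (\<Sum>a\<in>A1 \<union> A2. profit a)"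
  proof -
    let ?S = "{z\<in>\<Psi>. item_loc z = task_src (item_task z)}"
    have "sum wt \<Psi> = sum wt ?S"
      by (rule sum.mono_neutral_right) (use fin\<Psi> in \<open>auto simp: wt_def\<close>)
    also have "\<dots> \<le> sum profit A2"
    proof (rule sum_inj_le[where \<tau> = "\<lambda>z. inv enc_task (item_task z)"])
      have inv: "inv enc_task (enc_task a) = a" for a by (rule inv_f_f) (simp add: inj_on_def)
      have S: "\<exists>a i q. z = enc_item (source a) a i q \<and> a \<in> tasks I \<and> nf a" if "z \<in> ?S" for z
        using that \<Psi>_items mem_items[of z] by auto
      show "inj_on (\<lambda>z. inv enc_task (item_task z)) ?S"
      proof (rule inj_onI)
        fix y z assume yz: "y \<in> ?S" "z \<in> ?S" "inv enc_task (item_task y) = inv enc_task (item_task z)"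
        then obtain a i q b j r where ab: "y = enc_item (source a) a i q" "z = enc_item (source b) b j r" "a \<in> tasks I"
          using S[OF yz(1)] S[OF yz(2)] by blast
        then have "a = b" using yz(3) inv by simp
        then show "y = z"
          using valid_unique[OF \<Psi>_valid, of y z] yz(1,2) ab task_verts[OF ab(3)] vs(1) by simp
      qed
      show "(\<lambda>z. inv enc_task (item_task z)) ` ?S \<subseteq> A2"
        using S inv by (force simp: A2_def)
      show "wt z \<le> profit (inv enc_task (item_task z))" if "z \<in> ?S" for z
        using S[OF that] inv by (auto simp: wt_def)
    qed (rule fin)
    finally have "target I \<le> sum profit A2 + sum profit A1"
      using assms unfolding sum_free_profits A1_def by simp
    also have "\<dots> = (\<Sum>a\<in>A1 \<union> A2. profit a)"
      using fin by (subst sum.union_disjoint) (auto simp: A1_def A2_def)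
    finally show ?thesis .
  qed
  moreover have "A1 \<union> A2 \<subseteq> tasks I" by (auto simp: A1_def A2_def)
  ultimately show ?thesis unfolding uf_yes_def by blast
qed

end

section \<open>Vertex weights and the items of a routing\<close>

lemma bw_enc: "bw (enc_nat v) = 1 + (\<Sum>e\<in>{e\<in>edges G. v \<in> e}. capacity I e)"
proof -
  have "bw (enc_nat v) = 1 + (\<Sum>(u, w)\<leftarrow>es. if u = v \<or> w = v then capacity I {u, w} else 0)"
    unfolding bw_def load_def x_simps by (induction es) (auto simp: length_concat)
  also have "(\<Sum>(u, w)\<leftarrow>es. if u = v \<or> w = v then capacity I {u, w} else 0) =
      (\<Sum>e\<leftarrow>map (\<lambda>(u, w). {u, w}) es. if v \<in> e then capacity I e else 0)"
    unfolding map_map o_def by (intro arg_cong[where f = sum_list] map_cong refl) (auto split: prod.split)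
  also have "\<dots> = (\<Sum>e\<in>edges G. if v \<in> e then capacity I e else 0)"
    by (simp only: sum_list_distinct_conv_sum_set[OF es(2)] es(1))
  also have "\<dots> = (\<Sum>e\<in>{e\<in>edges G. v \<in> e}. capacity I e)"
    using finite_edges by (simp add: sum.inter_filter)
  finally show ?thesis .
qed

lemma bw_le: "v \<in> verts G \<Longrightarrow> bw (enc_nat v) \<le> 1 + max_capacity I * max_degree G"
proof -
  assume v: "v \<in> verts G"
  have "(\<Sum>e\<in>{e\<in>edges G. v \<in> e}. capacity I e) \<le> card {e\<in>edges G. v \<in> e} * max_capacity I"
  proof -
    have "capacity I e \<le> max_capacity I" if "e \<in> edges G" for e
      unfolding max_capacity_def using that finite_edges by (intro Max_ge) auto
    then show ?thesis using sum_bounded_above[of "{e\<in>edges G. v \<in> e}" "capacity I" "max_capacity I"] by simp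
  qed
  also have "\<dots> \<le> max_degree G * max_capacity I"
  proof (rule mult_le_mono1)
    show "card {e\<in>edges G. v \<in> e} \<le> max_degree G"
      unfolding max_degree_def degree_def[symmetric] using v graph_facts(1) by (intro Max_ge) auto
  qed
  finally show ?thesis unfolding bw_enc by (simp add: mult.commute)
qed

context
  fixes A :: "task set" and R :: "task \<Rightarrow> nat list"
  assumes A: "A \<subseteq> tasks I" and R: "flow_routing I A R"
begin

text \<open>The last vertex points to itself; as no edge is a loop, the item at the sink uses no
  capacity.\<close>

definition next_vertex :: "nat list \<Rightarrow> nat \<Rightarrow> nat" where
  "next_vertex p j = (if Suc j < length p then p ! Suc j else p ! j)"

definition route_item :: "task \<Rightarrow> nat \<Rightarrow> sexp" where
  "route_item a j = enc_item (R a ! j) a (length (R a) - 1 - j) (next_vertex (R a) j)"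

definition route_items :: "sexp set" where
  "route_items = (\<Union>a\<in>{a\<in>A. nf a}. route_item a ` {..<length (R a)})"

lemma route: 
  assumes "a \<in> A"
  shows "is_path G (source a) (sink a) (R a)" "int (path_length (R a)) \<le> len_bound I" "R a \<noteq> []"
    "distinct (R a)" "set (R a) \<subseteq> verts G" "R a ! 0 = source a" "R a ! (length (R a) - 1) = sink a"
    "Suc j < length (R a) \<Longrightarrow> {R a ! j, R a ! Suc j} \<in> edges G"
proof -
  show p: "is_path G (source a) (sink a) (R a)" and "int (path_length (R a)) \<le> len_bound I"
    using R assms unfolding flow_routing_def by blast+
  show "R a \<noteq> []" "distinct (R a)" "set (R a) \<subseteq> verts G" "R a ! 0 = source a" "R a ! (length (R a) - 1) = sink a"
    using p by (auto simp: is_path_def hd_conv_nth last_conv_nth)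
  show "Suc j < length (R a) \<Longrightarrow> {R a ! j, R a ! Suc j} \<in> edges G"
    using p by (auto simp: is_path_def successively_conv_nth)
qed

lemma finite_A: "finite A"
  using A finite_tasks by (rule finite_subset)

lemma route_items_subset: "route_items \<subseteq> set (items x)"
proof
  fix z assume "z \<in> route_items"
  then obtain a j where aj: "a \<in> A" "nf a" "j < length (R a)" "z = route_item a j"
    by (auto simp: route_items_def)
  note r = route[OF aj(1)]
  have "R a ! j \<in> verts G" "next_vertex (R a) j \<in> verts G"
    using r(5) aj(3) by (auto simp: next_vertex_def subset_iff)
  moreover have "length (R a) - 1 - j \<le> path_length (R a)" by (simp add: path_length_def)
  moreover have "path_length (R a) \<le> length vs" using path_length_le[OF r(1)] by simp
  moreover have "R a ! j = sink a \<or> (length (R a) - 1 - j \<noteq> 0 \<and> {R a ! j, next_vertex (R a) j} \<in> edges G)"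
  proof (cases "Suc j < length (R a)")
    case True
    then show ?thesis using r(8)[OF True] by (simp add: next_vertex_def)
  next
    case False
    then have "j = length (R a) - 1" using aj(3) by simp
    then show ?thesis using r(7) by simp
  qed
  ultimately show "z \<in> set (items x)"
    unfolding mem_items aj(4) route_item_def using aj(1,2) A r(2)
    by (intro exI[of _ "R a ! j"] exI[of _ a] exI[of _ "length (R a) - 1 - j"] exI[of _ "next_vertex (R a) j"]) auto
qed

lemma route_uses:
  assumes a: "a \<in> A" and j: "j < length (R a)" and uv: "(u, v) \<in> set es"
    and use: "uses (enc_edge (capacity I) (u, v)) (route_item a j)"
  shows "Suc j < length (R a)" "{R a ! j, R a ! Suc j} = {u, v}"
proof -
  have e: "{R a ! j, next_vertex (R a) j} = {u, v}" using use by (simp add: route_item_def uses_enc)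
  moreover have "u \<noteq> v" using es_edges[OF uv] edge_verts by blast
  ultimately show "Suc j < length (R a)" by (auto simp: next_vertex_def doubleton_eq_iff split: if_splits)
  then show "{R a ! j, R a ! Suc j} = {u, v}" using e by (simp add: next_vertex_def)
qed

lemma route_capacity:
  assumes e: "e \<in> edges G"
  shows "(\<Sum>a\<in>{a\<in>A. e \<in> path_edges (R a)}. demand a) \<le> capacity I e"
  using R e unfolding flow_routing_def by blast

lemma inv_enc_task: "inv enc_task (enc_task a) = a"
  by (rule inv_f_f) (simp add: inj_on_def)

lemma route_items_valid: "valid (V) route_items"
  unfolding valid_def
proof (intro conjI ballI impI)
  fix y z assume y: "y \<in> route_items" and z: "z \<in> route_items"
    and yz: "item_loc y \<in> V \<and> item_loc y = item_loc z \<and> item_task y = item_task z"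
  then obtain a j b k where ab: "a \<in> A" "j < length (R a)" "y = route_item a j" "k < length (R b)" "z = route_item b k"
    by (auto simp: route_items_def)
  then have "a = b" "R a ! j = R b ! k" using yz by (auto simp: route_item_def)
  then show "y = z" using ab route(4)[OF ab(1)] by (simp add: nth_eq_iff_index_eq)
next
  fix z assume z: "z \<in> route_items" "item_loc z \<in> V"
  then obtain a j where aj: "a \<in> A" "nf a" "j < length (R a)" "z = route_item a j"
    by (auto simp: route_items_def)
  show "item_loc z = task_snk (item_task z) \<or> item_next z \<notin> V \<or>
       (\<exists>y\<in>route_items. item_loc y = item_next z \<and> item_task y = item_task z \<and> item_idx y = right (item_idx z))"
  proof (cases "Suc j < length (R a)")
    case True
    have "route_item a (Suc j) \<in> route_items"
      unfolding route_items_def using aj(1,2) True by (intro UN_I[of a] imageI) simp_all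
    moreover have "length (R a) - 1 - j = Suc (length (R a) - 1 - Suc j)" using True by simp
    ultimately show ?thesis using True
      by (intro disjI2 bexI[of _ "route_item a (Suc j)"]) (simp_all add: aj(4) route_item_def next_vertex_def enc_unary_Suc)
  next
    case False
    then have "j = length (R a) - 1" using aj(3) by simp
    then show ?thesis using route(7)[OF aj(1)] by (simp add: aj(4) route_item_def)
  qed
next
  fix e assume "e \<in> set (in_edges x)" "edge_fst e \<in> V \<and> edge_snd e \<in> V"
  then obtain u v where uv: "(u, v) \<in> set es" "e = enc_edge (capacity I) (u, v)" by auto
  have "(\<Sum>z\<in>{z\<in>route_items. uses e z}. val (task_dem (item_task z))) \<le> (\<Sum>a\<in>{a\<in>A. {u, v} \<in> path_edges (R a)}. demand a)"
  proof (rule sum_inj_le[where \<tau> = "\<lambda>z. inv enc_task (item_task z)"])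
    show "inj_on (\<lambda>z. inv enc_task (item_task z)) {z\<in>route_items. uses e z}"
    proof (rule inj_onI)
      fix y z assume y: "y \<in> {z\<in>route_items. uses e z}" and z: "z \<in> {z\<in>route_items. uses e z}"
        and yz: "inv enc_task (item_task y) = inv enc_task (item_task z)"
      obtain a j where aj: "a \<in> A" "j < length (R a)" "y = route_item a j" using y by (auto simp: route_items_def)
      obtain b k where bk: "b \<in> A" "k < length (R b)" "z = route_item b k" using z by (auto simp: route_items_def)
      have ab: "a = b" using yz aj bk by (simp add: route_item_def inv_enc_task)
      have "Suc j < length (R a)" "{R a ! j, R a ! Suc j} = {u, v}" "Suc k < length (R a)" "{R a ! k, R a ! Suc k} = {u, v}"
        using route_uses[OF aj(1,2) uv(1)] route_uses[OF bk(1,2) uv(1)] y z uv(2) aj(3) bk(3) ab by auto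
      \<comment> \<open>A simple path passes an edge only once, so each task contributes a single
        item to it.\<close>
      then have "j = k"
        using route(4)[OF aj(1)] by (auto simp: doubleton_eq_iff nth_eq_iff_index_eq)
      then show "y = z" using aj bk ab by simp
    qed
    show "(\<lambda>z. inv enc_task (item_task z)) ` {z\<in>route_items. uses e z} \<subseteq> {a\<in>A. {u, v} \<in> path_edges (R a)}"
    proof (rule image_subsetI)
      fix z assume z: "z \<in> {z\<in>route_items. uses e z}"
      then obtain a j where aj: "a \<in> A" "j < length (R a)" "z = route_item a j" by (auto simp: route_items_def)
      have "Suc j < length (R a)" "{R a ! j, R a ! Suc j} = {u, v}"
        using route_uses[OF aj(1,2) uv(1)] z uv(2) aj(3) by auto
      then have "{u, v} \<in> path_edges (R a)" unfolding path_edges_def by blast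
      then show "inv enc_task (item_task z) \<in> {a\<in>A. {u, v} \<in> path_edges (R a)}"
        using aj by (simp add: route_item_def inv_enc_task)
    qed
    show "val (task_dem (item_task z)) \<le> demand (inv enc_task (item_task z))" if "z \<in> {z\<in>route_items. uses e z}" for z
      using that by (auto simp: route_items_def route_item_def inv_enc_task)
  qed (use finite_A in simp)
  also have "\<dots> \<le> capacity I {u, v}" by (rule route_capacity[OF es_edges[OF uv(1)]])
  finally show "(\<Sum>z\<in>{z\<in>route_items. uses e z}. val (task_dem (item_task z))) \<le> length (edge_cap e)"
    using uv(2) by simp
qed

lemma sol_route_items: "sol V {} route_items"
proof -
  have "\<forall>z\<in>route_items. item_loc z \<in> V" using route_items_subset items_loc by blast
  then show ?thesis
    using route_items_subset route_items_valid unfolding sol_def NB_V by auto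
qed


text \<open>A task with distinct endpoints that visits a vertex uses an incident edge and takes at
  least one unit of its capacity. So the tasks visiting the vertex number at most the sum of the
  incident capacities, the second term in \<open>bw_enc\<close>.\<close>

lemma thin_route_items: "thin (route_items)"
  unfolding thin_def
proof
  fix w
  let ?S = "{z\<in>route_items. item_loc z = w}"
  show "card ?S \<le> bw w"
  proof (cases "w \<in> V")
    case False
    then have "?S = {}" using route_items_subset items_loc by blast
    then show ?thesis by (simp only: card.empty)
  next
    case True
    then obtain v where v: "w = enc_nat v" by auto
    let ?T = "{a\<in>A. nf a \<and> v \<in> set (R a)}"
    have "card ?S = (\<Sum>z\<in>?S. 1)" by simp
    also have "\<dots> \<le> (\<Sum>a\<in>?T. 1)"
    proof (rule sum_inj_le[where \<tau> = "\<lambda>z. inv enc_task (item_task z)"])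
      have z: "\<exists>a j. a \<in> A \<and> nf a \<and> j < length (R a) \<and> z = route_item a j \<and> R a ! j = v" if z: "z \<in> ?S" for z
      proof -
        obtain a j where aj: "a \<in> A" "nf a" "j < length (R a)" "z = route_item a j"
          using z unfolding route_items_def by blast
        moreover have "R a ! j = v" using z by (simp add: aj(4) route_item_def v)
        ultimately show ?thesis by blast
      qed
      show "inj_on (\<lambda>z. inv enc_task (item_task z)) ?S"
      proof (rule inj_onI)
        fix y z assume yz: "y \<in> ?S" "z \<in> ?S" "inv enc_task (item_task y) = inv enc_task (item_task z)"
        obtain a j where aj: "y = route_item a j" using z[OF yz(1)] by blast
        obtain b k where bk: "z = route_item b k" using z[OF yz(2)] by blast
        have "a = b" using yz(3) by (simp add: aj bk route_item_def inv_enc_task)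
        then have "item_task y = item_task z" by (simp add: aj bk route_item_def)
        then show "y = z" using valid_unique[OF route_items_valid, of y z] yz(1,2) True by auto
      qed
      show "(\<lambda>z. inv enc_task (item_task z)) ` ?S \<subseteq> ?T"
      proof (rule image_subsetI)
        fix y assume "y \<in> ?S"
        then obtain a j where "a \<in> A" "nf a" "j < length (R a)" "y = route_item a j" "R a ! j = v" using z by blast
        then show "inv enc_task (item_task y) \<in> ?T"
          by (auto simp: route_item_def inv_enc_task)
      qed
    qed (use finite_A in auto)
    also have "\<dots> = card ?T" by simp
    also have "\<dots> \<le> card (\<Union>e\<in>{e\<in>edges G. v \<in> e}. {a\<in>A. nf a \<and> e \<in> path_edges (R a)})"
    proof (rule card_mono)
      show "finite (\<Union>e\<in>{e\<in>edges G. v \<in> e}. {a\<in>A. nf a \<and> e \<in> path_edges (R a)})"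
        using finite_A finite_edges by simp
      show "?T \<subseteq> (\<Union>e\<in>{e\<in>edges G. v \<in> e}. {a\<in>A. nf a \<and> e \<in> path_edges (R a)})"
      proof
        fix a assume a: "a \<in> ?T"
        then obtain j where j: "j < length (R a)" "R a ! j = v" by (auto simp: in_set_conv_nth)
        have aA: "a \<in> A" using a by simp
        have "length (R a) \<noteq> 1"
        proof
          assume "length (R a) = 1"
          then have "source a = sink a" using route(6)[OF aA] route(7)[OF aA] by simp
          then show False using a by simp
        qed
        \<comment> \<open>\<open>v\<close> has a successor on the path or, as the last of at least
          two vertices, a predecessor.\<close>
        then have "Suc j < length (R a) \<or> (j > 0 \<and> Suc (j - 1) < length (R a) \<and> R a ! Suc (j - 1) = v)" using j by auto
        then obtain i where i: "Suc i < length (R a)" "v \<in> {R a ! i, R a ! Suc i}" using j(2) by blast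
        then have "{R a ! i, R a ! Suc i} \<in> path_edges (R a)" unfolding path_edges_def by blast
        then show "a \<in> (\<Union>e\<in>{e\<in>edges G. v \<in> e}. {a\<in>A. nf a \<and> e \<in> path_edges (R a)})"
          using i route(8)[OF aA i(1)] a by blast
      qed
    qed
    also have "\<dots> \<le> (\<Sum>e\<in>{e\<in>edges G. v \<in> e}. card {a\<in>A. nf a \<and> e \<in> path_edges (R a)})"
      using finite_edges by (intro card_UN_le) simp
    also have "\<dots> \<le> (\<Sum>e\<in>{e\<in>edges G. v \<in> e}. capacity I e)"
    proof (rule sum_mono)
      fix e assume e: "e \<in> {e\<in>edges G. v \<in> e}"
      have "card {a\<in>A. nf a \<and> e \<in> path_edges (R a)} = (\<Sum>a\<in>{a\<in>A. nf a \<and> e \<in> path_edges (R a)}. 1)" by simp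
      also have "\<dots> \<le> (\<Sum>a\<in>{a\<in>A. e \<in> path_edges (R a)}. demand a)"
        by (rule sum_inj_le[where \<tau> = "\<lambda>a. a"]) (use finite_A in auto)
      also have "\<dots> \<le> capacity I e" using route_capacity e by blast
      finally show "card {a\<in>A. nf a \<and> e \<in> path_edges (R a)} \<le> capacity I e" .
    qed
    finally show ?thesis unfolding v bw_enc by simp
  qed
qed

lemma sum_profit_le: "(\<Sum>a\<in>A. profit a) \<le> sum wt (route_items) + (\<Sum>p\<leftarrow>free_profits x. val p)"
proof -
  have "(\<Sum>a\<in>A. profit a) = (\<Sum>a\<in>{a\<in>A. nf a}. profit a) + (\<Sum>a\<in>{a\<in>A. \<not> nf a}. profit a)"
  proof -
    have "A = {a\<in>A. nf a} \<union> {a\<in>A. \<not> nf a}" by blast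
    then show ?thesis using finite_A by (subst sum.union_disjoint[symmetric]) auto
  qed
  also have "(\<Sum>a\<in>{a\<in>A. nf a}. profit a) \<le> sum wt (route_items)"
  proof (rule sum_inj_le[where \<tau> = "\<lambda>a. route_item a 0"])
    have ne: "0 < length (R a)" if "a \<in> A" for a using route(3)[OF that] by simp
    show "inj_on (\<lambda>a. route_item a 0) {a\<in>A. nf a}"
    proof (rule inj_onI)
      fix a b assume "route_item a 0 = route_item b 0"
      then have "item_task (route_item a 0) = item_task (route_item b 0)" by simp
      then show "a = b" by (simp add: route_item_def)
    qed
    show "(\<lambda>a. route_item a 0) ` {a\<in>A. nf a} \<subseteq> route_items"
      using ne by (auto simp: route_items_def)
    show "finite (route_items)" using route_items_subset by (rule finite_subset) simp
    show "profit a \<le> wt (route_item a 0)" if "a \<in> {a\<in>A. nf a}" for a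
      using that route(6)[of a] by (simp add: wt_def route_item_def)
  qed
  also have "(\<Sum>a\<in>{a\<in>A. \<not> nf a}. profit a) \<le> (\<Sum>a\<in>{a\<in>tasks I. \<not> nf a \<and> routable a}. profit a)"
  proof (rule sum_mono2)
    show "{a\<in>A. \<not> nf a} \<subseteq> {a\<in>tasks I. \<not> nf a \<and> routable a}"
      using A route(1,2) unfolding routable_def by blast
  qed (use finite_tasks in auto)
  finally show ?thesis unfolding sum_free_profits by simp
qed

end

lemma enough_iff:
  assumes U: "contains_words K U"
    and results: "results x K U \<noteq> []"
  shows "enough x K U \<longleftrightarrow> uf_yes I"
proof
  assume "enough x K U"
  then obtain \<Psi> where "sol V {} \<Psi>" "val (in_target x) \<le> sum wt \<Psi> + (\<Sum>p\<leftarrow>free_profits x. val p)"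
    using enough_sound[OF results] by blast
  then show "uf_yes I" using sol_imp_yes by simp
next
  assume "uf_yes I"
  then obtain A R where A: "A \<subseteq> tasks I" and R: "flow_routing I A R" and p: "target I \<le> (\<Sum>a\<in>A. profit a)"
    unfolding uf_yes_def by blast
  show "enough x K U"
  proof (rule enough_complete)
    show "val (in_target x) \<le> sum wt (route_items A R) + (\<Sum>p\<leftarrow>free_profits x. val p)"
      using le_trans[OF p sum_profit_le[OF A R]] by simp
  qed (fact U results sol_route_items[OF A R] thin_route_items[OF A R])+
qed

text \<open>\<open>LEAST\<close> yields an attained value only if some decomposition exists; a
  single node whose bag holds all vertices is one.\<close>

lemma treewidth_decomposition:
  obtains T bag where "tree_decomposition G T bag" "width T bag = treewidth G"
proof -
  let ?T = "\<lparr>verts = {0::nat}, edges = {}\<rparr>"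
  have single: "is_connected H" if "verts H \<subseteq> {0::nat}" for H :: "nat sgraph"
    unfolding is_connected_def
  proof (intro ballI)
    fix u v assume "u \<in> verts H" "v \<in> verts H"
    then have "is_path H u v [0]" using that by (auto simp: is_path_def)
    then show "\<exists>p. is_path H u v p" by blast
  qed
  have "is_tree ?T"
    using single[of ?T] by (auto simp: is_tree_def simple_graph_def is_cycle_def)
  then have "tree_decomposition G ?T (\<lambda>_. verts G)"
    unfolding tree_decomposition_def using graph_facts(2) by (auto intro!: single simp: induced_def)
  then have "\<exists>k T bag. tree_decomposition G T bag \<and> width T bag = k" by blast
  then have "\<exists>T bag. tree_decomposition G T bag \<and> width T bag = treewidth G"
    unfolding treewidth_def by (rule LeastI_ex)
  then show ?thesis using that by blast
qed

lemma results_nonempty_treewidth: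
  assumes U: "contains_words K U"
    and K: "(treewidth G + 1) * (1 + max_capacity I * max_degree G) \<le> length (dec_list K)"
  shows "results x K U \<noteq> []"
proof (rule results_nonempty[OF U])
  obtain T bag where dec: "tree_decomposition G T bag" and w: "width T bag = treewidth G"
    by (rule treewidth_decomposition)
  note d = dec[unfolded tree_decomposition_def]
  have tree: "is_tree T" using d by blast
  have finT: "finite (verts T)" using tree by (simp add: is_tree_def simple_graph_def)
  let ?bag = "\<lambda>i. enc_nat ` bag i"
  show "solvable (length (dec_list K)) (Suc (length (in_verts x))) (V)"
  proof (rule solvable_verts[OF tree, of ?bag])
    show "(\<Union>i\<in>verts T. ?bag i) = V"
      using d unfolding set_in_verts by blast
    show "\<exists>i\<in>verts T. u \<in> ?bag i \<and> v \<in> ?bag i" if uv: "adj x u v" for u v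
    proof -
      obtain a b where "u = enc_nat a" "v = enc_nat b" using adj_verts[OF uv] by auto
      then show ?thesis using uv d by fastforce
    qed
    show "is_connected (induced T {i. v \<in> ?bag i})" if v: "v \<in> V" for v
    proof -
      obtain a where a: "v = enc_nat a" "a \<in> verts G" using v unfolding set_in_verts by blast
      then have "{i. v \<in> ?bag i} = {i. a \<in> bag i}" by auto
      then show ?thesis using d a by simp
    qed
    show "(\<Sum>v\<in>?bag i. bw v) \<le> length (dec_list K)" if i: "i \<in> verts T" for i
    proof -
      have sub: "bag i \<subseteq> verts G" using d i by blast
      have "card (bag i) \<le> Max ((\<lambda>i. card (bag i)) ` verts T)"
        using finT i by (intro Max_ge) auto
      \<comment> \<open>\<open>m \<le> m - 1 + 1\<close> holds also for \<open>m = 0\<close>, so the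
        truncated subtraction in \<open>width\<close> does no harm.\<close>
      then have card: "card (bag i) \<le> treewidth G + 1" using w unfolding width_def by simp
      have "(\<Sum>v\<in>?bag i. bw v) = (\<Sum>v\<in>bag i. bw (enc_nat v))"
        by (subst sum.reindex) (auto simp: inj_on_def)
      also have "\<dots> \<le> card (bag i) * (1 + max_capacity I * max_degree G)"
        using sum_bounded_above[of "bag i" "\<lambda>v. bw (enc_nat v)" "1 + max_capacity I * max_degree G"] bw_le sub by auto
      also have "\<dots> \<le> (treewidth G + 1) * (1 + max_capacity I * max_degree G)"
        using card by (rule mult_le_mono1)
      finally show ?thesis using K by simp
    qed
  qed
qed

end

section \<open>Running time\<close>

fun all_words :: "sexp \<Rightarrow> nat \<Rightarrow> sexp list" where
  "all_words x 0 = [NIL]"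
| "all_words x (Suc k) = words x (all_words x k)"

lemma all_words_complete:
  "set l \<subseteq> set (letters x) \<Longrightarrow> length l \<le> k \<Longrightarrow> enc_list l \<in> set (all_words x k)"
proof (induction l arbitrary: k)
  case Nil
  then show ?case by (cases k) (auto simp: words_def)
next
  case (Cons a l)
  then obtain k' where "k = Suc k'" by (cases k) auto
  then show ?case using Cons by (auto simp: words_def)
qed

lemma size_words: "size (enc_list (words x U)) \<le> 1 + 2 * size (enc_list (letters x)) * size (enc_list U)"
proof -
  have row: "size (enc_list (map (CONS a) U)) \<le> (size a + 2) * size (enc_list U)" for a
  proof (induction U)
    case (Cons l U)
    have "size a + 2 + size l \<le> (size a + 2) * Suc (size l)" by simp
    then show ?case using Cons by (simp add: distrib_left)
  qed simp
  have "size (enc_list (concat (map (\<lambda>a. map (CONS a) U) as))) \<le> 2 * size (enc_list as) * size (enc_list U)" for as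
  proof (induction as)
    case (Cons a as)
    have "(size a + 2) * size (enc_list U) \<le> (2 * size a + 2) * size (enc_list U)"
      by (rule mult_le_mono1) simp
    then show ?case using Cons row[of a] by (simp add: size_enc_list_append distrib_right)
  qed simp
  from this[of "letters x"] show ?thesis by (simp add: words_def)
qed

lemma size_all_words: "size (enc_list (all_words x k)) \<le> (1 + 2 * size (enc_list (letters x))) ^ Suc k"
proof (induction k)
  case (Suc k)
  let ?L = "size (enc_list (letters x))"
  have "size (enc_list (all_words x (Suc k))) \<le> 1 + 2 * ?L * size (enc_list (all_words x k))"
    using size_words by simp
  also have "\<dots> \<le> (1 + 2 * ?L) ^ Suc k + 2 * ?L * (1 + 2 * ?L) ^ Suc k"
    by (intro add_mono mult_le_mono Suc.IH one_le_power) auto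
  also have "\<dots> = (1 + 2 * ?L) ^ Suc (Suc k)" by simp
  finally show ?case .
qed simp

definition loop_state :: "sexp \<Rightarrow> nat \<Rightarrow> sexp" where
  "loop_state x k = CONS (CONS NIL NIL) (CONS x (CONS (enc_unary k) (enc_list (all_words x k))))"

lemma loop_state_0: "loop_state x 0 = CONS (CONS NIL NIL) (CONS x (CONS NIL (CONS NIL NIL)))"
  by (simp add: loop_state_def enc_unary_def)

lemma round_step_loop_state:
  "round_step (loop_state x k) = (if results x (enc_unary k) (enc_list (all_words x k)) = [] then loop_state x (Suc k)
     else CONS NIL (enc_bool (enough x (enc_unary k) (enc_list (all_words x k)))))"
  by (simp add: round_step_def loop_state_def enc_unary_Suc Let_def)

lemma round_step_iterate:
  assumes "\<And>j. j < k \<Longrightarrow> results x (enc_unary j) (enc_list (all_words x j)) = []"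
  shows "(round_step ^^ k) (loop_state x 0) = loop_state x k"
  using assms by (induction k) (auto simp: round_step_loop_state)

lemma size_loop_state: "size (loop_state x k) = size x + k + size (enc_list (all_words x k)) + 4"
  by (simp add: loop_state_def)

text \<open>The words dominate: the base \<open>1 + 2 * size (enc_list (letters x))\<close> is below
  \<open>m ^ Suc d\<close>. The surplus in \<open>d + 4\<close> and \<open>8 \<le> m\<close> absorb
  the constants and the summand \<open>k\<close>.\<close>

lemma loop_state_bound:
  assumes L: "size (enc_list (letters x)) \<le> m ^ d" and x: "size x + 2 \<le> m" and m: "8 \<le> m"
  shows "size (loop_state x k) + 2 \<le> m ^ ((d + 4) * Suc k)"
proof -
  have "1 + 2 * size (enc_list (letters x)) \<le> m ^ d + 2 * m ^ d"
    using L m by (intro add_mono) auto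
  also have "\<dots> \<le> m ^ d * m" using m by (simp add: mult.commute)
  finally have "(1 + 2 * size (enc_list (letters x))) ^ Suc k \<le> (m ^ Suc d) ^ Suc k"
    by (intro power_mono) (simp_all add: mult.commute)
  then have U: "size (enc_list (all_words x k)) \<le> m ^ (Suc d * Suc k)"
    using size_all_words[of x k] by (simp only: power_mult)
  have mono: "m ^ i \<le> m ^ (Suc d * Suc k)" if "i \<le> Suc k" for i
    using that m by (intro power_increasing) auto
  have "k \<le> m ^ Suc k"
  proof -
    have "k \<le> 2 ^ k" by (simp add: order.strict_implies_order)
    also have "\<dots> \<le> m ^ k" using m by (intro power_mono) auto
    also have "\<dots> \<le> m ^ Suc k" using m by simp
    finally show ?thesis .
  qed
  then have k: "k \<le> m ^ (Suc d * Suc k)" by (rule le_trans) (rule mono, simp)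
  have m1: "m \<le> m ^ (Suc d * Suc k)" using mono[of 1] by simp
  have "size (loop_state x k) + 2 \<le> m + k + size (enc_list (all_words x k)) + m"
    using x m by (simp add: size_loop_state)
  also have "\<dots> \<le> 4 * m ^ (Suc d * Suc k)" using U k m1 by linarith
  also have "\<dots> \<le> m ^ Suc k * m ^ (Suc d * Suc k)"
  proof (rule mult_le_mono1)
    have "m ^ 1 \<le> m ^ Suc k" using m by (intro power_increasing) auto
    then show "4 \<le> m ^ Suc k" using m unfolding power_one_right by linarith
  qed
  also have "\<dots> = m ^ (Suc (Suc d) * Suc k)" by (simp add: power_add)
  also have "\<dots> \<le> m ^ ((d + 4) * Suc k)" using m by (intro power_increasing mult_le_mono) auto
  finally show ?thesis .
qed

lemma computes_runs:
  assumes "computes p F b"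
  shows "\<exists>n\<le>b e. runs p e n (F e)"
proof -
  let ?s = "(\<lambda>_. NIL)(0 := e) :: state"
  have "wp p (b (?s 0)) (\<lambda>s'. s' 0 = F (?s 0)) ?s" using assms unfolding computes_def by (rule spec)
  then show ?thesis unfolding wp_def runs_def by auto
qed

text \<open>The loop makes \<open>Suc k\<close> rounds, each polynomial in a state whose size has an
  exponent linear in \<open>Suc k\<close>. The total exponent is thus linear too, with a factor
  \<open>E\<close> fixed before the input.\<close>

lemma main_program:
  "\<exists>p E. \<forall>x k. 6 \<le> size x \<longrightarrow> (\<forall>j<k. results x (enc_unary j) (enc_list (all_words x j)) = []) \<longrightarrow>
     results x (enc_unary k) (enc_list (all_words x k)) \<noteq> [] \<longrightarrow>
     decides_in_time p x (size x ^ (E * Suc k)) (enough x (enc_unary k) (enc_list (all_words x k)))"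
proof -
  obtain r b where r: "computes r round_step b" "pbd b" using pt_round_step by (rule ptE)
  obtain c where c: "\<And>e. b e \<le> (size e + 2) ^ c" using r(2) unfolding pbd_def by blast
  have "pt (\<lambda>x. loop_state x 0)" unfolding loop_state_0 by (intro pt_intros)
  then obtain i a where i: "computes i (\<lambda>x. loop_state x 0) a" "pbd a" by (rule ptE)
  obtain c0 where c0: "\<And>e. a e \<le> (size e + 2) ^ c0" using i(2) unfolding pbd_def by blast
  have "pbd (\<lambda>x. size (enc_list (letters x)))" by (intro pt_pbd pt_enc_list ptl_letters pt_id)
  then obtain d where d: "\<And>x. size (enc_list (letters x)) \<le> (size x + 2) ^ d" unfolding pbd_def by blast
  obtain N where N: "N \<notin> insert 0 (vars r)" using fresh_var by (metis finite_vars finite_insert)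
  let ?p = "Seq i (Seq (loop N r) (SetRight 0 0))"
  let ?E = "2 * (c0 + c * (d + 4) + 5)"
  show ?thesis
  proof (intro exI[of _ ?p] exI[of _ ?E] allI impI)
    fix x k
    assume x: "6 \<le> size x" and no: "\<forall>j<k. results x (enc_unary j) (enc_list (all_words x j)) = []"
      and yes: "results x (enc_unary k) (enc_list (all_words x k)) \<noteq> []"
    let ?ans = "enough x (enc_unary k) (enc_list (all_words x k))"
    let ?m = "size x + 2"
    have it: "(round_step ^^ j) (loop_state x 0) = loop_state x j" if "j \<le> k" for j
      using round_step_iterate[of j x] no that by simp
    have final: "(round_step ^^ Suc k) (loop_state x 0) = CONS NIL (enc_bool ?ans)"
      using it[of k] yes by (simp add: round_step_loop_state)
    let ?t = "a x + ((2 + (\<Sum>j<Suc k. b ((round_step ^^ j) (loop_state x 0)) + 2)) + 1)"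
    have "wp ?p ?t (\<lambda>s'. s' 0 = enc_bool ?ans) ((\<lambda>_. NIL)(0 := x))"
    proof (intro wp_Seq computes_wp[OF i(1)])
      fix s' :: state assume s': "s' 0 = loop_state x 0"
      have "\<forall>j<Suc k. left ((round_step ^^ j) (s' 0)) \<noteq> NIL"
        using it unfolding s' by (auto simp: loop_state_def)
      moreover have "left ((round_step ^^ Suc k) (s' 0)) = NIL" unfolding s' final by simp
      ultimately have "wp (loop N r) (2 + (\<Sum>j<Suc k. b ((round_step ^^ j) (s' 0)) + 2))
          (\<lambda>s. s 0 = (round_step ^^ Suc k) (s' 0)) s'"
        using N by (intro wp_loop[where k = "Suc k", OF r(1)]) auto
      then show "wp (loop N r) (2 + (\<Sum>j<Suc k. b ((round_step ^^ j) (loop_state x 0)) + 2))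
          (wp (SetRight 0 0) 1 (\<lambda>s'. s' 0 = enc_bool ?ans)) s'"
        unfolding s' final by (rule wp_mono) (auto intro!: wp_SetRight simp del: One_nat_def)
    qed simp
    then obtain n s where n: "exec ?p ((\<lambda>_. NIL)(0 := x)) n s" "n \<le> ?t" "s 0 = enc_bool ?ans"
      unfolding wp_def by blast
    have "?t \<le> size x ^ (?E * Suc k)"
    proof -
      let ?e = "c * (d + 4) * Suc k"
      have b: "b (loop_state x j) + 2 \<le> 3 * ?m ^ ?e" if "j \<le> k" for j
      proof -
        have "b (loop_state x j) \<le> (size (loop_state x j) + 2) ^ c" by (rule c)
        also have "\<dots> \<le> (?m ^ ((d + 4) * Suc j)) ^ c"
          using x by (intro power_mono loop_state_bound[OF d]) auto
        also have "\<dots> = ?m ^ (c * (d + 4) * Suc j)" by (simp only: power_mult[symmetric] ac_simps)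
        also have "\<dots> \<le> ?m ^ ?e" using that by (intro power_increasing mult_le_mono) auto
        finally have "b (loop_state x j) \<le> ?m ^ ?e" .
        moreover have "1 \<le> ?m ^ ?e" by simp
        ultimately show ?thesis by linarith
      qed
      have "(\<Sum>j<Suc k. b ((round_step ^^ j) (loop_state x 0)) + 2) \<le> (\<Sum>j<Suc k. 3 * ?m ^ ?e)"
        by (rule sum_mono) (use b it in auto)
      also have "\<dots> = Suc k * (3 * ?m ^ ?e)" by simp
      also have "\<dots> \<le> ?m ^ Suc k * (?m * ?m ^ ?e)"
      proof (intro mult_le_mono)
        have "Suc k \<le> 2 ^ Suc k" using less_exp[of "Suc k"] by simp
        also have "\<dots> \<le> ?m ^ Suc k" by (intro power_mono) auto
        finally show "Suc k \<le> ?m ^ Suc k" .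
      qed (use x in auto)
      also have "\<dots> = ?m ^ (Suc k + 1 + ?e)" by (simp only: power_add power_one_right mult.assoc)
      finally have sum: "(\<Sum>j<Suc k. b ((round_step ^^ j) (loop_state x 0)) + 2) \<le> ?m ^ (Suc k + 1 + ?e)" .
      let ?M = "?m ^ ((c0 + c * (d + 4) + 4) * Suc k)"
      have "?t \<le> ?m ^ c0 + ?m ^ (Suc k + 1 + ?e) + 3" using c0[of x] sum by simp
      also have "\<dots> \<le> ?M + ?M + ?m"
        using x by (intro add_mono power_increasing) (auto simp: algebra_simps)
      also have "\<dots> \<le> ?M + ?M + ?M"
        using power_increasing[of 1 "(c0 + c * (d + 4) + 4) * Suc k" ?m] by simp
      also have "\<dots> \<le> ?m * ?M" using x by simp
      also have "\<dots> = ?m ^ (1 + (c0 + c * (d + 4) + 4) * Suc k)" by (simp only: power_add power_one_right)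
      also have "\<dots> \<le> ?m ^ ((c0 + c * (d + 4) + 5) * Suc k)"
        by (intro power_increasing) (auto simp: algebra_simps)
      \<comment> \<open>The base changes from \<open>size x + 2\<close> to \<open>size x\<close>, at
        the cost of doubling the exponent.\<close>
      also have "\<dots> \<le> (size x ^ 2) ^ ((c0 + c * (d + 4) + 5) * Suc k)"
      proof (rule power_mono)
        have "size x + 2 \<le> 2 * size x" using x by simp
        also have "\<dots> \<le> size x * size x" using x by (intro mult_le_mono1) simp
        finally show "size x + 2 \<le> size x ^ 2" by (simp add: power2_eq_square)
      qed simp
      also have "\<dots> = size x ^ (?E * Suc k)" by (simp add: power_mult[symmetric] algebra_simps)
      finally show ?thesis .
    qed
    then show "decides_in_time ?p x (size x ^ (?E * Suc k)) ?ans"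
      unfolding decides_in_time_def runs_def using n
      by (intro exI[of _ n] conjI exI[of _ "enc_bool ?ans"]) auto
  qed
qed

text \<open>The loop stops at some \<open>k\<close> up to the bound of
  \<open>results_nonempty_treewidth\<close>, after \<open>Suc k\<close> rounds.\<close>

definition exponent :: "nat \<Rightarrow> nat \<Rightarrow> nat \<Rightarrow> nat \<Rightarrow> nat" where
  "exponent E c w \<Delta> = E * Suc ((w + 1) * (1 + c * \<Delta>))"

text \<open>Unary numbers are lists of \<open>NIL\<close>, so multiplication is a
  \<open>concat\<close> of equal lists and the closure rules for lists provide the program.\<close>

lemma computable_exponent: "computable3 (exponent E)"
proof -
  let ?M = "\<lambda>x. NIL # concat (map (\<lambda>_. dec_list (left (right (right x)))) (dec_list (left x)))"
  let ?F = "\<lambda>x. concat (map (\<lambda>_. NIL # concat (map (\<lambda>_. ?M x) (NIL # dec_list (left (right x))))) (replicate E NIL))"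
  have rep: "concat (replicate m (replicate n NIL)) = replicate (m * n) NIL" for m n
    by (induction m) (auto simp: replicate_add)
  have M: "?M (enc_list [enc_unary c, enc_unary w, enc_unary \<Delta>]) = replicate (1 + c * \<Delta>) NIL" for c w \<Delta>
    by (simp add: enc_unary_def rep)
  have val: "enc_list (?F (enc_list [enc_unary c, enc_unary w, enc_unary \<Delta>])) = enc_unary (exponent E c w \<Delta>)" for c w \<Delta>
  proof -
    have "NIL # concat (map (\<lambda>_. replicate n NIL) (NIL # replicate w NIL)) = replicate (Suc ((w + 1) * n)) NIL" for n
      by (simp add: rep replicate_add)
    then show ?thesis unfolding M by (simp add: enc_unary_def exponent_def rep del: replicate_Suc map_replicate concat.simps) (simp only: map_replicate rep, simp add: algebra_simps)
  qed
  have "ptl (\<lambda>_. replicate E NIL)" unfolding ptl_def by (rule pt_const)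
  then have "pt (\<lambda>x. enc_list (?F x))" by (intro pt_intros)
  then obtain p b where p: "computes p (\<lambda>x. enc_list (?F x)) b" by (rule ptE)
  show ?thesis unfolding computable3_def
  proof (intro exI[of _ p] allI)
    fix c w \<Delta>
    show "\<exists>n. runs p (enc_list [enc_unary c, enc_unary w, enc_unary \<Delta>]) n (enc_unary (exponent E c w \<Delta>))"
      using computes_runs[OF p, of "enc_list [enc_unary c, enc_unary w, enc_unary \<Delta>]"] unfolding val by blast
  qed
qed

theorem theorem1:
  shows "\<exists>(f :: nat \<Rightarrow> nat \<Rightarrow> nat \<Rightarrow> nat) (p :: prog). computable3 f \<and>
    (\<forall>(I :: uf_instance) (x :: sexp). valid_instance I \<longrightarrow> encodes I x \<longrightarrow>
      decides_in_time p x
        (size x ^ f (max_capacity I) (treewidth (graph I)) (max_degree (graph I)))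
        (uf_yes I))"
proof -
  obtain p E where p: "\<And>x k. 6 \<le> size x \<Longrightarrow> (\<forall>j<k. results x (enc_unary j) (enc_list (all_words x j)) = []) \<Longrightarrow>
     results x (enc_unary k) (enc_list (all_words x k)) \<noteq> [] \<Longrightarrow>
     decides_in_time p x (size x ^ (E * Suc k)) (enough x (enc_unary k) (enc_list (all_words x k)))"
    using main_program by blast
  show ?thesis
  proof (intro exI[of _ "exponent E"] exI[of _ p] conjI allI impI computable_exponent)
    fix I x
    assume "valid_instance I" "encodes I x"
    then obtain vs es as where "uf_encoding I vs es as x"
      unfolding encodes_def uf_encoding_def by blast
    then interpret uf_encoding I vs es as x .
    let ?K = "(treewidth G + 1) * (1 + max_capacity I * max_degree G)"
    let ?P = "\<lambda>k. results x (enc_unary k) (enc_list (all_words x k)) \<noteq> []"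
    have U: "contains_words (enc_unary k) (enc_list (all_words x k))" for k
      using all_words_complete by (simp add: contains_words_def)
    have K: "?P ?K" by (rule results_nonempty_treewidth, rule U) simp_all
    define k where "k = (LEAST k. ?P k)"
    have k: "?P k" unfolding k_def using K by (rule LeastI)
    have kK: "k \<le> ?K" unfolding k_def using K by (rule Least_le)
    have no: "\<forall>j<k. \<not> ?P j" unfolding k_def using not_less_Least by blast
    \<comment> \<open>Five cells of the outer list and the \<open>CONS\<close> of the encoded
      integer.\<close>
    have six: "6 \<le> size x" by (simp add: x_def enc_int_def)
    have "decides_in_time p x (size x ^ (E * Suc k)) (enough x (enc_unary k) (enc_list (all_words x k)))"
      using p[OF six _ k] no by blast
    moreover have "enough x (enc_unary k) (enc_list (all_words x k)) \<longleftrightarrow> uf_yes I"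
      by (rule enough_iff, rule U) (use k in simp_all)
    moreover have "size x ^ (E * Suc k) \<le> size x ^ exponent E (max_capacity I) (treewidth G) (max_degree G)"
      unfolding exponent_def using kK six by (intro power_increasing mult_le_mono) auto
    ultimately show "decides_in_time p x (size x ^ exponent E (max_capacity I) (treewidth G) (max_degree G)) (uf_yes I)"
      unfolding decides_in_time_def using le_trans by blast
  qed
qed

end
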